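(* For $n\ge1$ let $V(n)$ denote the assertion: every convex domain $K\subset\mathbb{R}^{2n}$ satisfies $\mathrm{sys}_n(K)\le 1$. (1) If $V(n)$ holds for some $n>1$, then $V(m)$ holds for every $1\le m\le n$. (2) If there exists a sequence of real numbers $\alpha(n)$ with $\alpha(n)\to1$ as $n\to\infty$ such that for every $n$ and every convex body $K\subset\mathbb{R}^{2n}$ one has $\mathrm{sys}_n(K)\le\alpha(n)$, then $V(n)$ holds for every $n\ge1$.
   Context: A convex body in $\mathbb{R}^d$ is a compact convex set with non-empty interior; "convex domain" and "convex body" are used interchangeably. The space $\mathbb{R}^{2n}$ carries the standard symplectic form $\omega_n=dq\wedge dp$ and standard linear complex structure $J$. Capacity: for a convex body $K\subset\mathbb{R}^{2n}$ with smooth boundary, $c_{\rm EHZ}(K)$ is the minimal symplectic action $A(\gamma)=\int_\gamma\lambda$ ($d\lambda=\omega_n$) among closed characteristics $\gamma$ on $\partial K$, i.e. closed integral curves of the line field $\ker\omega_n|_{\partial K}$ (oriented along $J n_K$, with $n_K$ the outer unit normal). For a general convex body, $c_{\rm EHZ}$ is the extension of this by continuity in the Hausdorff metric; equivalently it is the minimal action among generalized closed characteristics, i.e. non-constant absolutely continuous closed curves $\gamma\subset\partial K$ with $\dot\gamma(t)\in J N_K(\gamma(t))$ for almost every $t$, where $N_K(x)$ is the outer normal cone of $K$ at $x$. Systolic ratio: $\mathrm{sys}_n(K)=\dfrac{c_{\rm EHZ}(K)}{(n!\,\mathrm{Vol}(K))^{1/n}}$, where $\mathrm{Vol}$ is Lebesgue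 measure. The assertion $V(n)$ for all $n$ is the weak version of Viterbo's volume-capacity conjecture. *)

theory Defs
  imports "HOL-Analysis.Analysis"
begin

text \<open>
  The dimension has to be an ordinary variable, since it is quantified over inside hypotheses.
  Following \<^const>\<open>Euclidean_space\<close>, a vector of $\mathbb{R}^d$ is a function
  \<^typ>\<open>nat \<Rightarrow> real\<close> that vanishes at every index \<open>i \<ge> d\<close>. The linear structure is written
  coordinatewise.
\<close>

subsection \<open>Convex bodies\<close>

definition convex_body :: "nat \<Rightarrow> (nat \<Rightarrow> real) set \<Rightarrow> bool" where
  "convex_body d K \<longleftrightarrow>
     compactin (Euclidean_space d) K \<and>
     (\<forall>x\<in>K. \<forall>y\<in>K. \<forall>s\<in>{0..1}. (\<lambda>i. (1 - s) * x i + s * y i) \<in> K) \<and>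
     Euclidean_space d interior_of K \<noteq> {}"

text \<open>
  The product measure lives on functions that are \<^const>\<open>undefined\<close> outside \<open>{..<d}\<close>, hence the
  restriction map, which identifies the two models of $\mathbb{R}^d$.
\<close>

definition vol :: "nat \<Rightarrow> (nat \<Rightarrow> real) set \<Rightarrow> real" where
  "vol d K = measure (PiM {..<d} (\<lambda>_. lborel)) ((\<lambda>x. restrict x {..<d}) ` K)"

definition outer_normal_cone ::
    "nat \<Rightarrow> (nat \<Rightarrow> real) set \<Rightarrow> (nat \<Rightarrow> real) \<Rightarrow> (nat \<Rightarrow> real) set" where
  "outer_normal_cone d K x =
     {v \<in> topspace (Euclidean_space d). \<forall>y\<in>K. (\<Sum>i<d. v i * (y i - x i)) \<le> 0}"


subsection \<open>The standard symplectic structure\<close>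

text \<open>
  Coordinates on $\mathbb{R}^{2n}$ are interleaved: \<open>x (2 * j)\<close> is $q_j$ and \<open>x (2 * j + 1)\<close> is
  $p_j$, for \<open>j < n\<close>. The complex structure is multiplication by $i$ under $z_j = q_j + i p_j$,
  that is $J(q,p) = (-p,q)$, so that \<open>symp_form n v (cstruct v)\<close> is the squared norm of \<open>v\<close>.
\<close>

definition symp_form :: "nat \<Rightarrow> (nat \<Rightarrow> real) \<Rightarrow> (nat \<Rightarrow> real) \<Rightarrow> real" where
  "symp_form n u v = (\<Sum>j<n. u (2*j) * v (2*j+1) - u (2*j+1) * v (2*j))"

definition cstruct :: "(nat \<Rightarrow> real) \<Rightarrow> nat \<Rightarrow> real" where
  "cstruct x = (\<lambda>i. if even i then - x (i + 1) else x (i - 1))"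

text \<open>
  The primitive $\lambda = \frac12 \sum_j (q_j\,dp_j - p_j\,dq_j)$ of the symplectic form; on closed
  curves every other primitive has the same integral.
\<close>

definition liouville_form :: "nat \<Rightarrow> (nat \<Rightarrow> real) \<Rightarrow> (nat \<Rightarrow> real) \<Rightarrow> real" where
  "liouville_form n x v = symp_form n x v / 2"


subsection \<open>Closed characteristics and the EHZ capacity\<close>

definition abs_continuous_on_Icc :: "real \<Rightarrow> real \<Rightarrow> (real \<Rightarrow> real) \<Rightarrow> bool" where
  "abs_continuous_on_Icc a b f \<longleftrightarrow>
     (\<forall>\<epsilon>>0. \<exists>\<delta>>0. \<forall>(N::nat) u v.
        (\<forall>k<N. a \<le> u k \<and> u k \<le> v k \<and> v k \<le> b) \<longrightarrow>
        disjoint_family_on (\<lambda>k. {u k<..<v k}) {..<N} \<longrightarrow>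
        (\<Sum>k<N. v k - u k) < \<delta> \<longrightarrow>
        (\<Sum>k<N. \<bar>f (v k) - f (u k)\<bar>) < \<epsilon>)"

text \<open>
  Normal cones are cones and actions are invariant under reparametrization, so fixing the parameter
  interval \<open>{0..1}\<close> is no restriction. Values of \<open>\<gamma>\<close> outside of it are irrelevant.
\<close>

definition gen_closed_characteristic ::
    "nat \<Rightarrow> (nat \<Rightarrow> real) set \<Rightarrow> (real \<Rightarrow> nat \<Rightarrow> real) \<Rightarrow> bool" where
  "gen_closed_characteristic n K \<gamma> \<longleftrightarrow>
     (\<forall>i<2*n. abs_continuous_on_Icc 0 1 (\<lambda>t. \<gamma> t i)) \<and>
     \<gamma> 0 = \<gamma> 1 \<and>
     \<not> \<gamma> constant_on {0..1} \<and>
     \<gamma> ` {0..1} \<subseteq> Euclidean_space (2*n) frontier_of K \<and>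
     (AE t in lebesgue. t \<in> {0..1} \<longrightarrow>
        (\<exists>v\<in>outer_normal_cone (2*n) K (\<gamma> t).
           \<forall>i<2*n. ((\<lambda>s. \<gamma> s i) has_real_derivative cstruct v i) (at t)))"

definition symp_action :: "nat \<Rightarrow> (real \<Rightarrow> nat \<Rightarrow> real) \<Rightarrow> real" where
  "symp_action n \<gamma> =
     (LINT t:{0..1}|lebesgue. liouville_form n (\<gamma> t) (\<lambda>i. deriv (\<lambda>s. \<gamma> s i) t))"

text \<open>
  For a convex body the infimum is over a non-empty set of positive reals and is attained
  (existence of a minimal generalized closed characteristic), so it is the minimal action.
\<close>

definition c_EHZ :: "nat \<Rightarrow> (nat \<Rightarrow> real) set \<Rightarrow> real" where
  "c_EHZ n K = Inf {symp_action n \<gamma> |\<gamma>. gen_closed_characteristic n K \<gamma>}"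

definition sys :: "nat \<Rightarrow> (nat \<Rightarrow> real) set \<Rightarrow> real" where
  "sys n K = c_EHZ n K / root n (fact n * vol (2*n) K)"

text \<open>The assertion $V(n)$.\<close>

definition weak_Viterbo :: "nat \<Rightarrow> bool" where
  "weak_Viterbo n \<longleftrightarrow> (\<forall>K. convex_body (2*n) K \<longrightarrow> sys n K \<le> 1)"

end

theory Submission
  imports Defs "HOL-Probability.Probability"
begin

text \<open>
  Both parts compare dimensions by means of the two-product: if \<open>K\<close> and \<open>T\<close> are the unit balls of the
  gauges \<open>g\<close> and \<open>h\<close>, their two-product is the unit ball of \<open>sqrt (g x\<^sup>2 + h y\<^sup>2)\<close>. Two facts about it
  carry the proof.

  The volume term of the systolic ratio is multiplicative. The Gaussian integral of \<open>exp (- g\<^sup>2)\<close> is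
  \<open>n!\<close> times the volume of the unit ball of \<open>g\<close> in dimension \<open>2n\<close>
  (\<open>gaussian_integral_eq_volume\<close>), and by Tonelli's theorem the Gaussian integral of the product
  gauge is the product of those of the factors (\<open>gaussian_integral_l2_gauge\<close>).

  The set of actions of closed characteristics of the product is the union of the sets for the
  factors (\<open>action_spectrum_l2_gauge\<close>). Along a closed characteristic of the product, the gauge of
  each component is constant (\<open>l2_characteristic_conserves_gauge\<close>), for the Hamiltonian \<open>g\<^sup>2 + h\<^sup>2\<close>
  is a sum of two functions of separate variables. So the component in a factor, rescaled to
  the unit sphere, is a closed characteristic of that factor, and the rescaling exactly compensates
  for the action that the other component contributes. In particular the capacity of a two-product
  is the minimum of the capacities of the factors.

  Consequently every two-power of \<open>K\<close> has the systolic ratio of \<open>K\<close>, in arbitrarily high dimension,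
  so that an asymptotic bound \<open>1\<close> is a bound \<open>1\<close> (\<open>weak_Viterbo_of_asymptotic_bound\<close>). To descend by
  one dimension, the two-product of \<open>K\<close> with a planar disc whose area is the capacity of \<open>K\<close> keeps
  the systolic ratio on the same side of \<open>1\<close> (\<open>weak_Viterbo_Suc\<close>); the capacity of the disc is its
  area, since its closed characteristics wind around the circle a positive number of times
  (\<open>disc_action_lower_bound\<close>).

  The curves are only absolutely continuous. What is used about them is the fundamental theorem of
  calculus for an absolutely continuous function that is differentiable almost everywhere
  (\<open>ac_has_integral\<close>), which yields constancy of the gauges, invariance of the action under
  translation of the body, and the winding number.
\<close>

section \<open>Absolutely continuous functions\<close>

lemma ac_finite_family:
  assumes "abs_continuous_on_Icc a b f" "\<epsilon> > 0"
  shows "\<exists>\<delta>>0. \<forall>(I :: 'i set) u v. finite I \<longrightarrow> (\<forall>i\<in>I. a \<le> u i \<and> u i \<le> v i \<and> v i \<le> b) \<longrightarrow>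
       disjoint_family_on (\<lambda>i. {u i<..<v i}) I \<longrightarrow> (\<Sum>i\<in>I. v i - u i) < \<delta> \<longrightarrow>
       (\<Sum>i\<in>I. \<bar>f (v i) - f (u i)\<bar>) < \<epsilon>"
proof -
  from assms obtain \<delta> where \<delta>: "\<delta> > 0" "\<And>(N::nat) u v.
        (\<forall>k<N. a \<le> u k \<and> u k \<le> v k \<and> v k \<le> b) \<Longrightarrow>
        disjoint_family_on (\<lambda>k. {u k<..<v k}) {..<N} \<Longrightarrow>
        (\<Sum>k<N. v k - u k) < \<delta> \<Longrightarrow> (\<Sum>k<N. \<bar>f (v k) - f (u k)\<bar>) < \<epsilon>"
    unfolding abs_continuous_on_Icc_def by meson
  have "(\<Sum>i\<in>I. \<bar>f (v i) - f (u i)\<bar>) < \<epsilon>"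
    if I: "finite I" "\<forall>i\<in>I. a \<le> u i \<and> u i \<le> v i \<and> v i \<le> b"
      "disjoint_family_on (\<lambda>i. {u i<..<v i}) I" "(\<Sum>i\<in>I. v i - u i) < \<delta>" for I :: "'i set" and u v
  proof -
    obtain h where h: "bij_betw h {..<card I} I"
      using ex_bij_betw_nat_finite[OF I(1)] by (auto simp: atLeast0LessThan)
    have inj: "inj_on h {..<card I}" and im: "h ` {..<card I} = I"
      using h by (auto simp: bij_betw_def)
    have "disjoint_family_on (\<lambda>k. {u (h k)<..<v (h k)}) {..<card I}"
      using I(3) inj im unfolding disjoint_family_on_def inj_on_def by (metis imageI)
    moreover have "(\<Sum>k<card I. v (h k) - u (h k)) = (\<Sum>i\<in>I. v i - u i)"
      by (rule sum.reindex_bij_betw[OF h])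
    moreover have "(\<Sum>k<card I. \<bar>f (v (h k)) - f (u (h k))\<bar>) = (\<Sum>i\<in>I. \<bar>f (v i) - f (u i)\<bar>)"
      by (rule sum.reindex_bij_betw[OF h])
    moreover have "\<forall>k<card I. a \<le> u (h k) \<and> u (h k) \<le> v (h k) \<and> v (h k) \<le> b"
      using I(2) im by auto
    ultimately show ?thesis
      using \<delta>(2)[of "card I" "\<lambda>k. u (h k)" "\<lambda>k. v (h k)"] I(4) by simp
  qed
  with \<delta>(1) show ?thesis by blast
qed

lemma ac_single_interval:
  assumes "abs_continuous_on_Icc a b f" "\<epsilon> > 0"
  shows "\<exists>\<delta>>0. \<forall>u v. a \<le> u \<longrightarrow> u \<le> v \<longrightarrow> v \<le> b \<longrightarrow> v - u < \<delta> \<longrightarrow> \<bar>f v - f u\<bar> < \<epsilon>"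
proof -
  obtain \<delta> where "\<delta> > 0" and \<delta>: "\<forall>(I :: unit set) u v. finite I \<longrightarrow> (\<forall>i\<in>I. a \<le> u i \<and> u i \<le> v i \<and> v i \<le> b) \<longrightarrow>
       disjoint_family_on (\<lambda>i. {u i<..<v i}) I \<longrightarrow> (\<Sum>i\<in>I. v i - u i) < \<delta> \<longrightarrow>
       (\<Sum>i\<in>I. \<bar>f (v i) - f (u i)\<bar>) < \<epsilon>"
    using ac_finite_family[OF assms] by blast
  have "\<bar>f v - f u\<bar> < \<epsilon>" if "a \<le> u" "u \<le> v" "v \<le> b" "v - u < \<delta>" for u v
    using \<delta>[rule_format, of "{()}" "\<lambda>_. u" "\<lambda>_. v"] that by (simp add: disjoint_family_on_def)
  with \<open>\<delta> > 0\<close> show ?thesis by blast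
qed

lemma ac_imp_continuous_on:
  assumes "abs_continuous_on_Icc a b f"
  shows "continuous_on {a..b} f"
  unfolding continuous_on_iff
proof (intro ballI allI impI)
  fix x e :: real assume x: "x \<in> {a..b}" and "e > 0"
  obtain \<delta> where "\<delta> > 0" and \<delta>: "\<forall>u v. a \<le> u \<longrightarrow> u \<le> v \<longrightarrow> v \<le> b \<longrightarrow> v - u < \<delta> \<longrightarrow> \<bar>f v - f u\<bar> < e"
    using ac_single_interval[OF assms \<open>e > 0\<close>] by blast
  have "dist (f y) (f x) < e" if "y \<in> {a..b}" "dist y x < \<delta>" for y
    using \<delta>[rule_format, of x y] \<delta>[rule_format, of y x] that x by (cases "x \<le> y") (auto simp: dist_real_def)
  with \<open>\<delta> > 0\<close> show "\<exists>d>0. \<forall>x'\<in>{a..b}. dist x' x < d \<longrightarrow> dist (f x') (f x) < e" by blast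
qed

text \<open>
  Absolute continuity passes to every function whose increments over short intervals are dominated
  by the increments of finitely many absolutely continuous functions.
\<close>

lemma ac_dominated:
  fixes F :: "'j \<Rightarrow> real \<Rightarrow> real"
  assumes J: "finite J" "\<And>j. j \<in> J \<Longrightarrow> abs_continuous_on_Icc a b (F j)"
    and "\<eta> > 0" and C: "C \<ge> 0"
    and le: "\<And>u v. a \<le> u \<Longrightarrow> u \<le> v \<Longrightarrow> v \<le> b \<Longrightarrow> v - u < \<eta> \<Longrightarrow>
               \<bar>f v - f u\<bar> \<le> C * (\<Sum>j\<in>J. \<bar>F j v - F j u\<bar>)"
  shows "abs_continuous_on_Icc a b f"
  unfolding abs_continuous_on_Icc_def
proof (intro allI impI)
  fix \<epsilon> :: real assume "\<epsilon> > 0"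
  define \<epsilon>' where "\<epsilon>' = \<epsilon> / ((C + 1) * (card J + 1))"
  have "\<epsilon>' > 0" using \<open>\<epsilon> > 0\<close> C by (simp add: \<epsilon>'_def)
  define good where "good j \<delta> \<longleftrightarrow> \<delta> > 0 \<and> (\<forall>(N::nat) u v.
        (\<forall>k<N. a \<le> u k \<and> u k \<le> v k \<and> v k \<le> b) \<longrightarrow>
        disjoint_family_on (\<lambda>k. {u k<..<v k}) {..<N} \<longrightarrow>
        (\<Sum>k<N. v k - u k) < \<delta> \<longrightarrow> (\<Sum>k<N. \<bar>F j (v k) - F j (u k)\<bar>) < \<epsilon>')" for j \<delta>
  have "\<forall>j\<in>J. \<exists>\<delta>. good j \<delta>"
    using J(2) \<open>\<epsilon>' > 0\<close> unfolding abs_continuous_on_Icc_def good_def by blast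
  then obtain \<delta> where good: "\<forall>j\<in>J. good j (\<delta> j)" by (auto dest: bchoice)
  then have \<delta>: "\<delta> j > 0" "\<And>(N::nat) u v.
        (\<forall>k<N. a \<le> u k \<and> u k \<le> v k \<and> v k \<le> b) \<Longrightarrow>
        disjoint_family_on (\<lambda>k. {u k<..<v k}) {..<N} \<Longrightarrow>
        (\<Sum>k<N. v k - u k) < \<delta> j \<Longrightarrow> (\<Sum>k<N. \<bar>F j (v k) - F j (u k)\<bar>) < \<epsilon>'" if "j \<in> J" for j
    using that unfolding good_def by blast+
  define d where "d = Min (insert \<eta> (\<delta> ` J))"
  have d: "d > 0" "d \<le> \<eta>" "\<And>j. j \<in> J \<Longrightarrow> d \<le> \<delta> j"
    using J(1) \<delta>(1) \<open>\<eta> > 0\<close> by (auto simp: d_def)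
  have "(\<Sum>k<N. \<bar>f (v k) - f (u k)\<bar>) < \<epsilon>"
    if uv: "\<forall>k<N. a \<le> u k \<and> u k \<le> v k \<and> v k \<le> b"
      "disjoint_family_on (\<lambda>k. {u k<..<v k}) {..<N}" "(\<Sum>k<N. v k - u k) < d" for N :: nat and u v
  proof -
    have short: "v k - u k < \<eta>" if "k < N" for k
      using member_le_sum[of k "{..<N}" "\<lambda>k. v k - u k"] uv d(2) that by fastforce
    have "(\<Sum>k<N. \<bar>f (v k) - f (u k)\<bar>) \<le> (\<Sum>k<N. C * (\<Sum>j\<in>J. \<bar>F j (v k) - F j (u k)\<bar>))"
      using uv(1) short by (intro sum_mono le) auto
    also have "\<dots> = C * (\<Sum>j\<in>J. \<Sum>k<N. \<bar>F j (v k) - F j (u k)\<bar>)"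
      by (subst sum.swap) (simp add: sum_distrib_left)
    also have "\<dots> \<le> C * (\<Sum>j\<in>J. \<epsilon>')"
    proof (intro mult_left_mono sum_mono C)
      fix j assume "j \<in> J"
      then show "(\<Sum>k<N. \<bar>F j (v k) - F j (u k)\<bar>) \<le> \<epsilon>'"
        using \<delta>(2)[OF \<open>j \<in> J\<close> uv(1,2)] uv(3) d(3)[of j] by force
    qed
    also have "\<dots> < (C + 1) * (card J + 1) * \<epsilon>'"
    proof -
      have "C * card J < (C + 1) * (card J + 1)" using C by (simp add: algebra_simps add_pos_nonneg)
      then show ?thesis using \<open>\<epsilon>' > 0\<close> by simp
    qed
    also have "\<dots> = \<epsilon>" using C by (simp add: \<epsilon>'_def)
    finally show ?thesis .
  qed
  with d(1) show "\<exists>\<delta>>0. \<forall>(N::nat) u v. (\<forall>k<N. a \<le> u k \<and> u k \<le> v k \<and> v k \<le> b) \<longrightarrow>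
        disjoint_family_on (\<lambda>k. {u k<..<v k}) {..<N} \<longrightarrow>
        (\<Sum>k<N. v k - u k) < \<delta> \<longrightarrow> (\<Sum>k<N. \<bar>f (v k) - f (u k)\<bar>) < \<epsilon>" by blast
qed

lemma ac_affine:
  assumes "abs_continuous_on_Icc a b f"
  shows "abs_continuous_on_Icc a b (\<lambda>t. c * f t + k)"
  by (rule ac_dominated[of "{()}" a b "\<lambda>_. f" 1 "\<bar>c\<bar>"])
     (use assms in \<open>auto simp: abs_mult[symmetric] algebra_simps\<close>)

lemma ac_lipschitz:
  assumes "\<And>u v. \<bar>f v - f u\<bar> \<le> C * \<bar>v - u\<bar>"
  shows "abs_continuous_on_Icc a b f"
proof (rule ac_dominated[of "{()}" a b "\<lambda>_ t. t" 1 "\<bar>C\<bar>"])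
  show "abs_continuous_on_Icc a b (\<lambda>t. t)"
    unfolding abs_continuous_on_Icc_def
  proof (intro allI impI exI conjI)
    fix \<epsilon> :: real and N :: nat and u v :: "nat \<Rightarrow> real"
    assume "\<forall>k<N. a \<le> u k \<and> u k \<le> v k \<and> v k \<le> b" and *: "(\<Sum>k<N. v k - u k) < \<epsilon>"
    then have "(\<Sum>k<N. \<bar>v k - u k\<bar>) = (\<Sum>k<N. v k - u k)" by (intro sum.cong) auto
    with * show "(\<Sum>k<N. \<bar>v k - u k\<bar>) < \<epsilon>" by simp
  qed
  show "\<bar>f v - f u\<bar> \<le> \<bar>C\<bar> * (\<Sum>j\<in>{()}. \<bar>v - u\<bar>)" for u v
    using assms[of v u] mult_right_mono[OF abs_ge_self, of "\<bar>v - u\<bar>" C] by simp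
qed auto

lemma tagged_partial_division_real_intervals:
  assumes "p tagged_partial_division_of {a..b::real}"
  shows "\<forall>z\<in>p. a \<le> Inf (snd z) \<and> Inf (snd z) \<le> fst z \<and> fst z \<le> Sup (snd z) \<and> Sup (snd z) \<le> b
            \<and> snd z = {Inf (snd z)..Sup (snd z)}"
    and "disjoint_family_on (\<lambda>z. {Inf (snd z)<..<Sup (snd z)}) p"
proof -
  note D = tagged_partial_division_ofD[OF assms]
  show *: "\<forall>z\<in>p. a \<le> Inf (snd z) \<and> Inf (snd z) \<le> fst z \<and> fst z \<le> Sup (snd z) \<and> Sup (snd z) \<le> b
            \<and> snd z = {Inf (snd z)..Sup (snd z)}"
  proof (intro ballI, clarify)
    fix x K assume xK: "(x, K) \<in> p"
    obtain c d where K: "K = {c..d}" using D(4)[OF xK] by (auto simp: cbox_interval)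
    have "x \<in> {c..d}" "{c..d} \<subseteq> {a..b}" using D(2,3)[OF xK] K by auto
    then show "a \<le> Inf (snd (x,K)) \<and> Inf (snd (x,K)) \<le> fst (x,K) \<and> fst (x,K) \<le> Sup (snd (x,K))
        \<and> Sup (snd (x,K)) \<le> b \<and> snd (x,K) = {Inf (snd (x,K))..Sup (snd (x,K))}"
      using K by auto
  qed
  show "disjoint_family_on (\<lambda>z. {Inf (snd z)<..<Sup (snd z)}) p"
    unfolding disjoint_family_on_def
  proof (intro ballI impI)
    fix z z' assume z: "z \<in> p" "z' \<in> p" "z \<noteq> z'"
    have int: "interior (snd z) = {Inf (snd z)<..<Sup (snd z)}" if "z \<in> p" for z
    proof -
      have "snd z = {Inf (snd z)..Sup (snd z)}" using * that by blast
      then show ?thesis using interior_atLeastAtMost_real[of "Inf (snd z)" "Sup (snd z)"] by simp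
    qed
    have "interior (snd z) \<inter> interior (snd z') = {}"
      using D(5)[of "fst z" "snd z" "fst z'" "snd z'"] z by (metis prod.collapse)
    then show "{Inf (snd z)<..<Sup (snd z)} \<inter> {Inf (snd z')<..<Sup (snd z')} = {}"
      using int z by simp
  qed
qed

lemma sum_lengths_less:
  fixes u v :: "'i \<Rightarrow> real"
  assumes "finite I" "\<forall>i\<in>I. u i \<le> v i \<and> {u i..v i} \<subseteq> T"
    and "disjoint_family_on (\<lambda>i. {u i<..<v i}) I"
    and "T \<in> sets lborel" "emeasure lborel T < ennreal d"
  shows "(\<Sum>i\<in>I. v i - u i) < d"
proof -
  have "ennreal (\<Sum>i\<in>I. v i - u i) = (\<Sum>i\<in>I. emeasure lborel {u i<..<v i})"
    using assms(2) by (simp add: sum_ennreal)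
  also have "\<dots> = emeasure lborel (\<Union>i\<in>I. {u i<..<v i})"
    using assms(1,3) by (intro sum_emeasure) auto
  also have "\<dots> \<le> emeasure lborel T"
  proof (intro emeasure_mono assms)
    show "(\<Union>i\<in>I. {u i<..<v i}) \<subseteq> T"
      using assms(2) greaterThanLessThan_subseteq_atLeastAtMost_iff by (fastforce simp: subset_iff)
  qed
  finally have "ennreal (\<Sum>i\<in>I. v i - u i) < ennreal d" using assms(5) by simp
  then show ?thesis using sum_nonneg[of I "\<lambda>i. v i - u i"] assms(2) by (simp add: ennreal_less_iff)
qed

text \<open>
  The fundamental theorem of calculus holds for absolutely continuous functions as soon as the
  derivative is known to exist almost everywhere. In the gauge integral this is a direct argument:
  intervals tagged off the exceptional null set are controlled by differentiability at the tag, and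
  those tagged in it lie in an open set of small measure, where absolute continuity controls the
  increments.
\<close>

lemma ac_has_integral:
  fixes f g :: "real \<Rightarrow> real"
  assumes ac: "abs_continuous_on_Icc a b f" and ab: "a \<le> b" and N: "negligible N"
    and der: "\<And>x. x \<in> {a..b} - N \<Longrightarrow> (f has_real_derivative g x) (at x)"
  shows "(g has_integral (f b - f a)) {a..b}"
proof -
  define G where "G x = (if x \<in> N then 0 else g x)" for x
  have "(G has_integral (f b - f a)) {a..b}"
    unfolding has_integral_real
  proof (intro allI impI)
    fix e :: real assume "e > 0"
    define e' where "e' = e / (4 * (b - a + 1))"
    have "e' > 0" using \<open>e > 0\<close> ab by (simp add: e'_def)
    have "e' * (4 * (b - a + 1)) = e" using ab by (simp add: e'_def)
    then have e': "e' * (b - a) < e / 2" using \<open>e' > 0\<close> \<open>e > 0\<close> by (simp add: algebra_simps)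
    obtain \<delta> where "\<delta> > 0" and \<delta>: "\<forall>(I :: (real \<times> real set) set) u v. finite I \<longrightarrow>
        (\<forall>i\<in>I. a \<le> u i \<and> u i \<le> v i \<and> v i \<le> b) \<longrightarrow>
        disjoint_family_on (\<lambda>i. {u i<..<v i}) I \<longrightarrow> (\<Sum>i\<in>I. v i - u i) < \<delta> \<longrightarrow>
        (\<Sum>i\<in>I. \<bar>f (v i) - f (u i)\<bar>) < e / 2"
      using ac_finite_family[OF ac half_gt_zero[OF \<open>e > 0\<close>]] by blast
    have N0: "N \<in> null_sets lebesgue" using N by (simp add: negligible_iff_null_sets)
    obtain T where T: "open T" "N \<subseteq> T" "emeasure lebesgue (T - N) < ennreal \<delta>" "(T - N) \<in> lmeasurable"
      by (rule sets_lebesgue_outer_open[of N \<delta>]) (use N0 \<open>\<delta> > 0\<close> in \<open>auto simp: null_setsD2\<close>)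
    have "emeasure lebesgue T = emeasure lebesgue (T - N)"
      using T(1) N0 by (simp add: emeasure_Diff_null_set)
    then have Tm: "emeasure lborel T < ennreal \<delta>" using T by simp
    have "\<exists>r>0. \<forall>y. \<bar>y - x\<bar> < r \<longrightarrow> \<bar>f y - f x - g x * (y - x)\<bar> \<le> e' * \<bar>y - x\<bar>"
      if x: "x \<in> {a..b} - N" for x
      using der[OF x] \<open>e' > 0\<close> unfolding has_field_derivative_def has_derivative_at_alt
      by (auto simp: real_norm_def mult.commute)
    then obtain r where r: "\<And>x. x \<in> {a..b} - N \<Longrightarrow> r x > 0"
      "\<And>x y. x \<in> {a..b} - N \<Longrightarrow> \<bar>y - x\<bar> < r x \<Longrightarrow> \<bar>f y - f x - g x * (y - x)\<bar> \<le> e' * \<bar>y - x\<bar>"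
      by metis
    \<comment> \<open>Intervals tagged in \<open>N\<close> are confined to \<open>T\<close>, all others to the range of first-order
      approximation at their tag.\<close>
    define \<gamma> where "\<gamma> x = (if x \<in> N then T else if x \<in> {a..b} then ball x (r x) else ball x 1)" for x
    have "gauge \<gamma>"
      using T r(1) by (auto simp: gauge_def \<gamma>_def)
    moreover have key: "norm ((\<Sum>(x,k)\<in>p. measure lborel k *\<^sub>R G x) - (f b - f a)) < e"
      if p: "p tagged_division_of {a..b}" and fine: "\<gamma> fine p" for p
    proof -
      have pp: "p tagged_partial_division_of {a..b}" using p by (simp add: tagged_division_of_def)
      have fin: "finite p" using p by auto
      define u v where "u z = Inf (snd z)" and "v z = Sup (snd z)" for z :: "real \<times> real set"
      note P = tagged_partial_division_real_intervals[OF pp, folded u_def v_def]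
      have inc: "(\<Sum>z\<in>p. f (v z) - f (u z)) = f b - f a" "(\<Sum>z\<in>p. v z - u z) = b - a"
        using additive_tagged_division_1[OF ab p, of f] additive_tagged_division_1[OF ab p, of "\<lambda>x. x"]
        by (auto simp: u_def v_def case_prod_beta)
      define p1 where "p1 = {z \<in> p. fst z \<in> N}"
      define p2 where "p2 = {z \<in> p. fst z \<notin> N}"
      have sp: "sum h p = sum h p1 + sum h p2" for h :: "_ \<Rightarrow> real"
      proof -
        have "p = p1 \<union> p2" "p1 \<inter> p2 = {}" "finite p1" "finite p2"
          using fin by (auto simp: p1_def p2_def)
        then show ?thesis by (metis sum.union_disjoint)
      qed
      have c: "measure lborel (snd z) = v z - u z" if "z \<in> p" for z
      proof -
        have "snd z = {u z..v z}" "u z \<le> v z" using P(1) that by fastforce+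
        then show ?thesis using content_real[of "u z" "v z"] by simp
      qed
      \<comment> \<open>Tags in \<open>N\<close>: \<open>G\<close> vanishes there, and absolute continuity bounds the increments.\<close>
      have b1: "\<bar>\<Sum>z\<in>p1. measure lborel (snd z) * G (fst z) - (f (v z) - f (u z))\<bar> < e / 2"
      proof -
        have "(\<Sum>z\<in>p1. \<bar>f (v z) - f (u z)\<bar>) < e / 2"
        proof (rule \<delta>[rule_format])
          show "finite p1" using fin by (simp add: p1_def)
          show "a \<le> u i \<and> u i \<le> v i \<and> v i \<le> b" if "i \<in> p1" for i using P(1) that by (fastforce simp: p1_def)
          show dis: "disjoint_family_on (\<lambda>i. {u i<..<v i}) p1"
            using P(2) by (rule disjoint_family_on_mono[rotated]) (auto simp: p1_def)
          show "(\<Sum>i\<in>p1. v i - u i) < \<delta>"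
          proof (rule sum_lengths_less[OF \<open>finite p1\<close> _ dis _ Tm])
            show "\<forall>i\<in>p1. u i \<le> v i \<and> {u i..v i} \<subseteq> T"
            proof
              fix z assume z: "z \<in> p1"
              have "snd z \<subseteq> \<gamma> (fst z)" using fine z by (metis (no_types, lifting) fineD mem_Collect_eq p1_def prod.collapse)
              then have "snd z \<subseteq> T" using z by (simp add: \<gamma>_def p1_def)
              moreover have "u z \<le> v z" "snd z = {u z..v z}" using P(1) z by (force simp: p1_def)+
              ultimately show "u z \<le> v z \<and> {u z..v z} \<subseteq> T" by simp
            qed
            show "T \<in> sets lborel" using T(1) by simp
          qed
        qed
        moreover have "\<bar>\<Sum>z\<in>p1. measure lborel (snd z) * G (fst z) - (f (v z) - f (u z))\<bar> \<le> (\<Sum>z\<in>p1. \<bar>f (v z) - f (u z)\<bar>)"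
          by (rule order_trans[OF sum_abs]) (auto simp: p1_def G_def intro!: sum_mono)
        ultimately show ?thesis by linarith
      qed
      \<comment> \<open>Tags off \<open>N\<close>: compare both endpoints with the tag.\<close>
      have b2: "\<bar>\<Sum>z\<in>p2. measure lborel (snd z) * G (fst z) - (f (v z) - f (u z))\<bar> \<le> e' * (b - a)"
      proof -
        have "\<bar>measure lborel (snd z) * G (fst z) - (f (v z) - f (u z))\<bar> \<le> e' * (v z - u z)" if z: "z \<in> p2" for z
        proof -
          obtain x where x: "x = fst z" by simp
          have zp: "z \<in> p" and xN: "x \<notin> N" using z x by (auto simp: p2_def)
          have q: "a \<le> u z" "u z \<le> x" "x \<le> v z" "v z \<le> b" "snd z = {u z..v z}" using P(1) zp x by blast+
          have xab: "x \<in> {a..b} - N" using q xN by auto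
          have "snd z \<subseteq> \<gamma> x" using fine zp x by (metis fineD prod.collapse)
          then have "snd z \<subseteq> ball x (r x)" using xN xab by (simp add: \<gamma>_def)
          moreover have "u z \<in> snd z" "v z \<in> snd z" using q by auto
          ultimately have "\<bar>u z - x\<bar> < r x" "\<bar>v z - x\<bar> < r x" by (auto simp: dist_real_def)
          then have 1: "\<bar>f (u z) - f x - g x * (u z - x)\<bar> \<le> e' * (x - u z)"
            and 2: "\<bar>f (v z) - f x - g x * (v z - x)\<bar> \<le> e' * (v z - x)"
            using r(2)[OF xab, of "u z"] r(2)[OF xab, of "v z"] q by auto
          have "measure lborel (snd z) * G (fst z) - (f (v z) - f (u z))
              = (f (u z) - f x - g x * (u z - x)) - (f (v z) - f x - g x * (v z - x))"
            unfolding c[OF zp] using xN x by (simp add: G_def algebra_simps)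
          moreover have "e' * (x - u z) + e' * (v z - x) = e' * (v z - u z)" by (simp add: algebra_simps)
          ultimately show ?thesis using 1 2 by linarith
        qed
        then have "\<bar>\<Sum>z\<in>p2. measure lborel (snd z) * G (fst z) - (f (v z) - f (u z))\<bar> \<le> (\<Sum>z\<in>p2. e' * (v z - u z))"
          by (intro order_trans[OF sum_abs] sum_mono)
        also have "\<dots> \<le> (\<Sum>z\<in>p. e' * (v z - u z))"
        proof (rule sum_mono2[OF fin])
          fix z assume "z \<in> p - p2"
          then have "u z \<le> v z" using P(1) by fastforce
          then show "0 \<le> e' * (v z - u z)" using \<open>e' > 0\<close> by simp
        qed (auto simp: p2_def)
        also have "\<dots> = e' * (b - a)" by (simp add: sum_distrib_left[symmetric] inc)
        finally show ?thesis .
      qed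
      have "(\<Sum>(x,k)\<in>p. measure lborel k *\<^sub>R G x) - (f b - f a)
         = (\<Sum>z\<in>p. measure lborel (snd z) * G (fst z) - (f (v z) - f (u z)))"
        unfolding sum_subtractf[of _ "\<lambda>z. f (v z) - f (u z)"] inc(1) by (simp add: case_prod_beta)
      also have "\<bar>\<dots>\<bar> < e" unfolding sp using b1 b2 e' by linarith
      finally show ?thesis by simp
    qed
    ultimately show "\<exists>\<gamma>. gauge \<gamma> \<and> (\<forall>p. p tagged_division_of {a..b} \<and> \<gamma> fine p \<longrightarrow>
        norm ((\<Sum>(x,k)\<in>p. measure lborel k *\<^sub>R G x) - (f b - f a)) < e)"
      by (intro exI[of _ \<gamma>] conjI allI impI key) auto
  qed
  then show ?thesis
    by (rule has_integral_spike[OF N, rotated]) (auto simp: G_def)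
qed

lemma ac_restrict:
  assumes "abs_continuous_on_Icc a b f" "a \<le> c" "d \<le> b"
  shows "abs_continuous_on_Icc c d f"
  using assms unfolding abs_continuous_on_Icc_def by (meson order_trans)

lemma AE_imp_negligible:
  assumes "AE x in lebesgue. x \<in> {a..b::real} \<longrightarrow> P x"
  shows "\<exists>N. negligible N \<and> a \<in> N \<and> b \<in> N \<and> (\<forall>x\<in>{a..b} - N. P x)"
proof -
  obtain N where N: "N \<in> null_sets lebesgue" "{x \<in> space lebesgue. \<not> (x \<in> {a..b} \<longrightarrow> P x)} \<subseteq> N"
    using assms by (rule AE_E3) auto
  then have "negligible (insert a (insert b N))" by (simp add: negligible_iff_null_sets[symmetric])
  moreover have "\<forall>x\<in>{a..b} - insert a (insert b N). P x" using N(2) by auto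
  ultimately show ?thesis by blast
qed

lemma ac_zero_derivative_imp_constant:
  assumes ac: "abs_continuous_on_Icc 0 1 f"
    and der: "AE t in lebesgue. t \<in> {0..1} \<longrightarrow> (f has_real_derivative 0) (at t)"
    and t: "t \<in> {0..1}"
  shows "f t = f 0"
proof -
  obtain N where N: "negligible N" "\<And>x. x \<in> {0..1} - N \<Longrightarrow> (f has_real_derivative 0) (at x)"
    using AE_imp_negligible[OF der] by blast
  have "((\<lambda>_. 0) has_integral (f t - f 0)) {0..t}"
    by (rule ac_has_integral[OF ac_restrict[OF ac] _ N(1)]) (use t N in auto)
  moreover have "((\<lambda>_. 0::real) has_integral 0) {0..t}" by simp
  ultimately show ?thesis using has_integral_unique by fastforce
qed

text \<open>
  An absolutely continuous function has bounded variation on short intervals, hence an absolutely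
  integrable derivative there; finitely many short intervals cover the domain.
\<close>

lemma ac_derivative_absolutely_integrable:
  fixes f g :: "real \<Rightarrow> real"
  assumes ac: "abs_continuous_on_Icc a b f" and ab: "a \<le> b" and N: "negligible N"
    and der: "\<And>x. x \<in> {a..b} - N \<Longrightarrow> (f has_real_derivative g x) (at x)"
  shows "g absolutely_integrable_on {a..b}"
proof -
  have hi: "(g has_integral (f d - f c)) {c..d}" if "a \<le> c" "c \<le> d" "d \<le> b" for c d
    by (rule ac_has_integral[OF ac_restrict[OF ac] _ N]) (use that der in auto)
  obtain \<delta> where "\<delta> > 0" and \<delta>: "\<forall>(I :: real set set) u v. finite I \<longrightarrow>
        (\<forall>i\<in>I. a \<le> u i \<and> u i \<le> v i \<and> v i \<le> b) \<longrightarrow>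
        disjoint_family_on (\<lambda>i. {u i<..<v i}) I \<longrightarrow> (\<Sum>i\<in>I. v i - u i) < \<delta> \<longrightarrow>
        (\<Sum>i\<in>I. \<bar>f (v i) - f (u i)\<bar>) < 1"
    using ac_finite_family[OF ac zero_less_one] by blast
  have short: "g absolutely_integrable_on {c..d}" if cd: "a \<le> c" "c \<le> d" "d \<le> b" "d - c < \<delta>" for c d
  proof -
    have "(\<Sum>K\<in>D. norm (integral K g)) \<le> 1" if D: "D division_of (cbox c d)" for D
    proof -
      have K: "a \<le> Inf K \<and> Inf K \<le> Sup K \<and> Sup K \<le> b \<and> K = {Inf K..Sup K} \<and> c \<le> Inf K \<and> Sup K \<le> d" if KD: "K \<in> D" for K
      proof -
        obtain s t where st: "K = {s..t}" using division_ofD(4)[OF D KD] by (auto simp: cbox_interval)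
        moreover have "K \<noteq> {}" "K \<subseteq> {c..d}" using division_ofD(2,3)[OF D KD] by auto
        ultimately show ?thesis using cd by auto
      qed
      have dis: "disjoint_family_on (\<lambda>K. {Inf K<..<Sup K}) D"
        unfolding disjoint_family_on_def
      proof (intro ballI impI)
        fix K L assume KL: "K \<in> D" "L \<in> D" "K \<noteq> L"
        have "interior K \<inter> interior L = {}" using division_ofD(5)[OF D] KL by auto
        moreover have "interior M = {Inf M<..<Sup M}" if "M \<in> D" for M
        proof -
          have "M = {Inf M..Sup M}" using K[OF that] by blast
          then show ?thesis using interior_atLeastAtMost_real[of "Inf M" "Sup M"] by simp
        qed
        ultimately show "{Inf K<..<Sup K} \<inter> {Inf L<..<Sup L} = {}" using KL by simp
      qed
      have "(\<Sum>K\<in>D. norm (integral K g)) = (\<Sum>K\<in>D. \<bar>f (Sup K) - f (Inf K)\<bar>)"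
      proof (rule sum.cong)
        fix J assume "J \<in> D"
        then have "(g has_integral (f (Sup J) - f (Inf J))) J" using hi K[of J] by metis
        then show "norm (integral J g) = \<bar>f (Sup J) - f (Inf J)\<bar>" by (simp add: integral_unique)
      qed simp
      also have "\<dots> < 1"
      proof (rule \<delta>[rule_format, OF _ _ dis])
        show "finite D" using D by auto
        show "a \<le> Inf i \<and> Inf i \<le> Sup i \<and> Sup i \<le> b" if "i \<in> D" for i using K that by blast
        have "Sup M - Inf M = measure lborel M" if "M \<in> D" for M
        proof -
          have "M = {Inf M..Sup M}" "Inf M \<le> Sup M" using K[OF that] by blast+
          then show ?thesis using content_real[of "Inf M" "Sup M"] by simp
        qed
        then have "(\<Sum>K\<in>D. Sup K - Inf K) = (\<Sum>K\<in>D. measure lborel K)"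
          by (intro sum.cong) auto
        also have "\<dots> = d - c" using additive_content_division[OF D] cd by simp
        finally show "(\<Sum>K\<in>D. Sup K - Inf K) < \<delta>" using cd by simp
      qed
      finally show ?thesis by simp
    qed
    moreover have "g integrable_on cbox c d" using hi[OF cd(1-3)] by auto
    ultimately show ?thesis using bounded_variation_absolutely_integrable_interval by (metis cbox_interval)
  qed
  \<comment> \<open>The partition points advance by half the admissible length, since \<open>short\<close> needs a strict bound.\<close>
  define w where "w n = min b (a + real n * (\<delta> / 2))" for n :: nat
  have step: "w n \<le> w (Suc n)" "w (Suc n) - w n < \<delta>" "a \<le> w n" "w n \<le> b" for n
  proof -
    have "a + real (Suc n) * (\<delta> / 2) = a + real n * (\<delta> / 2) + \<delta> / 2" by (simp add: algebra_simps)
    moreover have "real n * (\<delta> / 2) \<ge> 0" using \<open>\<delta> > 0\<close> by simp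
    ultimately show "w n \<le> w (Suc n)" "w (Suc n) - w n < \<delta>" "a \<le> w n" "w n \<le> b"
      using ab \<open>\<delta> > 0\<close> unfolding w_def by linarith+
  qed
  have "g absolutely_integrable_on {a..w n}" for n
  proof (induction n)
    case 0
    show ?case using short[of a a] ab \<open>\<delta> > 0\<close> by (simp add: w_def min_absorb2)
  next
    case (Suc n)
    show ?case
      by (rule absolutely_integrable_on_combine[OF Suc short])
         (use step[of n] step[of "Suc n"] in auto)
  qed
  moreover obtain n :: nat where "real n * (\<delta> / 2) > b - a"
    using reals_Archimedean3[OF half_gt_zero[OF \<open>\<delta> > 0\<close>]] by blast
  then have "w n = b" by (simp add: w_def)
  ultimately show ?thesis by metis
qed

section \<open>Convex bodies as unit balls of gauges\<close>

abbreviation coord_space :: "nat \<Rightarrow> (nat \<Rightarrow> real) set" where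
  "coord_space d \<equiv> topspace (Euclidean_space d)"

text \<open>
  The gauge (Minkowski functional) of a convex body around an interior point is a possibly
  asymmetric norm. The two-sided comparison with the sum norm encodes that the body is bounded and
  a neighbourhood of the point.
\<close>

definition asym_norm :: "nat \<Rightarrow> ((nat \<Rightarrow> real) \<Rightarrow> real) \<Rightarrow> bool" where
  "asym_norm d g \<longleftrightarrow>
     (\<forall>x\<in>coord_space d. \<forall>c\<ge>0. g (\<lambda>i. c * x i) = c * g x) \<and>
     (\<forall>x\<in>coord_space d. \<forall>y\<in>coord_space d. g (\<lambda>i. x i + y i) \<le> g x + g y) \<and>
     (\<exists>c>0. \<forall>x\<in>coord_space d. c * (\<Sum>i<d. \<bar>x i\<bar>) \<le> g x) \<and>
     (\<exists>C\<ge>0. \<forall>x\<in>coord_space d. g x \<le> C * (\<Sum>i<d. \<bar>x i\<bar>))"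

definition gauge_ball :: "nat \<Rightarrow> (nat \<Rightarrow> real) \<Rightarrow> ((nat \<Rightarrow> real) \<Rightarrow> real) \<Rightarrow> (nat \<Rightarrow> real) set" where
  "gauge_ball d p g = {x \<in> coord_space d. g (\<lambda>i. x i - p i) \<le> 1}"

lemma in_coord_space: "x \<in> coord_space d \<longleftrightarrow> (\<forall>i\<ge>d. x i = 0)"
  by (simp add: topspace_Euclidean_space)

lemma coord_space_closed [simp]:
  "x \<in> coord_space d \<Longrightarrow> y \<in> coord_space d \<Longrightarrow> (\<lambda>i. x i + y i) \<in> coord_space d"
  "x \<in> coord_space d \<Longrightarrow> y \<in> coord_space d \<Longrightarrow> (\<lambda>i. x i - y i) \<in> coord_space d"
  "x \<in> coord_space d \<Longrightarrow> (\<lambda>i. c * x i) \<in> coord_space d"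
  "x \<in> coord_space d \<Longrightarrow> (\<lambda>i. x i / c) \<in> coord_space d"
  "(\<lambda>i. 0) \<in> coord_space d"
  by (auto simp: in_coord_space)

lemma openin_Euclidean_space_cube:
  "openin (Euclidean_space d) U \<longleftrightarrow> U \<subseteq> coord_space d \<and>
     (\<forall>x\<in>U. \<exists>\<epsilon>>0. \<forall>y\<in>coord_space d. (\<forall>i<d. \<bar>y i - x i\<bar> < \<epsilon>) \<longrightarrow> y \<in> U)"
  (is "?L \<longleftrightarrow> ?R")
proof
  assume L: ?L
  have "\<exists>\<epsilon>>0. \<forall>y\<in>coord_space d. (\<forall>i<d. \<bar>y i - x i\<bar> < \<epsilon>) \<longrightarrow> y \<in> U" if x: "x \<in> U" for x
  proof -
    obtain T where T: "openin (powertop_real UNIV) T" "U = T \<inter> {x. \<forall>i\<ge>d. x i = 0}"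
      using L unfolding Euclidean_space_def openin_subtopology by blast
    obtain X where X: "x \<in> (\<Pi>\<^sub>E i\<in>UNIV. X i)" "\<And>i. open (X i)" "(\<Pi>\<^sub>E i\<in>UNIV. X i) \<subseteq> T"
      using product_topology_open_contains_basis[OF T(1), of x] T(2) x by auto
    have "\<exists>e>0. \<forall>y. \<bar>y - x i\<bar> < e \<longrightarrow> y \<in> X i" for i
      using X(1,2) by (metis PiE_mem UNIV_I dist_real_def open_dist)
    then obtain e where e: "\<And>i. e i > 0" "\<And>i y. \<bar>y - x i\<bar> < e i \<Longrightarrow> y \<in> X i" by metis
    define \<epsilon> where "\<epsilon> = Min (insert 1 (e ` {..<d}))"
    have "\<epsilon> > 0" "\<And>i. i < d \<Longrightarrow> \<epsilon> \<le> e i" using e(1) by (auto simp: \<epsilon>_def)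
    moreover have "y \<in> U" if y: "y \<in> coord_space d" "\<forall>i<d. \<bar>y i - x i\<bar> < \<epsilon>" for y
    proof -
      have "y i \<in> X i" for i
      proof (cases "i < d")
        case True
        then show ?thesis using e(2)[of "y i" i] y(2) \<open>\<And>i. i < d \<Longrightarrow> \<epsilon> \<le> e i\<close>[of i] by fastforce
      next
        case False
        then have "y i = x i" using y(1) x T(2) by (auto simp: in_coord_space)
        then show ?thesis using e(2)[of "y i" i] e(1)[of i] by simp
      qed
      then show ?thesis using X(3) T(2) y(1) by (auto simp: in_coord_space)
    qed
    ultimately show ?thesis by blast
  qed
  then show ?R using openin_subset[OF L] by blast
next
  assume R: ?R
  show ?L
  proof (subst openin_subopen, intro ballI)
    fix x assume x: "x \<in> U"
    then obtain \<epsilon> where \<epsilon>: "\<epsilon> > 0" "\<forall>y\<in>coord_space d. (\<forall>i<d. \<bar>y i - x i\<bar> < \<epsilon>) \<longrightarrow> y \<in> U"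
      using R by blast
    define T where "T = {y. \<forall>i\<in>{..<d}. y i \<in> ball (x i) \<epsilon>}"
    have "open T" unfolding T_def using product_topology_basis'[of "{..<d}" "\<lambda>i. ball (x i) \<epsilon>" "\<lambda>i. i"] by simp
    then have "openin (Euclidean_space d) (T \<inter> coord_space d)"
      unfolding Euclidean_space_def euclidean_product_topology topspace_subtopology
      by (auto simp: openin_subtopology)
    moreover have "x \<in> T \<inter> coord_space d" using \<epsilon>(1) x R by (auto simp: T_def)
    moreover have "T \<inter> coord_space d \<subseteq> U"
      using \<epsilon>(2) by (auto simp: T_def dist_real_def abs_minus_commute)
    ultimately show "\<exists>T. openin (Euclidean_space d) T \<and> x \<in> T \<and> T \<subseteq> U" by blast
  qed
qed

context
  fixes d :: nat and g :: "(nat \<Rightarrow> real) \<Rightarrow> real"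
  assumes g: "asym_norm d g"
begin

lemma asym_norm_scale: "x \<in> coord_space d \<Longrightarrow> c \<ge> 0 \<Longrightarrow> g (\<lambda>i. c * x i) = c * g x"
  and asym_norm_triangle: "x \<in> coord_space d \<Longrightarrow> y \<in> coord_space d \<Longrightarrow> g (\<lambda>i. x i + y i) \<le> g x + g y"
  and asym_norm_lower: "\<exists>c>0. \<forall>x\<in>coord_space d. c * (\<Sum>i<d. \<bar>x i\<bar>) \<le> g x"
  and asym_norm_upper: "\<exists>C\<ge>0. \<forall>x\<in>coord_space d. g x \<le> C * (\<Sum>i<d. \<bar>x i\<bar>)"
  using g unfolding asym_norm_def by blast+

lemma asym_norm_nonneg: "x \<in> coord_space d \<Longrightarrow> g x \<ge> 0"
  using asym_norm_lower by (meson abs_ge_zero dual_order.trans mult_nonneg_nonneg less_imp_le sum_nonneg)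

lemma asym_norm_zero: "g (\<lambda>i. 0) = 0"
  using asym_norm_scale[of "\<lambda>i. 0" 0] by simp

lemma asym_norm_eq_0D:
  assumes "x \<in> coord_space d" "g x = 0"
  shows "x = (\<lambda>i. 0)"
proof -
  obtain c where "c > 0" "c * (\<Sum>i<d. \<bar>x i\<bar>) \<le> 0" using asym_norm_lower assms by metis
  then have "(\<Sum>i<d. \<bar>x i\<bar>) \<le> 0" by (simp add: mult_le_0_iff)
  then have "(\<Sum>i<d. \<bar>x i\<bar>) = 0" by (simp add: antisym sum_nonneg)
  then have "\<forall>i<d. x i = 0" by (simp add: sum_nonneg_eq_0_iff)
  then show ?thesis using assms(1) by (intro ext) (metis in_coord_space not_le)
qed

lemma asym_norm_lipschitz:
  "\<exists>C\<ge>0. \<forall>x\<in>coord_space d. \<forall>y\<in>coord_space d. \<bar>g x - g y\<bar> \<le> C * (\<Sum>i<d. \<bar>x i - y i\<bar>)"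
proof -
  obtain C where C: "C \<ge> 0" "\<And>x. x \<in> coord_space d \<Longrightarrow> g x \<le> C * (\<Sum>i<d. \<bar>x i\<bar>)"
    using asym_norm_upper by blast
  have "g x - g y \<le> C * (\<Sum>i<d. \<bar>x i - y i\<bar>)" if "x \<in> coord_space d" "y \<in> coord_space d" for x y
    using asym_norm_triangle[of y "\<lambda>i. x i - y i"] C(2)[of "\<lambda>i. x i - y i"] that by simp
  from this this[of _ _] show ?thesis
    using C(1) by (intro exI[of _ C]) (force simp: abs_le_iff abs_minus_commute)
qed

lemma continuous_on_asym_norm: "continuous_on UNIV (\<lambda>x. g (\<lambda>i. if i < d then x i - p i else 0))"
proof -
  define h where "h x = g (\<lambda>i. if i < d then x i - p i else 0)" for x
  obtain C where C: "\<And>x y. x \<in> coord_space d \<Longrightarrow> y \<in> coord_space d \<Longrightarrow> \<bar>g x - g y\<bar> \<le> C * (\<Sum>i<d. \<bar>x i - y i\<bar>)"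
    using asym_norm_lipschitz by blast
  have hC: "\<bar>h y - h x\<bar> \<le> C * (\<Sum>i<d. \<bar>y i - x i\<bar>)" for x y
    using C[of "\<lambda>i. if i < d then y i - p i else 0" "\<lambda>i. if i < d then x i - p i else 0"]
    by (simp add: h_def in_coord_space)
  have "(h \<longlongrightarrow> h x) (at x)" for x
  proof -
    have "continuous_on UNIV (\<lambda>y. C * (\<Sum>i<d. \<bar>y i - x i\<bar>))"
      by (intro continuous_intros continuous_on_product_coordinates)
    then have "((\<lambda>y. C * (\<Sum>i<d. \<bar>y i - x i\<bar>)) \<longlongrightarrow> C * (\<Sum>i<d. \<bar>x i - x i\<bar>)) (at x)"
      unfolding continuous_on_def by blast
    then have "((\<lambda>y. C * (\<Sum>i<d. \<bar>y i - x i\<bar>)) \<longlongrightarrow> 0) (at x)" by simp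
    then have "((\<lambda>y. h y - h x) \<longlongrightarrow> 0) (at x)"
      by (rule Lim_null_comparison[rotated]) (use hC in auto)
    then show ?thesis by (simp add: Lim_null[symmetric])
  qed
  then show ?thesis unfolding h_def continuous_on_def by auto
qed

lemma openin_gauge_lt:
  assumes p: "p \<in> coord_space d"
  shows "openin (Euclidean_space d) {x \<in> coord_space d. g (\<lambda>i. x i - p i) < 1}"
proof -
  have "open {x. g (\<lambda>i. if i < d then x i - p i else 0) < 1}"
    by (intro open_Collect_less continuous_on_asym_norm continuous_intros)
  then have "openin (Euclidean_space d) ({x. g (\<lambda>i. if i < d then x i - p i else 0) < 1} \<inter> coord_space d)"
    unfolding Euclidean_space_def euclidean_product_topology topspace_subtopology
    by (auto simp: openin_subtopology)
  moreover have "(\<lambda>i. if i < d then x i - p i else 0) = (\<lambda>i. x i - p i)" if "x \<in> coord_space d" for x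
    using that p by (auto simp: in_coord_space)
  then have "{x. g (\<lambda>i. if i < d then x i - p i else 0) < 1} \<inter> coord_space d
    = {x \<in> coord_space d. g (\<lambda>i. x i - p i) < 1}" by auto
  ultimately show ?thesis by simp
qed

lemma closed_gauge_ball:
  assumes p: "p \<in> coord_space d"
  shows "closed (gauge_ball d p g)"
proof -
  have "closed {x. g (\<lambda>i. if i < d then x i - p i else 0) \<le> 1}"
    by (intro closed_Collect_le continuous_on_asym_norm continuous_intros)
  moreover have "closed (coord_space d)"
    using closedin_Euclidean_space_iff[of d "coord_space d"] by blast
  moreover have "(\<lambda>i. if i < d then x i - p i else 0) = (\<lambda>i. x i - p i)" if "x \<in> coord_space d" for x
    using that p by (auto simp: in_coord_space)
  then have "gauge_ball d p g = {x. g (\<lambda>i. if i < d then x i - p i else 0) \<le> 1} \<inter> coord_space d"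
    by (auto simp: gauge_ball_def)
  ultimately show ?thesis by auto
qed

text \<open>
  A point of the unit sphere is not interior, because moving away from the centre \<open>p\<close> leaves the
  ball at once.
\<close>

lemma frontier_gauge_ball:
  assumes p: "p \<in> coord_space d"
  shows "Euclidean_space d frontier_of gauge_ball d p g = {x \<in> coord_space d. g (\<lambda>i. x i - p i) = 1}"
proof -
  have int: "Euclidean_space d interior_of gauge_ball d p g = {x \<in> coord_space d. g (\<lambda>i. x i - p i) < 1}"
  proof (rule interior_of_unique)
    fix T assume T: "T \<subseteq> gauge_ball d p g" "openin (Euclidean_space d) T"
    show "T \<subseteq> {x \<in> coord_space d. g (\<lambda>i. x i - p i) < 1}"
    proof
      fix x assume "x \<in> T"
      then have x: "x \<in> coord_space d" "g (\<lambda>i. x i - p i) \<le> 1" using T(1) by (auto simp: gauge_ball_def)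
      obtain \<epsilon> where \<epsilon>: "\<epsilon> > 0" "\<And>y. y \<in> coord_space d \<Longrightarrow> (\<forall>i<d. \<bar>y i - x i\<bar> < \<epsilon>) \<Longrightarrow> y \<in> T"
        using T(2) \<open>x \<in> T\<close> unfolding openin_Euclidean_space_cube by blast
      define M where "M = 1 + (\<Sum>i<d. \<bar>x i - p i\<bar>)"
      have M: "M > 0" "\<bar>x i - p i\<bar> < M" if "i < d" for i
        using member_le_sum[of i "{..<d}" "\<lambda>i. \<bar>x i - p i\<bar>"] that sum_nonneg[of "{..<d}" "\<lambda>i. \<bar>x i - p i\<bar>"]
        by (auto simp: M_def)
      have "M > 0" using sum_nonneg[of "{..<d}" "\<lambda>i. \<bar>x i - p i\<bar>"] by (simp add: M_def add_pos_nonneg)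
      define s where "s = \<epsilon> / M"
      have s: "s > 0" using \<epsilon>(1) \<open>M > 0\<close> by (simp add: s_def)
      define y where "y = (\<lambda>i. p i + (1 + s) * (x i - p i))"
      have "y \<in> T"
      proof (rule \<epsilon>(2))
        show "y \<in> coord_space d" using x p by (auto simp: y_def in_coord_space)
        show "\<forall>i<d. \<bar>y i - x i\<bar> < \<epsilon>"
        proof (intro allI impI)
          fix i assume "i < d"
          have "y i - x i = s * (x i - p i)" by (simp add: y_def algebra_simps)
          then have "\<bar>y i - x i\<bar> = s * \<bar>x i - p i\<bar>" using s by (simp add: abs_mult)
          also have "\<dots> < s * M" using M(2)[OF \<open>i < d\<close>] s by simp
          also have "\<dots> = \<epsilon>" using \<open>M > 0\<close> by (simp add: s_def)
          finally show "\<bar>y i - x i\<bar> < \<epsilon>" .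
        qed
      qed
      then have "g (\<lambda>i. y i - p i) \<le> 1" using T(1) by (auto simp: gauge_ball_def)
      moreover have "g (\<lambda>i. y i - p i) = (1 + s) * g (\<lambda>i. x i - p i)"
        using asym_norm_scale[of "\<lambda>i. x i - p i" "1 + s"] x p s by (simp add: y_def)
      ultimately have "(1 + s) * g (\<lambda>i. x i - p i) \<le> 1" by simp
      moreover have "(1 + s) * 1 > 1" using s by simp
      ultimately have "g (\<lambda>i. x i - p i) \<noteq> 1" by force
      then show "x \<in> {x \<in> coord_space d. g (\<lambda>i. x i - p i) < 1}" using x by simp
    qed
  qed (use openin_gauge_lt[OF p] in \<open>auto simp: gauge_ball_def\<close>)
  have "closedin (Euclidean_space d) (gauge_ball d p g)"
    unfolding closedin_Euclidean_space_iff using closed_gauge_ball[OF p] by (auto simp: gauge_ball_def)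
  then have "Euclidean_space d closure_of gauge_ball d p g = gauge_ball d p g"
    by (simp add: closure_of_closedin)
  then have "Euclidean_space d frontier_of gauge_ball d p g
    = gauge_ball d p g - {x \<in> coord_space d. g (\<lambda>i. x i - p i) < 1}"
    unfolding frontier_of_def int by simp
  also have "\<dots> = {x \<in> coord_space d. g (\<lambda>i. x i - p i) = 1}"
    unfolding gauge_ball_def by (rule set_eqI) (simp, metis order_le_less order_less_irrefl)
  finally show ?thesis .
qed

lemma convex_body_gauge_ball: "convex_body d (gauge_ball d (\<lambda>i. 0) g)"
  unfolding convex_body_def
proof (intro conjI ballI)
  let ?K = "gauge_ball d (\<lambda>i. 0) g"
  obtain c where c: "c > 0" "\<And>x. x \<in> coord_space d \<Longrightarrow> c * (\<Sum>i<d. \<bar>x i\<bar>) \<le> g x"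
    using asym_norm_lower by blast
  have "compactin (powertop_real UNIV) (PiE UNIV (\<lambda>i. {- 1 / c..1 / c}))"
    by (simp add: compactin_PiE)
  moreover have "closedin (powertop_real UNIV) ?K"
    using closed_gauge_ball[of "\<lambda>i. 0"] by (simp add: euclidean_product_topology)
  moreover have "?K \<subseteq> PiE UNIV (\<lambda>i. {- 1 / c..1 / c})"
  proof
    fix x assume x: "x \<in> ?K"
    have "\<bar>x i\<bar> \<le> 1 / c" for i
    proof (cases "i < d")
      case True
      have "\<bar>x i\<bar> \<le> (\<Sum>i<d. \<bar>x i\<bar>)" using True by (intro member_le_sum) auto
      also have "c * (\<Sum>i<d. \<bar>x i\<bar>) \<le> 1" using c(2)[of x] x by (auto simp: gauge_ball_def)
      then have "(\<Sum>i<d. \<bar>x i\<bar>) \<le> 1 / c" using c(1) by (simp add: field_simps)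
      finally show ?thesis .
    next
      case False
      then show ?thesis using x c(1) by (auto simp: gauge_ball_def in_coord_space)
    qed
    then show "x \<in> PiE UNIV (\<lambda>i. {- 1 / c..1 / c})" by (auto simp: abs_le_iff minus_le_iff)
  qed
  ultimately have "compactin (powertop_real UNIV) ?K" by (metis closed_compactin)
  then show "compactin (Euclidean_space d) ?K"
    unfolding Euclidean_space_def compactin_subtopology by (auto simp: gauge_ball_def in_coord_space)
  show "(\<lambda>i. (1 - s) * x i + s * y i) \<in> ?K" if xy: "x \<in> ?K" "y \<in> ?K" and s: "s \<in> {0..1}" for x y s
  proof -
    have "g (\<lambda>i. (1 - s) * x i + s * y i) \<le> (1 - s) * g x + s * g y"
      using asym_norm_triangle[of "\<lambda>i. (1 - s) * x i" "\<lambda>i. s * y i"] asym_norm_scale[of x "1 - s"] asym_norm_scale[of y s]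
        xy s by (auto simp: gauge_ball_def)
    also have "\<dots> \<le> (1 - s) * 1 + s * 1"
      using xy s by (intro add_mono mult_left_mono) (auto simp: gauge_ball_def)
    finally show ?thesis using xy by (auto simp: gauge_ball_def in_coord_space)
  qed
  have "{x \<in> coord_space d. g (\<lambda>i. x i - 0) < 1} \<subseteq> Euclidean_space d interior_of ?K"
    by (intro interior_of_maximal openin_gauge_lt) (auto simp: gauge_ball_def)
  then have "(\<lambda>i. 0) \<in> Euclidean_space d interior_of ?K" by (auto simp: asym_norm_zero)
  then show "Euclidean_space d interior_of ?K \<noteq> {}" by blast
qed

end

text \<open>
  Around an interior point \<open>p\<close> the gauge is the least dilation of \<open>K - p\<close> that contains a vector.
  Convexity gives the triangle inequality, boundedness of \<open>K\<close> the lower and interiority of \<open>p\<close> the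
  upper comparison with the sum norm, and closedness identifies \<open>K\<close> with the unit ball.
\<close>

lemma convex_body_eq_gauge_ball:
  assumes "convex_body d K"
  obtains p g where "p \<in> coord_space d" "asym_norm d g" "K = gauge_ball d p g"
proof -
  have cK: "compactin (Euclidean_space d) K"
    and conv: "\<And>x y s. x \<in> K \<Longrightarrow> y \<in> K \<Longrightarrow> s \<in> {0..1} \<Longrightarrow> (\<lambda>i. (1 - s) * x i + s * y i) \<in> K"
    and ne: "Euclidean_space d interior_of K \<noteq> {}"
    using assms unfolding convex_body_def by auto
  have KE: "K \<subseteq> coord_space d" using cK compactin_subset_topspace by blast
  have "closed K"
    using compactin_imp_closedin[OF Hausdorff_Euclidean_space cK] closedin_Euclidean_imp_closed by blast
  have "compact K"
    using cK unfolding Euclidean_space_def compactin_subtopology euclidean_product_topology by simp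
  obtain p where p: "p \<in> Euclidean_space d interior_of K" using ne by blast
  have pE: "p \<in> coord_space d" and pK: "p \<in> K"
    using p KE interior_of_subset[of "Euclidean_space d" K] by auto
  obtain \<epsilon> where "\<epsilon> > 0" and int: "\<forall>y\<in>coord_space d. (\<forall>i<d. \<bar>y i - p i\<bar> < \<epsilon>) \<longrightarrow> y \<in> Euclidean_space d interior_of K"
    using openin_interior_of[of "Euclidean_space d" K] p unfolding openin_Euclidean_space_cube by blast
  have \<epsilon>: "y \<in> K" if "y \<in> coord_space d" "\<forall>i<d. \<bar>y i - p i\<bar> < \<epsilon>" for y
    using int[rule_format, OF that(1)] that(2) interior_of_subset[of "Euclidean_space d" K] by auto
  have "continuous_on K (\<lambda>x. \<Sum>i<d. \<bar>x i - p i\<bar>)"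
    by (intro continuous_intros continuous_on_subset[OF continuous_on_product_coordinates]) simp
  then have "bounded ((\<lambda>x. \<Sum>i<d. \<bar>x i - p i\<bar>) ` K)"
    using \<open>compact K\<close> compact_continuous_image compact_imp_bounded by blast
  then obtain M where "M > 0" and M: "\<And>x. x \<in> K \<Longrightarrow> (\<Sum>i<d. \<bar>x i - p i\<bar>) \<le> M"
    unfolding bounded_pos by force
  define A where "A x = {r. r > 0 \<and> (\<lambda>i. p i + x i / r) \<in> K}" for x
  define g where "g x = Inf (A x)" for x
  define S where "S x = (\<Sum>i<d. \<bar>x i\<bar>)" for x :: "nat \<Rightarrow> real"
  have S0: "S x \<ge> 0" for x by (simp add: S_def sum_nonneg)
  have pos: "r > 0" if "r \<in> A x" for r x using that by (simp add: A_def)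
  have bdd: "bdd_below (A x)" for x by (rule bdd_belowI[of _ 0]) (auto simp: A_def)
  have up: "s \<in> A x" if r: "r \<in> A x" and "r \<le> s" for r s x
  proof -
    have "(\<lambda>i. (1 - r / s) * p i + r / s * (p i + x i / r)) \<in> K"
      using r \<open>r \<le> s\<close> pos[OF r] by (intro conv pK) (auto simp: A_def)
    moreover have "(1 - r / s) * p i + r / s * (p i + x i / r) = p i + x i / s" for i
      using pos[OF r] \<open>r \<le> s\<close> by (simp add: field_simps)
    ultimately show ?thesis using r \<open>r \<le> s\<close> by (simp add: A_def)
  qed
  have large: "s \<in> A x" if x: "x \<in> coord_space d" and s: "s > S x / \<epsilon>" for x s
  proof -
    have "s > 0" using s S0[of x] \<open>\<epsilon> > 0\<close> by (smt (verit) divide_nonneg_pos)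
    have "(\<lambda>i. p i + x i / s) \<in> K"
    proof (rule \<epsilon>)
      show "\<forall>i<d. \<bar>p i + x i / s - p i\<bar> < \<epsilon>"
      proof (intro allI impI)
        fix i assume "i < d"
        then have "\<bar>x i\<bar> \<le> S x" unfolding S_def by (intro member_le_sum) auto
        also have "\<dots> < s * \<epsilon>" using s \<open>\<epsilon> > 0\<close> by (simp add: field_simps)
        finally show "\<bar>p i + x i / s - p i\<bar> < \<epsilon>" using \<open>s > 0\<close> by (simp add: field_simps abs_if split: if_splits)
      qed
    qed (use pE x in simp)
    then show ?thesis using \<open>s > 0\<close> by (simp add: A_def)
  qed
  have ne: "A x \<noteq> {}" if "x \<in> coord_space d" for x
    using large[OF that, of "S x / \<epsilon> + 1"] by auto
  have g_le: "g x \<le> r" if "r \<in> A x" for r x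
    unfolding g_def using that bdd by (rule cInf_lower)
  have le_g: "z \<le> g x" if "x \<in> coord_space d" "\<And>r. r \<in> A x \<Longrightarrow> z \<le> r" for x z
    unfolding g_def using ne that by (intro cInf_greatest) auto
  have lower: "S x / M \<le> g x" if x: "x \<in> coord_space d" for x
  proof (rule le_g[OF x])
    fix r assume r: "r \<in> A x"
    have "(\<Sum>i<d. \<bar>p i + x i / r - p i\<bar>) \<le> M" using r by (intro M) (simp add: A_def)
    moreover have "(\<Sum>i<d. \<bar>p i + x i / r - p i\<bar>) = S x / r"
      using pos[OF r] by (simp add: S_def sum_divide_distrib)
    ultimately have "S x / r \<le> M" by simp
    then show "S x / M \<le> r" using pos[OF r] \<open>M > 0\<close> by (simp add: field_simps)
  qed
  have upper: "g x \<le> S x / \<epsilon>" if x: "x \<in> coord_space d" for x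
    by (rule field_le_epsilon) (use g_le large[OF x] in simp)
  have scale_le: "g (\<lambda>i. c * x i) \<le> c * g x" if x: "x \<in> coord_space d" and c: "c > 0" for x c
  proof -
    have "g (\<lambda>i. c * x i) / c \<le> g x"
    proof (rule le_g[OF x])
      fix r assume r: "r \<in> A x"
      then have "c * r \<in> A (\<lambda>i. c * x i)" using c by (simp add: A_def)
      then show "g (\<lambda>i. c * x i) / c \<le> r" using g_le c by (fastforce simp: field_simps)
    qed
    then show ?thesis using c by (simp add: field_simps)
  qed
  have scale: "g (\<lambda>i. c * x i) = c * g x" if x: "x \<in> coord_space d" and c: "c \<ge> 0" for x c
  proof (cases "c = 0")
    case True
    have "g (\<lambda>i. 0) = 0" using lower[of "\<lambda>i. 0"] upper[of "\<lambda>i. 0"] by (simp add: S_def)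
    then show ?thesis using True by simp
  next
    case False
    then have "g (\<lambda>i. inverse c * (c * x i)) \<le> inverse c * g (\<lambda>i. c * x i)"
      using x c by (intro scale_le[of "\<lambda>i. c * x i"]) auto
    then have "c * g x \<le> g (\<lambda>i. c * x i)" using False c by (simp add: field_simps)
    then show ?thesis using scale_le[OF x, of c] False c by simp
  qed
  have tri: "g (\<lambda>i. x i + y i) \<le> g x + g y" if x: "x \<in> coord_space d" and y: "y \<in> coord_space d" for x y
  proof -
    have "g (\<lambda>i. x i + y i) \<le> r + s" if r: "r \<in> A x" and s: "s \<in> A y" for r s
    proof (rule g_le)
      have rs: "r > 0" "s > 0" using pos r s by auto
      have "(\<lambda>i. (1 - s / (r + s)) * (p i + x i / r) + s / (r + s) * (p i + y i / s)) \<in> K"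
        using r s rs by (intro conv) (auto simp: A_def)
      moreover have "(1 - s / (r + s)) * (p i + x i / r) + s / (r + s) * (p i + y i / s) = p i + (x i + y i) / (r + s)" for i
      proof -
        have "r + s \<noteq> 0" using rs by simp
        have "1 - s / (r + s) = r / (r + s)" using \<open>r + s \<noteq> 0\<close> by (simp add: field_simps)
        moreover have "r / (r + s) * (p i + x i / r) = (r * p i + x i) / (r + s)"
          "s / (r + s) * (p i + y i / s) = (s * p i + y i) / (r + s)"
          using rs by (simp_all add: distrib_left add_divide_distrib)
        moreover have "(r * p i + x i) / (r + s) + (s * p i + y i) / (r + s) = p i + (x i + y i) / (r + s)"
        proof -
          have "p i = (r * p i + s * p i) / (r + s)"
            using \<open>r + s \<noteq> 0\<close> by (simp add: distrib_right[symmetric])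
          then have "p i + (x i + y i) / (r + s) = (r * p i + s * p i) / (r + s) + (x i + y i) / (r + s)" by simp
          then show ?thesis by (simp add: add_divide_distrib)
        qed
        ultimately show ?thesis by (simp only:)
      qed
      ultimately show "r + s \<in> A (\<lambda>i. x i + y i)" using rs by (simp add: A_def)
    qed
    then have "g (\<lambda>i. x i + y i) - s \<le> g x" if "s \<in> A y" for s
      using that by (intro le_g[OF x]) (simp add: algebra_simps)
    then have "g (\<lambda>i. x i + y i) - g x \<le> g y"
      by (intro le_g[OF y]) (simp add: algebra_simps)
    then show ?thesis by simp
  qed
  have "asym_norm d g"
    unfolding asym_norm_def
  proof (intro conjI ballI allI impI)
    show "\<exists>c>0. \<forall>x\<in>coord_space d. c * (\<Sum>i<d. \<bar>x i\<bar>) \<le> g x"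
      using lower \<open>M > 0\<close> by (intro exI[of _ "1 / M"]) (auto simp: S_def)
    show "\<exists>C\<ge>0. \<forall>x\<in>coord_space d. g x \<le> C * (\<Sum>i<d. \<bar>x i\<bar>)"
      using upper \<open>\<epsilon> > 0\<close> by (intro exI[of _ "1 / \<epsilon>"]) (auto simp: S_def)
  qed (use scale tri in auto)
  moreover have "K = gauge_ball d p g"
  proof (intro equalityI subsetI)
    fix x assume "x \<in> K"
    then have "1 \<in> A (\<lambda>i. x i - p i)" by (simp add: A_def)
    then show "x \<in> gauge_ball d p g" using g_le KE \<open>x \<in> K\<close> by (auto simp: gauge_ball_def)
  next
    fix x assume "x \<in> gauge_ball d p g"
    then have xE: "x \<in> coord_space d" and gx: "g (\<lambda>i. x i - p i) \<le> 1" by (auto simp: gauge_ball_def)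
    \<comment> \<open>The infimum defining \<open>g\<close> need not be attained a priori, so \<open>x\<close> is reached as a limit of
      points of \<open>K\<close> on the segment from \<open>p\<close>.\<close>
    define F where "F s = (\<lambda>i. p i + s * (x i - p i))" for s :: real
    have "continuous_on UNIV F"
      unfolding F_def by (intro continuous_on_coordinatewise_then_product continuous_intros)
    then have "(F \<longlongrightarrow> F 1) (at 1)" by (simp add: continuous_on_def)
    then have lim: "(F \<longlongrightarrow> F 1) (at_left 1)" by (rule tendsto_mono[rotated]) (simp add: at_le)
    have inK: "F s \<in> K" if s: "0 < s" "s < 1" for s
    proof -
      have "1 < 1 / s" using s by simp
      then have "Inf (A (\<lambda>i. x i - p i)) < 1 / s" using gx by (simp add: g_def)
      then obtain r where r: "r \<in> A (\<lambda>i. x i - p i)" "r < 1 / s"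
        using cInf_lessD[OF ne] xE pE by (metis coord_space_closed(2))
      then have "1 / s \<in> A (\<lambda>i. x i - p i)" using up by (meson less_imp_le)
      then show ?thesis by (simp add: A_def F_def mult.commute)
    qed
    have "\<forall>\<^sub>F s in at_left 1. F s \<in> K"
      unfolding eventually_at_left_field by (rule exI[of _ 0]) (use inK in auto)
    then have "F 1 \<in> K" using \<open>closed K\<close> lim by (intro Lim_in_closed_set) auto
    then show "x \<in> K" by (simp add: F_def)
  qed
  ultimately show ?thesis using that pE by blast
qed

section \<open>Closed characteristics in terms of the gauge\<close>

abbreviation dot :: "nat \<Rightarrow> (nat \<Rightarrow> real) \<Rightarrow> (nat \<Rightarrow> real) \<Rightarrow> real" where
  "dot d u v \<equiv> (\<Sum>i<d. u i * v i)"

lemma sum_lessThan_double: "(\<Sum>i<2*n. f i) = (\<Sum>j<n. f (2*j) + f (2*j+1))" for f :: "nat \<Rightarrow> real"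
  by (induction n) (auto simp: algebra_simps)

lemma dot_cstruct: "dot (2*n) v (cstruct v) = 0"
  unfolding sum_lessThan_double by (simp add: cstruct_def mult.commute)

lemma symp_form_cstruct:
  assumes "\<And>i. i < 2*n \<Longrightarrow> w i = cstruct v i"
  shows "symp_form n u w = dot (2*n) v u"
  unfolding symp_form_def sum_lessThan_double
  by (intro sum.cong) (use assms in \<open>auto simp: cstruct_def algebra_simps\<close>)

text \<open>
  On the unit sphere of \<open>g\<close> this describes the outer normals of the unit ball, and \<open>dot d v z\<close> is
  then the support function of the ball at \<open>v\<close>. Without a constraint \<open>g y \<le> 1\<close> the condition
  passes easily to factors and multiples of the ball.
\<close>

definition supports :: "nat \<Rightarrow> ((nat \<Rightarrow> real) \<Rightarrow> real) \<Rightarrow> (nat \<Rightarrow> real) \<Rightarrow> (nat \<Rightarrow> real) \<Rightarrow> bool" where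
  "supports d g v z \<longleftrightarrow> v \<in> coord_space d \<and> (\<forall>y\<in>coord_space d. dot d v y \<le> dot d v z * g y)"

lemma supports_nonneg:
  assumes g: "asym_norm d g" and "z \<in> coord_space d" "supports d g v z" "g z = 1"
  shows "dot d v z \<ge> 0"
proof -
  have w: "(\<lambda>i. (-1) * z i) \<in> coord_space d" using assms(2) by (rule coord_space_closed)
  have "\<forall>y\<in>coord_space d. dot d v y \<le> dot d v z * g y" using assms(3) by (simp add: supports_def)
  from bspec[OF this w] have "dot d v (\<lambda>i. (-1) * z i) \<le> dot d v z * g (\<lambda>i. (-1) * z i)" .
  then have "dot d v z * (1 + g (\<lambda>i. (-1) * z i)) \<ge> 0" by (simp add: algebra_simps sum_negf)
  moreover have "g (\<lambda>i. (-1) * z i) \<ge> 0"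
    using asym_norm_nonneg[OF g] assms(2) by (metis coord_space_closed(3))
  ultimately show ?thesis by (simp add: zero_le_mult_iff)
qed

lemma supports_eq_0:
  assumes "supports d g v z" "dot d v z = 0"
  shows "v = (\<lambda>i. 0)"
proof -
  have "dot d v v \<le> 0" using assms unfolding supports_def by force
  then have "dot d v v = 0" by (simp add: antisym sum_nonneg)
  then have "\<forall>i<d. v i = 0" by (simp add: sum_nonneg_eq_0_iff)
  then show ?thesis using assms(1) unfolding supports_def in_coord_space by (intro ext) (metis not_le)
qed

lemma outer_normal_cone_gauge_ball:
  assumes g: "asym_norm d g" and z: "z \<in> coord_space d" "g z = 1"
  shows "v \<in> outer_normal_cone d (gauge_ball d (\<lambda>i. 0) g) z \<longleftrightarrow> supports d g v z"
proof
  assume "v \<in> outer_normal_cone d (gauge_ball d (\<lambda>i. 0) g) z"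
  then have v: "v \<in> coord_space d" and
    n: "\<And>y. y \<in> coord_space d \<Longrightarrow> g y \<le> 1 \<Longrightarrow> dot d v y \<le> dot d v z"
    by (auto simp: outer_normal_cone_def gauge_ball_def algebra_simps sum_subtractf)
  have "dot d v y \<le> dot d v z * g y" if y: "y \<in> coord_space d" for y
  proof (cases "g y = 0")
    case True
    then have "y = (\<lambda>i. 0)" using asym_norm_eq_0D[OF g y] by simp
    then show ?thesis using True by simp
  next
    case False
    then have pos: "g y > 0" using asym_norm_nonneg[OF g y] by simp
    have "g (\<lambda>i. inverse (g y) * y i) = 1" using asym_norm_scale[OF g y, of "inverse (g y)"] pos by simp
    then have "dot d v (\<lambda>i. inverse (g y) * y i) \<le> dot d v z" using n y by simp
    moreover have "dot d v (\<lambda>i. inverse (g y) * y i) = dot d v y / g y"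
      by (simp add: sum_divide_distrib field_simps)
    ultimately have "dot d v y / g y \<le> dot d v z" by simp
    then show ?thesis using pos by (simp only: pos_divide_le_eq)
  qed
  then show "supports d g v z" using v by (simp add: supports_def)
next
  assume s: "supports d g v z"
  have "dot d v y \<le> dot d v z" if "y \<in> coord_space d" "g y \<le> 1" for y
  proof -
    have "dot d v y \<le> dot d v z * g y" using s that by (simp add: supports_def)
    also have "\<dots> \<le> dot d v z * 1"
      using supports_nonneg[OF g z(1) s z(2)] that by (intro mult_left_mono)
    finally show ?thesis by simp
  qed
  then show "v \<in> outer_normal_cone d (gauge_ball d (\<lambda>i. 0) g) z"
    using s by (auto simp: outer_normal_cone_def gauge_ball_def supports_def algebra_simps sum_subtractf)
qed

text \<open>
  Closed characteristics on the unit sphere of a gauge, and the set of their actions. For a convex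
  body around the origin they are the generalized closed characteristics of the body.
\<close>

definition gauge_characteristic :: "nat \<Rightarrow> ((nat \<Rightarrow> real) \<Rightarrow> real) \<Rightarrow> (real \<Rightarrow> nat \<Rightarrow> real) \<Rightarrow> bool" where
  "gauge_characteristic n g \<gamma> \<longleftrightarrow>
     (\<forall>i<2*n. abs_continuous_on_Icc 0 1 (\<lambda>t. \<gamma> t i)) \<and> \<gamma> 0 = \<gamma> 1 \<and> \<not> \<gamma> constant_on {0..1} \<and>
     (\<forall>t\<in>{0..1}. \<gamma> t \<in> coord_space (2*n) \<and> g (\<gamma> t) = 1) \<and>
     (AE t in lebesgue. t \<in> {0..1} \<longrightarrow> (\<exists>v. supports (2*n) g v (\<gamma> t) \<and>
        (\<forall>i<2*n. ((\<lambda>s. \<gamma> s i) has_real_derivative cstruct v i) (at t))))"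

definition action_spectrum :: "nat \<Rightarrow> ((nat \<Rightarrow> real) \<Rightarrow> real) \<Rightarrow> real set" where
  "action_spectrum n g = {symp_action n \<gamma> |\<gamma>. gauge_characteristic n g \<gamma>}"

lemma gen_closed_characteristic_gauge_ball:
  assumes g: "asym_norm (2*n) g"
  shows "gen_closed_characteristic n (gauge_ball (2*n) (\<lambda>i. 0) g) \<gamma> \<longleftrightarrow> gauge_characteristic n g \<gamma>"
proof -
  have fr: "\<gamma> ` {0..1} \<subseteq> Euclidean_space (2*n) frontier_of gauge_ball (2*n) (\<lambda>i. 0) g \<longleftrightarrow>
     (\<forall>t\<in>{0..1}. \<gamma> t \<in> coord_space (2*n) \<and> g (\<gamma> t) = 1)"
    by (subst frontier_gauge_ball[OF g]) auto
  have "(AE t in lebesgue. t \<in> {0..1} \<longrightarrow>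
        (\<exists>v\<in>outer_normal_cone (2*n) (gauge_ball (2*n) (\<lambda>i. 0) g) (\<gamma> t).
           \<forall>i<2*n. ((\<lambda>s. \<gamma> s i) has_real_derivative cstruct v i) (at t))) \<longleftrightarrow>
     (AE t in lebesgue. t \<in> {0..1} \<longrightarrow> (\<exists>v. supports (2*n) g v (\<gamma> t) \<and>
        (\<forall>i<2*n. ((\<lambda>s. \<gamma> s i) has_real_derivative cstruct v i) (at t))))"
    if "\<forall>t\<in>{0..1}. \<gamma> t \<in> coord_space (2*n) \<and> g (\<gamma> t) = 1"
    by (intro AE_cong) (use that outer_normal_cone_gauge_ball[OF g] in blast)
  then show ?thesis
    unfolding gen_closed_characteristic_def gauge_characteristic_def fr by blast
qed

text \<open>
  On a complete measure space almost everywhere equal functions have the same integral even if they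
  are not measurable.
\<close>

lemma LINT_cong_AE_lebesgue:
  fixes f g :: "real \<Rightarrow> real"
  assumes "AE t in lebesgue. t \<in> A \<longrightarrow> f t = g t"
  shows "(LINT t:A|lebesgue. f t) = (LINT t:A|lebesgue. g t)"
proof -
  let ?f = "\<lambda>t. indicator A t *\<^sub>R f t" and ?g = "\<lambda>t. indicator A t *\<^sub>R g t"
  have eq: "AE t in lebesgue. ?f t = ?g t"
    using assms by eventually_elim (auto simp: indicator_def)
  then have eq': "AE t in lebesgue. ?g t = ?f t" by eventually_elim (rule sym)
  show ?thesis
  proof (cases "?f \<in> borel_measurable lebesgue")
    case True
    then have "?g \<in> borel_measurable lebesgue" by (rule borel_measurable_AE) (rule eq)
    with True eq show ?thesis unfolding set_lebesgue_integral_def by (intro integral_cong_AE)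
  next
    case False
    have "?g \<notin> borel_measurable lebesgue"
    proof
      assume "?g \<in> borel_measurable lebesgue"
      then have "?f \<in> borel_measurable lebesgue" by (rule borel_measurable_AE) (rule eq')
      with False show False ..
    qed
    with False have "\<not> integrable lebesgue ?f" "\<not> integrable lebesgue ?g"
      by (auto dest: borel_measurable_integrable)
    then show ?thesis unfolding set_lebesgue_integral_def by (simp add: not_integrable_integral_eq)
  qed
qed

lemma liouville_form_velocity:
  assumes "\<And>i. i < 2*n \<Longrightarrow> ((\<lambda>s. \<gamma> s i) has_real_derivative cstruct v i) (at t)"
  shows "liouville_form n (\<gamma> t) (\<lambda>i. deriv (\<lambda>s. \<gamma> s i) t) = dot (2*n) v (\<gamma> t) / 2"
  unfolding liouville_form_def
  by (subst symp_form_cstruct[of n _ v]) (auto simp: DERIV_imp_deriv assms)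

text \<open>
  The action depends only on the almost everywhere defined density \<open>dot v \<gamma>\<close>, even for curves in
  spaces of different dimensions.
\<close>

lemma symp_action_transfer:
  assumes "AE t in lebesgue. t \<in> {0..1} \<longrightarrow> (\<exists>v w. dot (2*n) v (\<gamma> t) = dot (2*m) w (\<beta> t) \<and>
        (\<forall>i<2*n. ((\<lambda>s. \<gamma> s i) has_real_derivative cstruct v i) (at t)) \<and>
        (\<forall>i<2*m. ((\<lambda>s. \<beta> s i) has_real_derivative cstruct w i) (at t)))"
  shows "symp_action n \<gamma> = symp_action m \<beta>"
  unfolding symp_action_def
proof (rule LINT_cong_AE_lebesgue)
  show "AE t in lebesgue. t \<in> {0..1} \<longrightarrow> liouville_form n (\<gamma> t) (\<lambda>i. deriv (\<lambda>s. \<gamma> s i) t)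
      = liouville_form m (\<beta> t) (\<lambda>i. deriv (\<lambda>s. \<beta> s i) t)"
    using assms
  proof eventually_elim
    case (elim t)
    then show ?case
      using liouville_form_velocity[of n \<gamma> _ t] liouville_form_velocity[of m \<beta> _ t] by metis
  qed
qed

lemma action_spectrum_nonneg:
  assumes g: "asym_norm (2*n) g" and "a \<in> action_spectrum n g"
  shows "a \<ge> 0"
proof -
  obtain \<gamma> where a: "a = symp_action n \<gamma>" and \<gamma>: "gauge_characteristic n g \<gamma>"
    using assms(2) by (auto simp: action_spectrum_def)
  have sph: "\<And>t. t \<in> {0..1} \<Longrightarrow> \<gamma> t \<in> coord_space (2*n) \<and> g (\<gamma> t) = 1"
    and ae: "AE t in lebesgue. t \<in> {0..1} \<longrightarrow> (\<exists>v. supports (2*n) g v (\<gamma> t) \<and>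
        (\<forall>i<2*n. ((\<lambda>s. \<gamma> s i) has_real_derivative cstruct v i) (at t)))"
    using \<gamma> unfolding gauge_characteristic_def by auto
  have "AE t in lebesgue. t \<in> {0..1} \<longrightarrow> liouville_form n (\<gamma> t) (\<lambda>i. deriv (\<lambda>s. \<gamma> s i) t) \<ge> 0"
    using ae
  proof eventually_elim
    case (elim t)
    show ?case
    proof
      assume t: "t \<in> {0..1}"
      with elim obtain v where v: "supports (2*n) g v (\<gamma> t)"
        "\<And>i. i < 2*n \<Longrightarrow> ((\<lambda>s. \<gamma> s i) has_real_derivative cstruct v i) (at t)" by blast
      then show "liouville_form n (\<gamma> t) (\<lambda>i. deriv (\<lambda>s. \<gamma> s i) t) \<ge> 0"
        using supports_nonneg[OF g _ v(1)] sph[OF t] by (simp add: liouville_form_velocity[of n \<gamma> v])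
    qed
  qed
  then have "symp_action n \<gamma> \<ge> 0"
    unfolding symp_action_def set_lebesgue_integral_def
    by (intro integral_nonneg_AE) (auto elim!: eventually_mono simp: indicator_def)
  then show ?thesis using a by simp
qed

subsection \<open>Translation invariance\<close>

text \<open>
  Translating a curve changes the Liouville form by a form with constant coefficients, which
  integrates to zero over closed curves.
\<close>

lemma closed_curve_constant_form_integral:
  assumes ac: "\<And>i. i < 2*n \<Longrightarrow> abs_continuous_on_Icc 0 1 (\<lambda>t. \<gamma> t i)" and cl: "\<gamma> 0 = \<gamma> 1"
    and der: "AE t in lebesgue. t \<in> {0..1} \<longrightarrow> (\<forall>i<2*n. ((\<lambda>s. \<gamma> s i) has_real_derivative D i t) (at t))"
  shows "set_integrable lebesgue {0..1} (\<lambda>t. symp_form n a (\<lambda>i. D i t))"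
    and "(LINT t:{0..1}|lebesgue. symp_form n a (\<lambda>i. D i t)) = 0"
proof -
  obtain N where N: "negligible N" "\<forall>t\<in>{0..1} - N. \<forall>i<2*n. ((\<lambda>s. \<gamma> s i) has_real_derivative D i t) (at t)"
    using AE_imp_negligible[OF der] by blast
  have int: "set_integrable lebesgue {0..1} (D i)" "(LINT t:{0..1}|lebesgue. D i t) = 0" if "i < 2*n" for i
  proof -
    have d: "((\<lambda>s. \<gamma> s i) has_real_derivative D i t) (at t)" if "t \<in> {0..1} - N" for t
      using N(2) that \<open>i < 2*n\<close> by blast
    show *: "set_integrable lebesgue {0..1} (D i)"
      by (rule ac_derivative_absolutely_integrable[OF ac[OF \<open>i < 2*n\<close>] _ N(1) d]) auto
    have "(D i has_integral 0) {0..1}"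
      using ac_has_integral[OF ac[OF \<open>i < 2*n\<close>] _ N(1) d] cl by simp
    then show "(LINT t:{0..1}|lebesgue. D i t) = 0"
      using set_lebesgue_integral_eq_integral(2)[OF *] by (simp add: integral_unique)
  qed
  have i1: "set_integrable lebesgue {0..1} (\<lambda>t. c * D i t)" if "i < 2*n" for i c
    using int(1)[OF that] by simp
  have z: "(LINT t:{0..1}|lebesgue. c * D i t) = 0" if "i < 2*n" for i c
    using int(2)[OF that] by simp
  have i2: "set_integrable lebesgue {0..1} (\<lambda>t. a (2*j) * D (2*j+1) t - a (2*j+1) * D (2*j) t)"
    and z2: "(LINT t:{0..1}|lebesgue. a (2*j) * D (2*j+1) t - a (2*j+1) * D (2*j) t) = 0" if "j < n" for j
    using i1[of "2*j+1" "a (2*j)"] i1[of "2*j" "a (2*j+1)"] z[of "2*j+1" "a (2*j)"] z[of "2*j" "a (2*j+1)"] that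
    by (auto intro!: set_integral_diff(1) simp: set_integral_diff(2))
  show "set_integrable lebesgue {0..1} (\<lambda>t. symp_form n a (\<lambda>i. D i t))"
    unfolding symp_form_def set_integrable_def scaleR_sum_right
    using i2 by (intro Bochner_Integration.integrable_sum) (auto simp: set_integrable_def)
  show "(LINT t:{0..1}|lebesgue. symp_form n a (\<lambda>i. D i t)) = 0"
    unfolding symp_form_def set_lebesgue_integral_def scaleR_sum_right
    by (subst Bochner_Integration.integral_sum) (use i2 z2 in \<open>auto simp: set_integrable_def set_lebesgue_integral_def\<close>)
qed

lemma gen_closed_characteristic_translate:
  assumes g: "asym_norm (2*n) g" and p: "p \<in> coord_space (2*n)" and q: "q \<in> coord_space (2*n)"
    and \<gamma>: "gen_closed_characteristic n (gauge_ball (2*n) p g) \<gamma>"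
  shows "gen_closed_characteristic n (gauge_ball (2*n) q g) (\<lambda>t i. \<gamma> t i + (q i - p i))"
    and "symp_action n (\<lambda>t i. \<gamma> t i + (q i - p i)) = symp_action n \<gamma>"
proof -
  let ?\<beta> = "\<lambda>t i. \<gamma> t i + (q i - p i)"
  note G = \<gamma>[unfolded gen_closed_characteristic_def]
  have ac: "\<And>i. i < 2*n \<Longrightarrow> abs_continuous_on_Icc 0 1 (\<lambda>t. \<gamma> t i)" and cl: "\<gamma> 0 = \<gamma> 1"
    and nc: "\<not> \<gamma> constant_on {0..1}"
    and fr: "\<gamma> ` {0..1} \<subseteq> Euclidean_space (2*n) frontier_of gauge_ball (2*n) p g"
    and ae: "AE t in lebesgue. t \<in> {0..1} \<longrightarrow>
        (\<exists>v\<in>outer_normal_cone (2*n) (gauge_ball (2*n) p g) (\<gamma> t).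
           \<forall>i<2*n. ((\<lambda>s. \<gamma> s i) has_real_derivative cstruct v i) (at t))"
    using G by blast+
  have der: "((\<lambda>s. ?\<beta> s i) has_real_derivative D) (at t) \<longleftrightarrow> ((\<lambda>s. \<gamma> s i) has_real_derivative D) (at t)" for i D t
  proof
    assume "((\<lambda>s. ?\<beta> s i) has_real_derivative D) (at t)"
    from DERIV_diff[OF this DERIV_const[of "q i - p i"]] show "((\<lambda>s. \<gamma> s i) has_real_derivative D) (at t)" by simp
  next
    assume "((\<lambda>s. \<gamma> s i) has_real_derivative D) (at t)"
    from DERIV_add[OF this DERIV_const[of "q i - p i"]] show "((\<lambda>s. ?\<beta> s i) has_real_derivative D) (at t)" by simp
  qed
  have cone: "outer_normal_cone (2*n) (gauge_ball (2*n) p g) x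
      \<subseteq> outer_normal_cone (2*n) (gauge_ball (2*n) q g) (\<lambda>i. x i + (q i - p i))" for x
  proof
    fix v assume v: "v \<in> outer_normal_cone (2*n) (gauge_ball (2*n) p g) x"
    have "(\<Sum>i<2*n. v i * (y i - (x i + (q i - p i)))) \<le> 0" if "y \<in> gauge_ball (2*n) q g" for y
    proof -
      have "(\<lambda>i. y i - (q i - p i)) \<in> gauge_ball (2*n) p g" using that p q by (simp add: gauge_ball_def)
      then have "(\<Sum>i<2*n. v i * (y i - (q i - p i) - x i)) \<le> 0"
        using v by (auto simp: outer_normal_cone_def)
      then show ?thesis by (simp add: algebra_simps)
    qed
    then show "v \<in> outer_normal_cone (2*n) (gauge_ball (2*n) q g) (\<lambda>i. x i + (q i - p i))"
      using v by (auto simp: outer_normal_cone_def)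
  qed
  show "gen_closed_characteristic n (gauge_ball (2*n) q g) ?\<beta>"
    unfolding gen_closed_characteristic_def
  proof (intro conjI allI impI)
    show "abs_continuous_on_Icc 0 1 (\<lambda>t. ?\<beta> t i)" if "i < 2*n" for i
      using ac_affine[OF ac[OF that], of 1] by simp
    show "?\<beta> 0 = ?\<beta> 1" using cl by simp
    show "\<not> ?\<beta> constant_on {0..1}"
    proof
      assume "?\<beta> constant_on {0..1}"
      then obtain c where "\<And>t. t \<in> {0..1} \<Longrightarrow> ?\<beta> t = c" by (auto simp: constant_on_def)
      then have "\<And>t. t \<in> {0..1} \<Longrightarrow> \<gamma> t = (\<lambda>i. c i - (q i - p i))" by force
      then show False using nc by (auto simp: constant_on_def)
    qed
    show "?\<beta> ` {0..1} \<subseteq> Euclidean_space (2*n) frontier_of gauge_ball (2*n) q g"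
      using fr p q unfolding frontier_gauge_ball[OF g p] frontier_gauge_ball[OF g q] by auto
    show "AE t in lebesgue. t \<in> {0..1} \<longrightarrow>
        (\<exists>v\<in>outer_normal_cone (2*n) (gauge_ball (2*n) q g) (?\<beta> t).
           \<forall>i<2*n. ((\<lambda>s. ?\<beta> s i) has_real_derivative cstruct v i) (at t))"
      using ae unfolding der by eventually_elim (use cone in blast)
  qed
  have dd: "deriv (\<lambda>s. ?\<beta> s i) t = deriv (\<lambda>s. \<gamma> s i) t" for i t
    unfolding deriv_def der by simp
  define D where "D i t = deriv (\<lambda>s. \<gamma> s i) t" for i t
  have aeD: "AE t in lebesgue. t \<in> {0..1} \<longrightarrow> (\<forall>i<2*n. ((\<lambda>s. \<gamma> s i) has_real_derivative D i t) (at t))"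
    using ae unfolding D_def by eventually_elim (metis DERIV_imp_deriv)
  have h: "set_integrable lebesgue {0..1} (\<lambda>t. symp_form n (\<lambda>i. q i - p i) (\<lambda>i. D i t))"
    "(LINT t:{0..1}|lebesgue. symp_form n (\<lambda>i. q i - p i) (\<lambda>i. D i t)) = 0"
    by (rule closed_curve_constant_form_integral[OF ac cl aeD]; simp)+
  let ?f = "\<lambda>t. indicator {0..1} t * liouville_form n (\<gamma> t) (\<lambda>i. D i t)"
  let ?h = "\<lambda>t. indicator {0..1} t * (symp_form n (\<lambda>i. q i - p i) (\<lambda>i. D i t) / 2)"
  have hi: "integrable lebesgue ?h" "integral\<^sup>L lebesgue ?h = 0"
    using h unfolding set_integrable_def set_lebesgue_integral_def by auto
  have "symp_action n ?\<beta> = (\<integral>t. ?f t + ?h t \<partial>lebesgue)"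
    unfolding symp_action_def set_lebesgue_integral_def dd D_def
    by (intro Bochner_Integration.integral_cong)
       (auto simp: liouville_form_def symp_form_def indicator_def sum.distrib[symmetric]
         add_divide_distrib[symmetric] algebra_simps intro!: sum.cong)
  also have "\<dots> = integral\<^sup>L lebesgue ?f"
    \<comment> \<open>Adding an integrable function preserves non-integrability, and then both integrals are
      \<open>0\<close> by convention.\<close>
  proof (cases "integrable lebesgue ?f")
    case True
    then show ?thesis using hi by simp
  next
    case False
    then have "\<not> integrable lebesgue (\<lambda>t. ?f t + ?h t)"
      using Bochner_Integration.integrable_diff[OF _ hi(1), of "\<lambda>t. ?f t + ?h t"] by auto
    then show ?thesis using False by (simp add: not_integrable_integral_eq)
  qed
  also have "\<dots> = symp_action n \<gamma>"
    unfolding symp_action_def set_lebesgue_integral_def D_def by simp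
  finally show "symp_action n ?\<beta> = symp_action n \<gamma>" .
qed

lemma c_EHZ_gauge_ball:
  assumes g: "asym_norm (2*n) g" and p: "p \<in> coord_space (2*n)"
  shows "c_EHZ n (gauge_ball (2*n) p g) = Inf (action_spectrum n g)"
proof -
  define A where "A p = {symp_action n \<gamma> |\<gamma>. gen_closed_characteristic n (gauge_ball (2*n) p g) \<gamma>}" for p
  have le: "A p \<subseteq> A q" if pq: "p \<in> coord_space (2*n)" "q \<in> coord_space (2*n)" for p q
  proof
    fix a assume "a \<in> A p"
    then obtain \<gamma> where a: "a = symp_action n \<gamma>" "gen_closed_characteristic n (gauge_ball (2*n) p g) \<gamma>"
      unfolding A_def by blast
    note T = gen_closed_characteristic_translate[OF g pq a(2)]
    show "a \<in> A q" unfolding A_def a(1) T(2)[symmetric] using T(1) by blast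
  qed
  have "A p = A (\<lambda>i. 0)" by (intro equalityI le p coord_space_closed)
  then show ?thesis
    unfolding A_def c_EHZ_def action_spectrum_def gen_closed_characteristic_gauge_ball[OF g] by simp
qed

section \<open>The two-product and its closed characteristics\<close>

definition block :: "nat \<Rightarrow> nat \<Rightarrow> (nat \<Rightarrow> real) \<Rightarrow> nat \<Rightarrow> real" where
  "block b d z = (\<lambda>i. if i < d then z (i + b) else 0)"

definition embed_block :: "nat \<Rightarrow> nat \<Rightarrow> (nat \<Rightarrow> real) \<Rightarrow> nat \<Rightarrow> real" where
  "embed_block b d x = (\<lambda>i. if b \<le> i \<and> i < b + d then x (i - b) else 0)"

text \<open>The gauge of the symplectic two-product \<open>{(x, y). g x\<^sup>2 + h y\<^sup>2 \<le> 1}\<close>.\<close>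

definition l2_gauge ::
    "nat \<Rightarrow> nat \<Rightarrow> ((nat \<Rightarrow> real) \<Rightarrow> real) \<Rightarrow> ((nat \<Rightarrow> real) \<Rightarrow> real) \<Rightarrow> (nat \<Rightarrow> real) \<Rightarrow> real" where
  "l2_gauge d e g h z = sqrt ((g (block 0 d z))\<^sup>2 + (h (block d e z))\<^sup>2)"

lemma block_in [simp]: "block b d z \<in> coord_space d"
  by (simp add: block_def in_coord_space)

lemma embed_block_in: "b + d \<le> D \<Longrightarrow> embed_block b d x \<in> coord_space D"
  by (auto simp: embed_block_def in_coord_space)

lemma block_embed_block [simp]: "x \<in> coord_space d \<Longrightarrow> block b d (embed_block b d x) = x"
  by (auto simp: block_def embed_block_def in_coord_space)

lemma block_embed_block_disjoint:
  "b + d \<le> c \<or> c + e \<le> b \<Longrightarrow> block b d (embed_block c e x) = (\<lambda>i. 0)"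
  by (auto simp: block_def embed_block_def)

lemma block_add: "block b d (\<lambda>i. x i + y i) = (\<lambda>i. block b d x i + block b d y i)"
  and block_scale: "block b d (\<lambda>i. c * x i) = (\<lambda>i. c * block b d x i)"
  by (auto simp: block_def)

lemma sum_blocks: "(\<Sum>i<d+e. f i) = (\<Sum>i<d. f i) + (\<Sum>i<e. f (i + d))" for f :: "nat \<Rightarrow> 'a::comm_monoid_add"
  by (induction e) (auto simp: ac_simps)

lemma dot_blocks:
  "dot (d+e) v z = dot d (block 0 d v) (block 0 d z) + dot e (block d e v) (block d e z)"
  by (simp add: sum_blocks block_def)

lemma dot_embed_block:
  assumes "b + d \<le> D"
  shows "dot D (embed_block b d x) y = dot d x (block b d y)"
proof -
  have "dot D (embed_block b d x) y = (\<Sum>i\<in>{b..<b+d}. x (i - b) * y i)"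
    using assms by (intro sum.mono_neutral_cong_right) (auto simp: embed_block_def)
  also have "\<dots> = (\<Sum>i\<in>{0..<d}. x i * y (i + b))"
    using sum.shift_bounds_nat_ivl[of "\<lambda>i. x (i - b) * y i" 0 b d] by (simp add: add.commute)
  also have "\<dots> = dot d x (block b d y)"
    by (simp add: block_def atLeast0LessThan)
  finally show ?thesis .
qed

lemma cstruct_zero: "cstruct (\<lambda>i. 0) = (\<lambda>i. 0)"
  by (auto simp: cstruct_def)

lemma block_cstruct:
  assumes "even b" "even d" "i < d"
  shows "block b d (cstruct v) i = cstruct (block b d v) i"
proof (cases "even i")
  case True
  then have "i + 1 < d" using assms by (metis Suc_eq_plus1 Suc_lessI even_Suc)
  then show ?thesis using True assms by (simp add: block_def cstruct_def)
next
  case False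
  then have "i \<ge> 1" by (cases i) auto
  then show ?thesis using False assms by (simp add: block_def cstruct_def)
qed

lemma cstruct_embed_block:
  assumes "even b" "even d"
  shows "cstruct (embed_block b d v) i = (if b \<le> i \<and> i < b + d then cstruct v (i - b) else 0)"
proof (cases "even i")
  case True
  then have "b \<le> i + 1 \<longleftrightarrow> b \<le> i" "i + 1 < b + d \<longleftrightarrow> i < b + d"
    using assms by (metis Suc_eq_plus1 even_Suc le_Suc_eq, metis Suc_eq_plus1 Suc_lessI Suc_lessD even_Suc even_add)
  moreover have "b \<le> i \<Longrightarrow> i + 1 - b = i - b + 1" by simp
  ultimately show ?thesis using True assms by (auto simp: cstruct_def embed_block_def)
next
  case False
  then have "i \<ge> 1" by (cases i) auto
  have "b \<le> i - 1 \<longleftrightarrow> b \<le> i" "i - 1 < b + d \<longleftrightarrow> i < b + d"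
    using assms False \<open>i \<ge> 1\<close> by presburger+
  moreover have "b \<le> i \<Longrightarrow> i - 1 - b = i - b - 1" by simp
  moreover have "b \<le> i \<Longrightarrow> odd (i - b)" using assms False by simp
  ultimately show ?thesis using False assms by (auto simp: cstruct_def embed_block_def)
qed

lemma asym_norm_l2_gauge:
  assumes g: "asym_norm d g" and h: "asym_norm e h"
  shows "asym_norm (d + e) (l2_gauge d e g h)"
  unfolding asym_norm_def
proof (intro conjI ballI allI impI)
  fix x c assume "x \<in> coord_space (d + e)" and c: "c \<ge> (0::real)"
  have "(c * g (block 0 d x))\<^sup>2 + (c * h (block d e x))\<^sup>2 = c\<^sup>2 * ((g (block 0 d x))\<^sup>2 + (h (block d e x))\<^sup>2)"
    by (simp add: power_mult_distrib algebra_simps)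
  then show "l2_gauge d e g h (\<lambda>i. c * x i) = c * l2_gauge d e g h x"
    using c by (simp add: l2_gauge_def block_scale asym_norm_scale[OF g] asym_norm_scale[OF h] real_sqrt_mult)
next
  fix x y assume "x \<in> coord_space (d + e)" "y \<in> coord_space (d + e)"
  have "l2_gauge d e g h (\<lambda>i. x i + y i)
     \<le> sqrt ((g (block 0 d x) + g (block 0 d y))\<^sup>2 + (h (block d e x) + h (block d e y))\<^sup>2)"
    unfolding l2_gauge_def block_add
    by (intro real_sqrt_le_mono add_mono power_mono asym_norm_triangle[OF g] asym_norm_triangle[OF h]
        asym_norm_nonneg[OF g] asym_norm_nonneg[OF h] coord_space_closed block_in)
  also have "\<dots> \<le> l2_gauge d e g h x + l2_gauge d e g h y"
    unfolding l2_gauge_def by (rule real_sqrt_sum_squares_triangle_ineq)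
  finally show "l2_gauge d e g h (\<lambda>i. x i + y i) \<le> l2_gauge d e g h x + l2_gauge d e g h y" .
next
  obtain a b where a: "a > 0" "\<And>x. x \<in> coord_space d \<Longrightarrow> a * (\<Sum>i<d. \<bar>x i\<bar>) \<le> g x"
    and b: "b > 0" "\<And>x. x \<in> coord_space e \<Longrightarrow> b * (\<Sum>i<e. \<bar>x i\<bar>) \<le> h x"
    using asym_norm_lower[OF g] asym_norm_lower[OF h] by blast
  define c where "c = min a b / 2"
  have "c * (\<Sum>i<d+e. \<bar>z i\<bar>) \<le> l2_gauge d e g h z" for z
  proof -
    let ?S = "\<Sum>i<d. \<bar>block 0 d z i\<bar>" and ?T = "\<Sum>i<e. \<bar>block d e z i\<bar>"
    have "(\<Sum>i<d+e. \<bar>z i\<bar>) = ?S + ?T" by (simp add: sum_blocks block_def)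
    moreover have "min a b * ?S \<le> g (block 0 d z)"
      using a(2)[of "block 0 d z"] by (intro order_trans[OF mult_right_mono a(2)]) (auto intro: sum_nonneg)
    moreover have "min a b * ?T \<le> h (block d e z)"
      using b(2)[of "block d e z"] by (intro order_trans[OF mult_right_mono b(2)]) (auto intro: sum_nonneg)
    moreover have "g (block 0 d z) \<le> l2_gauge d e g h z" "h (block d e z) \<le> l2_gauge d e g h z"
      unfolding l2_gauge_def by simp_all
    ultimately show ?thesis unfolding c_def by (simp add: distrib_left)
  qed
  moreover have "c > 0" using a b by (simp add: c_def)
  ultimately show "\<exists>c>0. \<forall>x\<in>coord_space (d + e). c * (\<Sum>i<d + e. \<bar>x i\<bar>) \<le> l2_gauge d e g h x" by blast
next
  obtain A B where A: "A \<ge> 0" "\<And>x. x \<in> coord_space d \<Longrightarrow> g x \<le> A * (\<Sum>i<d. \<bar>x i\<bar>)"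
    and B: "B \<ge> 0" "\<And>x. x \<in> coord_space e \<Longrightarrow> h x \<le> B * (\<Sum>i<e. \<bar>x i\<bar>)"
    using asym_norm_upper[OF g] asym_norm_upper[OF h] by blast
  have "l2_gauge d e g h z \<le> (A + B) * (\<Sum>i<d+e. \<bar>z i\<bar>)" for z
  proof -
    let ?S = "\<Sum>i<d. \<bar>block 0 d z i\<bar>" and ?T = "\<Sum>i<e. \<bar>block d e z i\<bar>"
    have "l2_gauge d e g h z \<le> g (block 0 d z) + h (block d e z)"
      unfolding l2_gauge_def
      by (intro sqrt_sum_squares_le_sum asym_norm_nonneg[OF g] asym_norm_nonneg[OF h] block_in)
    also have "\<dots> \<le> A * ?S + B * ?T" by (intro add_mono A B block_in)
    also have "\<dots> \<le> (A + B) * (?S + ?T)"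
      using mult_nonneg_nonneg[OF A(1), of ?T] mult_nonneg_nonneg[OF B(1), of ?S]
      by (simp add: algebra_simps sum_nonneg)
    also have "?S + ?T = (\<Sum>i<d+e. \<bar>z i\<bar>)" by (simp add: sum_blocks block_def)
    finally show ?thesis .
  qed
  then show "\<exists>C\<ge>0. \<forall>x\<in>coord_space (d + e). l2_gauge d e g h x \<le> C * (\<Sum>i<d + e. \<bar>x i\<bar>)"
    using A(1) B(1) by (intro exI[of _ "A + B"]) auto
qed

lemma l2_gauge_embed:
  assumes "asym_norm d g" "asym_norm e h"
  shows "x \<in> coord_space d \<Longrightarrow> l2_gauge d e g h (embed_block 0 d x) = g x"
    and "y \<in> coord_space e \<Longrightarrow> l2_gauge d e g h (embed_block d e y) = h y"
  using assms
  by (simp_all add: l2_gauge_def block_embed_block_disjoint asym_norm_zero asym_norm_nonneg)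

subsection \<open>Characteristics of a factor are characteristics of the product\<close>

text \<open>
  Along a block of complex coordinates, padding with zeros commutes with the complex structure and
  turns a normal of the small ball into one of the big ball, as the latter projects into the former.
\<close>

lemma gauge_characteristic_embed:
  assumes g: "asym_norm (2*n) g" and b: "even b" "b + 2*n \<le> 2*N"
    and G: "\<And>z. z \<in> coord_space (2*N) \<Longrightarrow> g (block b (2*n) z) \<le> G z"
    and Ge: "\<And>x. x \<in> coord_space (2*n) \<Longrightarrow> G (embed_block b (2*n) x) = g x"
    and \<alpha>: "gauge_characteristic n g \<alpha>"
  shows "symp_action n \<alpha> \<in> action_spectrum N G"
proof -
  let ?\<gamma> = "\<lambda>t. embed_block b (2*n) (\<alpha> t)"
  have ac: "\<And>i. i < 2*n \<Longrightarrow> abs_continuous_on_Icc 0 1 (\<lambda>t. \<alpha> t i)" and cl: "\<alpha> 0 = \<alpha> 1"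
    and nc: "\<not> \<alpha> constant_on {0..1}"
    and sph: "\<And>t. t \<in> {0..1} \<Longrightarrow> \<alpha> t \<in> coord_space (2*n) \<and> g (\<alpha> t) = 1"
    and ae: "AE t in lebesgue. t \<in> {0..1} \<longrightarrow> (\<exists>v. supports (2*n) g v (\<alpha> t) \<and>
        (\<forall>i<2*n. ((\<lambda>s. \<alpha> s i) has_real_derivative cstruct v i) (at t)))"
    using \<alpha> unfolding gauge_characteristic_def by auto
  have der: "((\<lambda>s. ?\<gamma> s i) has_real_derivative cstruct (embed_block b (2*n) v) i) (at t)"
    if "\<forall>i<2*n. ((\<lambda>s. \<alpha> s i) has_real_derivative cstruct v i) (at t)" for v t i
    using that b by (auto simp: cstruct_embed_block) (auto simp: embed_block_def)
  have dots: "dot (2*N) (embed_block b (2*n) v) (?\<gamma> t) = dot (2*n) v (\<alpha> t)" if "t \<in> {0..1}" for v t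
    using sph[OF that] by (simp add: dot_embed_block[OF b(2)])
  have sup: "supports (2*N) G (embed_block b (2*n) v) (?\<gamma> t)"
    if v: "supports (2*n) g v (\<alpha> t)" and t: "t \<in> {0..1}" for v t
    unfolding supports_def
  proof (intro conjI ballI embed_block_in b)
    fix y assume y: "y \<in> coord_space (2*N)"
    have "dot (2*N) (embed_block b (2*n) v) y = dot (2*n) v (block b (2*n) y)"
      by (rule dot_embed_block[OF b(2)])
    also have "\<dots> \<le> dot (2*n) v (\<alpha> t) * g (block b (2*n) y)" using v by (simp add: supports_def)
    also have "\<dots> \<le> dot (2*n) v (\<alpha> t) * G y"
      using supports_nonneg[OF g _ v] sph[OF t] G[OF y] by (intro mult_left_mono) auto
    finally show "dot (2*N) (embed_block b (2*n) v) y \<le> dot (2*N) (embed_block b (2*n) v) (?\<gamma> t) * G y"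
      using dots[OF t] by simp
  qed
  have "gauge_characteristic N G ?\<gamma>"
    unfolding gauge_characteristic_def
  proof (intro conjI allI impI ballI)
    show "abs_continuous_on_Icc 0 1 (\<lambda>t. ?\<gamma> t i)" for i
      using ac[of "i - b"] ac_lipschitz[of "\<lambda>_. 0" 0 0 1]
      by (cases "b \<le> i \<and> i < b + 2*n") (auto simp: embed_block_def)
    show "?\<gamma> 0 = ?\<gamma> 1" using cl by simp
    show "\<not> ?\<gamma> constant_on {0..1}"
    proof
      assume "?\<gamma> constant_on {0..1}"
      then obtain c where "\<And>t. t \<in> {0..1} \<Longrightarrow> ?\<gamma> t = c" by (auto simp: constant_on_def)
      then have "\<And>t. t \<in> {0..1} \<Longrightarrow> \<alpha> t = block b (2*n) c" using sph block_embed_block by metis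
      then show False using nc by (auto simp: constant_on_def)
    qed
    show "?\<gamma> t \<in> coord_space (2*N)" "G (?\<gamma> t) = 1" if "t \<in> {0..1}" for t
      using sph[OF that] by (auto simp: Ge embed_block_in[OF b(2)])
    show "AE t in lebesgue. t \<in> {0..1} \<longrightarrow> (\<exists>v. supports (2*N) G v (?\<gamma> t) \<and>
        (\<forall>i<2*N. ((\<lambda>s. ?\<gamma> s i) has_real_derivative cstruct v i) (at t)))"
      using ae by eventually_elim (use sup der in blast)
  qed
  moreover have "symp_action N ?\<gamma> = symp_action n \<alpha>"
  proof (rule symp_action_transfer)
    show "AE t in lebesgue. t \<in> {0..1} \<longrightarrow> (\<exists>v w. dot (2*N) v (?\<gamma> t) = dot (2*n) w (\<alpha> t) \<and>
        (\<forall>i<2*N. ((\<lambda>s. ?\<gamma> s i) has_real_derivative cstruct v i) (at t)) \<and>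
        (\<forall>i<2*n. ((\<lambda>s. \<alpha> s i) has_real_derivative cstruct w i) (at t)))"
      using ae by eventually_elim (use dots der in blast)
  qed
  ultimately show ?thesis unfolding action_spectrum_def
    by (intro CollectI exI[of _ ?\<gamma>] conjI) simp_all
qed

subsection \<open>Characteristics of the product project to the factors\<close>

text \<open>
  The hypothesis compares an affine function with a smooth one that agrees with it at \<open>\<epsilon> = 0\<close>; the
  conclusion compares their right derivatives there.
\<close>

lemma l2_support_slope:
  fixes \<kappa> r s q w :: real
  assumes "\<kappa> \<ge> 0" "r\<^sup>2 + s\<^sup>2 = 1" "r \<ge> 0" "q \<ge> 0"
    and le: "\<And>\<epsilon>. \<epsilon> > 0 \<Longrightarrow> \<kappa> + \<epsilon> * w \<le> \<kappa> * sqrt ((r + \<epsilon> * q)\<^sup>2 + s\<^sup>2)"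
  shows "w \<le> \<kappa> * (r * q)"
proof (rule field_le_epsilon)
  fix e :: real assume "e > 0"
  define K where "K = \<kappa> * q\<^sup>2 / 2"
  have "K \<ge> 0" using assms by (simp add: K_def)
  define \<epsilon> where "\<epsilon> = e / (K + 1)"
  have \<epsilon>: "\<epsilon> > 0" "\<epsilon> * K \<le> e" using \<open>e > 0\<close> \<open>K \<ge> 0\<close> by (auto simp: \<epsilon>_def field_simps)
  \<comment> \<open>The bound \<open>sqrt (1 + u) \<le> 1 + u / 2\<close> for \<open>u = 2 \<epsilon> r q + \<epsilon>\<^sup>2 q\<^sup>2\<close>.\<close>
  have "sqrt ((r + \<epsilon> * q)\<^sup>2 + s\<^sup>2) \<le> 1 + (\<epsilon> * (r * q) + \<epsilon>\<^sup>2 * q\<^sup>2 / 2)"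
  proof (rule real_le_lsqrt)
    let ?u = "\<epsilon> * (r * q) + \<epsilon>\<^sup>2 * q\<^sup>2 / 2"
    have "(r + \<epsilon> * q)\<^sup>2 + s\<^sup>2 = (r\<^sup>2 + s\<^sup>2) + 2 * ?u" by (simp add: power2_eq_square algebra_simps)
    also have "\<dots> = 1 + 2 * ?u" using assms(2) by simp
    also have "\<dots> \<le> (1 + ?u)\<^sup>2" using zero_le_power2[of ?u] by (simp add: power2_eq_square algebra_simps)
    finally show "(r + \<epsilon> * q)\<^sup>2 + s\<^sup>2 \<le> (1 + ?u)\<^sup>2" .
    show "0 \<le> 1 + ?u" using assms \<epsilon>(1) by simp
  qed
  then have "\<kappa> * sqrt ((r + \<epsilon> * q)\<^sup>2 + s\<^sup>2) \<le> \<kappa> * (1 + (\<epsilon> * (r * q) + \<epsilon>\<^sup>2 * q\<^sup>2 / 2))"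
    using assms(1) by (rule mult_left_mono)
  with le[OF \<epsilon>(1)] have "\<epsilon> * w \<le> \<epsilon> * (\<kappa> * (r * q) + \<epsilon> * K)"
    by (simp add: K_def power2_eq_square algebra_simps)
  then have "w \<le> \<kappa> * (r * q) + \<epsilon> * K" using \<epsilon>(1) by simp
  with \<epsilon>(2) show "w \<le> \<kappa> * (r * q) + e" by simp
qed

text \<open>
  A support functional of the product splits: its components are normal to the scaled factors, and
  it distributes its value \<open>\<kappa>\<close> over the factors in proportion to the squared gauges. The inequalities
  come from moving \<open>z\<close> into the direction of one factor. Taken at \<open>z\<close> itself they add up to an
  equality, so both of them are equalities there.
\<close>

lemma supports_l2_gauge:
  assumes g: "asym_norm d g" and h: "asym_norm e h"
    and z: "z \<in> coord_space (d + e)" "l2_gauge d e g h z = 1"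
    and v: "supports (d + e) (l2_gauge d e g h) v z"
  defines "\<kappa> \<equiv> dot (d + e) v z"
  shows "x \<in> coord_space d \<Longrightarrow> dot d (block 0 d v) x \<le> \<kappa> * (g (block 0 d z) * g x)"
    and "y \<in> coord_space e \<Longrightarrow> dot e (block d e v) y \<le> \<kappa> * (h (block d e z) * h y)"
    and "dot d (block 0 d v) (block 0 d z) = \<kappa> * (g (block 0 d z))\<^sup>2"
    and "dot e (block d e v) (block d e z) = \<kappa> * (h (block d e z))\<^sup>2"
proof -
  let ?r = "g (block 0 d z)" and ?s = "h (block d e z)"
  have \<kappa>: "\<kappa> \<ge> 0" unfolding \<kappa>_def by (rule supports_nonneg[OF asym_norm_l2_gauge[OF g h] z(1) v z(2)])
  have r: "?r \<ge> 0" and s: "?s \<ge> 0" by (auto intro: asym_norm_nonneg[OF g] asym_norm_nonneg[OF h])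
  have rs: "?r\<^sup>2 + ?s\<^sup>2 = 1" using z(2) by (simp add: l2_gauge_def)
  have vle: "dot (d + e) v w \<le> \<kappa> * l2_gauge d e g h w" if "w \<in> coord_space (d + e)" for w
    using v that by (simp add: supports_def \<kappa>_def)
  have dz: "\<kappa> = dot d (block 0 d v) (block 0 d z) + dot e (block d e v) (block d e z)"
    by (simp only: \<kappa>_def dot_blocks)
  show 1: "dot d (block 0 d v) x \<le> \<kappa> * (?r * g x)" if x: "x \<in> coord_space d" for x
  proof (rule l2_support_slope[OF \<kappa> rs r asym_norm_nonneg[OF g x]])
    fix \<epsilon> :: real assume \<epsilon>: "\<epsilon> > 0"
    let ?w = "\<lambda>i. z i + \<epsilon> * embed_block 0 d x i"
    have w: "?w \<in> coord_space (d + e)"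
      by (intro coord_space_closed z embed_block_in) simp
    have b: "block 0 d ?w = (\<lambda>i. block 0 d z i + \<epsilon> * x i)" "block d e ?w = block d e z"
      using x by (auto simp: block_add block_scale block_embed_block_disjoint)
    have "\<kappa> + \<epsilon> * dot d (block 0 d v) x = dot (d + e) v ?w"
      unfolding dot_blocks b dz by (simp add: distrib_left sum.distrib sum_distrib_left mult.left_commute)
    also have "\<dots> \<le> \<kappa> * sqrt ((g (\<lambda>i. block 0 d z i + \<epsilon> * x i))\<^sup>2 + ?s\<^sup>2)"
      using vle[OF w] unfolding l2_gauge_def b .
    also have "\<dots> \<le> \<kappa> * sqrt ((?r + \<epsilon> * g x)\<^sup>2 + ?s\<^sup>2)"
      using asym_norm_triangle[OF g, of "block 0 d z" "\<lambda>i. \<epsilon> * x i"] asym_norm_scale[OF g x, of \<epsilon>] \<epsilon> x \<kappa>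
      by (intro mult_left_mono real_sqrt_le_mono add_right_mono power_mono asym_norm_nonneg[OF g]) auto
    finally show "\<kappa> + \<epsilon> * dot d (block 0 d v) x \<le> \<kappa> * sqrt ((?r + \<epsilon> * g x)\<^sup>2 + ?s\<^sup>2)" .
  qed
  show 2: "dot e (block d e v) y \<le> \<kappa> * (?s * h y)" if y: "y \<in> coord_space e" for y
  proof (rule l2_support_slope[OF \<kappa> _ s asym_norm_nonneg[OF h y]])
    show "?s\<^sup>2 + ?r\<^sup>2 = 1" using rs by simp
    fix \<epsilon> :: real assume \<epsilon>: "\<epsilon> > 0"
    let ?w = "\<lambda>i. z i + \<epsilon> * embed_block d e y i"
    have w: "?w \<in> coord_space (d + e)"
      by (intro coord_space_closed z embed_block_in) simp
    have b: "block d e ?w = (\<lambda>i. block d e z i + \<epsilon> * y i)" "block 0 d ?w = block 0 d z"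
      using y by (auto simp: block_add block_scale block_embed_block_disjoint)
    have "\<kappa> + \<epsilon> * dot e (block d e v) y = dot (d + e) v ?w"
      unfolding dot_blocks b dz by (simp add: distrib_left sum.distrib sum_distrib_left mult.left_commute)
    also have "\<dots> \<le> \<kappa> * sqrt ((h (\<lambda>i. block d e z i + \<epsilon> * y i))\<^sup>2 + ?r\<^sup>2)"
      using vle[OF w] unfolding l2_gauge_def b by (simp add: add.commute)
    also have "\<dots> \<le> \<kappa> * sqrt ((?s + \<epsilon> * h y)\<^sup>2 + ?r\<^sup>2)"
      using asym_norm_triangle[OF h, of "block d e z" "\<lambda>i. \<epsilon> * y i"] asym_norm_scale[OF h y, of \<epsilon>] \<epsilon> y \<kappa>
      by (intro mult_left_mono real_sqrt_le_mono add_right_mono power_mono asym_norm_nonneg[OF h]) auto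
    finally show "\<kappa> + \<epsilon> * dot e (block d e v) y \<le> \<kappa> * sqrt ((?s + \<epsilon> * h y)\<^sup>2 + ?r\<^sup>2)" .
  qed
  have "dot d (block 0 d v) (block 0 d z) \<le> \<kappa> * ?r\<^sup>2" "dot e (block d e v) (block d e z) \<le> \<kappa> * ?s\<^sup>2"
    using 1[of "block 0 d z"] 2[of "block d e z"] by (simp_all add: power2_eq_square)
  moreover have "\<kappa> * ?r\<^sup>2 + \<kappa> * ?s\<^sup>2 = \<kappa>" using rs by (simp add: distrib_left[symmetric])
  ultimately show "dot d (block 0 d v) (block 0 d z) = \<kappa> * ?r\<^sup>2" "dot e (block d e v) (block d e z) = \<kappa> * ?s\<^sup>2"
    using dz by linarith+
qed

lemma has_derivative_zero_dominated:
  fixes F :: "'j \<Rightarrow> real \<Rightarrow> real"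
  assumes J: "finite J" "\<And>j. j \<in> J \<Longrightarrow> (F j has_real_derivative 0) (at t)"
    and S: "open S" "t \<in> S"
    and le: "\<And>s. s \<in> S \<Longrightarrow> \<bar>f s - f t\<bar> \<le> C * (\<Sum>j\<in>J. \<bar>F j s - F j t\<bar>)"
  shows "(f has_real_derivative 0) (at t)"
proof -
  have "((\<lambda>s. C * (\<Sum>j\<in>J. \<bar>(F j s - F j t) / (s - t)\<bar>)) \<longlongrightarrow> C * (\<Sum>j\<in>J. \<bar>0\<bar>)) (at t)"
    using J(2) unfolding has_field_derivative_iff by (intro tendsto_intros)
  then have lim: "((\<lambda>s. C * (\<Sum>j\<in>J. \<bar>(F j s - F j t) / (s - t)\<bar>)) \<longlongrightarrow> 0) (at t)" by simp
  have "\<forall>\<^sub>F s in at t. s \<in> S" using S by (rule eventually_at_in_open')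
  then have "\<forall>\<^sub>F s in at t. norm ((f s - f t) / (s - t)) \<le> C * (\<Sum>j\<in>J. \<bar>(F j s - F j t) / (s - t)\<bar>)"
  proof eventually_elim
    case (elim s)
    have "norm ((f s - f t) / (s - t)) = \<bar>f s - f t\<bar> / \<bar>s - t\<bar>" by simp
    also have "\<dots> \<le> C * (\<Sum>j\<in>J. \<bar>F j s - F j t\<bar>) / \<bar>s - t\<bar>" by (intro divide_right_mono le elim) simp
    also have "\<dots> = C * (\<Sum>j\<in>J. \<bar>(F j s - F j t) / (s - t)\<bar>)" by (simp add: sum_divide_distrib[symmetric])
    finally show ?case .
  qed
  then have "((\<lambda>s. (f s - f t) / (s - t)) \<longlongrightarrow> 0) (at t)" by (rule Lim_null_comparison) (rule lim)
  then show ?thesis by (simp add: has_field_derivative_iff)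
qed

text \<open>
  Along a closed characteristic of the product the gauge of each factor is conserved. Each squared
  gauge can only grow at first order, because a support functional bounds it from below and does not
  change along its own Hamiltonian direction; as the two squares add up to one, neither changes.
\<close>

lemma l2_characteristic_conserves_gauge:
  assumes g: "asym_norm (2*n) g" and h: "asym_norm (2*m) h"
    and \<gamma>: "gauge_characteristic (n + m) (l2_gauge (2*n) (2*m) g h) \<gamma>"
    and t: "t \<in> {0..1}"
  shows "(g (block 0 (2*n) (\<gamma> t)))\<^sup>2 = (g (block 0 (2*n) (\<gamma> 0)))\<^sup>2"
proof -
  let ?G = "l2_gauge (2*n) (2*m) g h"
  let ?x = "\<lambda>t. block 0 (2*n) (\<gamma> t)" and ?y = "\<lambda>t. block (2*n) (2*m) (\<gamma> t)"
  define f where "f t = (g (?x t))\<^sup>2" for t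
  have ac: "\<And>i. i < 2*(n+m) \<Longrightarrow> abs_continuous_on_Icc 0 1 (\<lambda>t. \<gamma> t i)"
    and sph: "\<And>t. t \<in> {0..1} \<Longrightarrow> \<gamma> t \<in> coord_space (2*n + 2*m) \<and> ?G (\<gamma> t) = 1"
    and ae: "AE t in lebesgue. t \<in> {0..1} \<longrightarrow> (\<exists>v. supports (2*n + 2*m) ?G v (\<gamma> t) \<and>
        (\<forall>i<2*(n+m). ((\<lambda>s. \<gamma> s i) has_real_derivative cstruct v i) (at t)))"
    using \<gamma> unfolding gauge_characteristic_def distrib_left by auto
  have one: "f t + (h (?y t))\<^sup>2 = 1" if "t \<in> {0..1}" for t
    using sph[OF that] by (simp add: l2_gauge_def f_def)
  have g0: "g (?x t) \<ge> 0" for t by (intro asym_norm_nonneg[OF g] block_in)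
  have h0: "h (?y t) \<ge> 0" for t by (intro asym_norm_nonneg[OF h] block_in)
  have g1: "g (?x t) \<le> 1" if "t \<in> {0..1}" for t
  proof -
    have "f t \<le> 1" using one[OF that] zero_le_power2[of "h (?y t)"] by linarith
    then have "(g (?x t))\<^sup>2 \<le> 1\<^sup>2" by (simp add: f_def)
    then show ?thesis by (rule power2_le_imp_le) simp
  qed
  obtain C where C: "C \<ge> 0" "\<And>x y. x \<in> coord_space (2*n) \<Longrightarrow> y \<in> coord_space (2*n) \<Longrightarrow>
      \<bar>g x - g y\<bar> \<le> C * (\<Sum>i<2*n. \<bar>x i - y i\<bar>)"
    using asym_norm_lipschitz[OF g] by blast
  have fle: "\<bar>f v - f u\<bar> \<le> 2 * C * (\<Sum>i<2*n. \<bar>\<gamma> v i - \<gamma> u i\<bar>)" if "u \<in> {0..1}" "v \<in> {0..1}" for u v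
  proof -
    have "\<bar>f v - f u\<bar> = \<bar>g (?x v) + g (?x u)\<bar> * \<bar>g (?x v) - g (?x u)\<bar>"
      by (simp add: f_def abs_mult[symmetric] power2_eq_square algebra_simps)
    also have "\<dots> \<le> 2 * (C * (\<Sum>i<2*n. \<bar>?x v i - ?x u i\<bar>))"
      using g0[of u] g0[of v] g1[OF that(1)] g1[OF that(2)] by (intro mult_mono C block_in) auto
    finally show ?thesis by (simp add: block_def)
  qed
  have acf: "abs_continuous_on_Icc 0 1 f"
    by (rule ac_dominated[of "{..<2*n}" 0 1 "\<lambda>i t. \<gamma> t i" 1 "2*C"])
       (use ac C(1) fle in auto)
  have aef: "AE t in lebesgue. t \<in> {0<..<1} \<longrightarrow> (f has_real_derivative 0) (at t)"
    using ae
  proof eventually_elim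
    case (elim t)
    show ?case
    proof
      assume t: "t \<in> {0<..<1}"
      then have t': "t \<in> {0..1}" by simp
      obtain v where v: "supports (2*n + 2*m) ?G v (\<gamma> t)"
        and der: "\<And>i. i < 2*(n+m) \<Longrightarrow> ((\<lambda>s. \<gamma> s i) has_real_derivative cstruct v i) (at t)"
        using elim t' by blast
      let ?v = "block 0 (2*n) v" and ?w = "block (2*n) (2*m) v"
      define \<kappa> where "\<kappa> = dot (2*n + 2*m) v (\<gamma> t)"
      have "\<kappa> \<ge> 0"
        unfolding \<kappa>_def using supports_nonneg[OF asym_norm_l2_gauge[OF g h] _ v] sph[OF t'] by blast
      note S = supports_l2_gauge[OF g h conjunct1[OF sph[OF t']] conjunct2[OF sph[OF t']] v, folded \<kappa>_def]
      show "(f has_real_derivative 0) (at t)"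
      proof (cases "\<kappa> = 0")
        \<comment> \<open>Here the velocity vanishes and the Lipschitz bound for \<open>f\<close> suffices.\<close>
        case True
        then have "v = (\<lambda>i. 0)" using supports_eq_0[OF v] by (simp add: \<kappa>_def)
        then have "((\<lambda>s. \<gamma> s i) has_real_derivative 0) (at t)" if "i < 2*n" for i
          using der[of i] that by (simp add: cstruct_zero)
        then show ?thesis
          by (intro has_derivative_zero_dominated[of "{..<2*n}" "\<lambda>i s. \<gamma> s i" t "{0<..<1}" f "2*C"])
             (use fle t in auto)
      next
        case False
        then have "\<kappa> > 0" using \<open>\<kappa> \<ge> 0\<close> by simp
        define L where "L j s = (if j = (0::nat) then dot (2*n) ?v (?x s) else dot (2*m) ?w (?y s))" for j s
        have dx: "((\<lambda>s. ?x s i) has_real_derivative cstruct ?v i) (at t)" if "i < 2*n" for i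
          using der[of i] block_cstruct[of 0 "2*n" i v] that by (simp add: block_def)
        have dy: "((\<lambda>s. ?y s i) has_real_derivative cstruct ?w i) (at t)" if "i < 2*m" for i
          using der[of "i + 2*n"] block_cstruct[of "2*n" "2*m" i v] that by (simp add: block_def)
        have "(L 0 has_real_derivative dot (2*n) ?v (cstruct ?v)) (at t)"
          unfolding L_def if_P[OF refl] by (intro DERIV_sum DERIV_cmult dx) simp
        then have L0: "(L 0 has_real_derivative 0) (at t)" by (simp only: dot_cstruct)
        have "(L 1 has_real_derivative dot (2*m) ?w (cstruct ?w)) (at t)"
          unfolding L_def if_not_P[OF one_neq_zero] by (intro DERIV_sum DERIV_cmult dy) simp
        then have L1: "(L 1 has_real_derivative 0) (at t)" by (simp only: dot_cstruct)
        \<comment> \<open>From the support inequality for the gauge to one for its square, by \<open>(b - a)\<^sup>2 \<ge> 0\<close>.\<close>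
        have slope: "\<kappa> * (b\<^sup>2 - a\<^sup>2) \<ge> 2 * D" if "\<kappa> * a\<^sup>2 + D \<le> \<kappa> * (a * b)" for a b D :: real
        proof -
          have "\<kappa> * (b - a)\<^sup>2 \<ge> 0" using \<open>\<kappa> \<ge> 0\<close> by simp
          then show ?thesis using that by (simp add: power2_eq_square algebra_simps)
        qed
        have "\<bar>f s - f t\<bar> \<le> 2 / \<kappa> * (\<Sum>j\<in>{0,1}. \<bar>L j s - L j t\<bar>)" if "s \<in> {0<..<1}" for s
        proof -
          have "\<kappa> * ((g (?x s))\<^sup>2 - (g (?x t))\<^sup>2) \<ge> 2 * (L 0 s - L 0 t)"
            by (rule slope) (use S(1)[of "?x s"] S(3) in \<open>simp add: L_def\<close>)
          moreover have "\<kappa> * ((h (?y s))\<^sup>2 - (h (?y t))\<^sup>2) \<ge> 2 * (L 1 s - L 1 t)"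
            by (rule slope) (use S(2)[of "?y s"] S(4) in \<open>simp add: L_def\<close>)
          moreover have "(h (?y s))\<^sup>2 - (h (?y t))\<^sup>2 = - (f s - f t)"
            using one[of s] one[of t] that t' by auto
          ultimately have 1: "\<kappa> * (f s - f t) \<ge> 2 * (L 0 s - L 0 t)" and "\<kappa> * - (f s - f t) \<ge> 2 * (L 1 s - L 1 t)"
            unfolding f_def by metis+
          then have 2: "\<kappa> * (f s - f t) \<le> - (2 * (L 1 s - L 1 t))" unfolding mult_minus_right by linarith
          have "\<bar>X\<bar> \<le> 2 * \<bar>A\<bar> + 2 * \<bar>B\<bar>" if "2 * A \<le> X" "X \<le> - (2 * B)" for X A B :: real
            using that by linarith
          from this[OF 1 2]
          have "\<kappa> * \<bar>f s - f t\<bar> \<le> 2 * \<bar>L 0 s - L 0 t\<bar> + 2 * \<bar>L 1 s - L 1 t\<bar>"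
            using \<open>\<kappa> > 0\<close> by (simp add: abs_mult)
          then show ?thesis using \<open>\<kappa> > 0\<close> by (simp add: field_simps)
        qed
        then show ?thesis
          by (intro has_derivative_zero_dominated[of "{0,1}" L t "{0<..<1}" f "2/\<kappa>"]) (use L0 L1 t in auto)
      qed
    qed
  qed
  have "AE t in lebesgue. t \<noteq> 0 \<and> t \<noteq> (1::real)"
    by (intro AE_completion) (auto intro: AE_lborel_singleton AE_conjI)
  with aef have "AE t in lebesgue. t \<in> {0..1} \<longrightarrow> (f has_real_derivative 0) (at t)"
    by eventually_elim auto
  then show ?thesis using ac_zero_derivative_imp_constant[OF acf _ t] by (simp add: f_def)
qed

text \<open>
  A factor on which the conserved gauge is positive carries, after rescaling by it, a closed
  characteristic with the same action. The action density \<open>\<kappa> = dot v \<gamma>\<close> is common to the curve and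
  its rescaled projection: were the projection constant, \<open>\<kappa>\<close> and with it the velocity of the whole
  curve would vanish almost everywhere.
\<close>

lemma gauge_characteristic_block:
  assumes g: "asym_norm (2*n) g" and b: "even b" "b + 2*n \<le> 2*N"
    and \<gamma>: "gauge_characteristic N G \<gamma>"
    and r: "r > 0" "\<And>t. t \<in> {0..1} \<Longrightarrow> g (block b (2*n) (\<gamma> t)) = r"
    and split: "\<And>t v x. t \<in> {0..1} \<Longrightarrow> supports (2*N) G v (\<gamma> t) \<Longrightarrow> x \<in> coord_space (2*n) \<Longrightarrow>
       dot (2*n) (block b (2*n) v) x \<le> dot (2*N) v (\<gamma> t) * (r * g x)"
    and split': "\<And>t v. t \<in> {0..1} \<Longrightarrow> supports (2*N) G v (\<gamma> t) \<Longrightarrow>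
       dot (2*n) (block b (2*n) v) (block b (2*n) (\<gamma> t)) = dot (2*N) v (\<gamma> t) * r\<^sup>2"
  shows "symp_action N \<gamma> \<in> action_spectrum n g"
proof -
  let ?\<alpha> = "\<lambda>t i. block b (2*n) (\<gamma> t) i / r"
  have ac: "\<And>i. i < 2*N \<Longrightarrow> abs_continuous_on_Icc 0 1 (\<lambda>t. \<gamma> t i)" and cl: "\<gamma> 0 = \<gamma> 1"
    and nc: "\<not> \<gamma> constant_on {0..1}"
    and sph: "\<And>t. t \<in> {0..1} \<Longrightarrow> \<gamma> t \<in> coord_space (2*N)"
    and ae: "AE t in lebesgue. t \<in> {0..1} \<longrightarrow> (\<exists>v. supports (2*N) G v (\<gamma> t) \<and>
        (\<forall>i<2*N. ((\<lambda>s. \<gamma> s i) has_real_derivative cstruct v i) (at t)))"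
    using \<gamma> unfolding gauge_characteristic_def by auto
  let ?v = "\<lambda>v i. block b (2*n) v i / r"
  have der: "((\<lambda>s. ?\<alpha> s i) has_real_derivative cstruct (?v v) i) (at t)"
    if "\<forall>i<2*N. ((\<lambda>s. \<gamma> s i) has_real_derivative cstruct v i) (at t)" "i < 2*n" for v t i
  proof -
    have "((\<lambda>s. \<gamma> s (i + b)) has_real_derivative cstruct v (i + b)) (at t)" using that b by auto
    then have "((\<lambda>s. \<gamma> s (i + b) / r) has_real_derivative cstruct v (i + b) / r) (at t)" by (rule DERIV_cdivide)
    moreover have "cstruct (?v v) i = cstruct v (i + b) / r"
      using block_cstruct[OF b(1), of "2*n" i v] that(2) by (simp add: cstruct_def block_def split: if_splits)
    ultimately show ?thesis using that(2) by (simp add: block_def)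
  qed
  have dots: "dot (2*n) (?v v) (?\<alpha> t) = dot (2*N) v (\<gamma> t)" if "t \<in> {0..1}" "supports (2*N) G v (\<gamma> t)" for v t
  proof -
    have "dot (2*n) (?v v) (?\<alpha> t) = dot (2*n) (block b (2*n) v) (block b (2*n) (\<gamma> t)) / r\<^sup>2"
      by (simp add: sum_divide_distrib power2_eq_square)
    then show ?thesis using split'[OF that] r(1) by simp
  qed
  have sup: "supports (2*n) g (?v v) (?\<alpha> t)" if t: "t \<in> {0..1}" and v: "supports (2*N) G v (\<gamma> t)" for v t
    unfolding supports_def
  proof (intro conjI ballI)
    fix y assume y: "y \<in> coord_space (2*n)"
    have "dot (2*n) (?v v) y = dot (2*n) (block b (2*n) v) y / r" by (simp add: sum_divide_distrib)
    also have "\<dots> \<le> dot (2*N) v (\<gamma> t) * (r * g y) / r"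
      using r(1) by (intro divide_right_mono split[OF t v y]) simp
    finally show "dot (2*n) (?v v) y \<le> dot (2*n) (?v v) (?\<alpha> t) * g y" using r(1) dots[OF t v] by simp
  qed simp
  have "gauge_characteristic n g ?\<alpha>"
    unfolding gauge_characteristic_def
  proof (intro conjI allI impI ballI)
    show "abs_continuous_on_Icc 0 1 (\<lambda>t. ?\<alpha> t i)" if "i < 2*n" for i
      using ac_affine[OF ac[of "i + b"], of "1 / r" 0] that b by (simp add: block_def)
    show "?\<alpha> 0 = ?\<alpha> 1" using cl by simp
    show "?\<alpha> t \<in> coord_space (2*n)" for t by simp
    show "g (?\<alpha> t) = 1" if "t \<in> {0..1}" for t
      using asym_norm_scale[OF g, of "block b (2*n) (\<gamma> t)" "1 / r"] r that by simp
    show "AE t in lebesgue. t \<in> {0..1} \<longrightarrow> (\<exists>v. supports (2*n) g v (?\<alpha> t) \<and>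
        (\<forall>i<2*n. ((\<lambda>s. ?\<alpha> s i) has_real_derivative cstruct v i) (at t)))"
      using ae
    proof eventually_elim
      case (elim t)
      then show ?case using sup[of t] der[of _ t] by blast
    qed
    show "\<not> ?\<alpha> constant_on {0..1}"
    proof
      assume "?\<alpha> constant_on {0..1}"
      then obtain c where c: "\<And>t. t \<in> {0..1} \<Longrightarrow> ?\<alpha> t = c" by (auto simp: constant_on_def)
      have "AE t in lebesgue. t \<noteq> 0 \<and> t \<noteq> (1::real)"
        by (intro AE_completion) (auto intro: AE_lborel_singleton AE_conjI)
      with ae have z: "AE t in lebesgue. t \<in> {0..1} \<longrightarrow> (\<forall>i<2*N. ((\<lambda>s. \<gamma> s i) has_real_derivative 0) (at t))"
      proof eventually_elim
        case (elim t)
        show ?case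
        proof
          assume t: "t \<in> {0..1}"
          with elim obtain v where v: "supports (2*N) G v (\<gamma> t)"
            and d: "\<forall>i<2*N. ((\<lambda>s. \<gamma> s i) has_real_derivative cstruct v i) (at t)" by blast
          have t': "t \<in> {0<..<1}" using t elim by auto
          have "cstruct (?v v) i = 0" if "i < 2*n" for i
          proof -
            have "((\<lambda>s. c i) has_real_derivative cstruct (?v v) i) (at t)"
            proof (rule has_field_derivative_transform_within_open[OF der[OF d that]])
              show "?\<alpha> s i = c i" if "s \<in> {0<..<1}" for s
                using fun_cong[OF c[of s]] that by simp
            qed (use t' in auto)
            then show ?thesis using DERIV_unique DERIV_const by blast
          qed
          moreover have "dot (2*n) (?v v) (?v v) = dot (2*n) (cstruct (?v v)) (cstruct (?v v))"
            by (simp add: sum_lessThan_double cstruct_def add.commute)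
          ultimately have "dot (2*n) (?v v) (?v v) = 0" by simp
          then have "\<forall>i<2*n. ?v v i = 0" by (auto simp: sum_nonneg_eq_0_iff)
          then have "dot (2*n) (?v v) (?\<alpha> t) = 0"
            by (intro sum.neutral ballI) (metis lessThan_iff mult_zero_left)
          then have "dot (2*N) v (\<gamma> t) = 0" using dots[OF t v] by simp
          then have "v = (\<lambda>i. 0)" by (rule supports_eq_0[OF v])
          then show "\<forall>i<2*N. ((\<lambda>s. \<gamma> s i) has_real_derivative 0) (at t)" using d by (simp add: cstruct_zero)
        qed
      qed
      have "\<gamma> t = \<gamma> 0" if t: "t \<in> {0..1}" for t
      proof
        fix i
        show "\<gamma> t i = \<gamma> 0 i"
        proof (cases "i < 2*N")
          case True
          have "AE t in lebesgue. t \<in> {0..1} \<longrightarrow> ((\<lambda>s. \<gamma> s i) has_real_derivative 0) (at t)"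
            using z by eventually_elim (use True in blast)
          then show ?thesis using ac_zero_derivative_imp_constant[OF ac[OF True] _ t] by simp
        next
          case False
          then show ?thesis using sph[OF t] sph[of 0] by (auto simp: in_coord_space)
        qed
      qed
      then have "\<gamma> constant_on {0..1}" unfolding constant_on_def by (intro exI ballI)
      then show False using nc by contradiction
    qed
  qed
  moreover have "symp_action N \<gamma> = symp_action n ?\<alpha>"
  proof (rule symp_action_transfer)
    show "AE t in lebesgue. t \<in> {0..1} \<longrightarrow> (\<exists>v w. dot (2*N) v (\<gamma> t) = dot (2*n) w (?\<alpha> t) \<and>
        (\<forall>i<2*N. ((\<lambda>s. \<gamma> s i) has_real_derivative cstruct v i) (at t)) \<and>
        (\<forall>i<2*n. ((\<lambda>s. ?\<alpha> s i) has_real_derivative cstruct w i) (at t)))"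
      using ae
    proof eventually_elim
      case (elim t)
      show ?case
      proof
        assume t: "t \<in> {0..1}"
        then obtain v where v: "supports (2*N) G v (\<gamma> t)"
          and d: "\<forall>i<2*N. ((\<lambda>s. \<gamma> s i) has_real_derivative cstruct v i) (at t)" using elim by blast
        show "\<exists>v w. dot (2*N) v (\<gamma> t) = dot (2*n) w (?\<alpha> t) \<and>
            (\<forall>i<2*N. ((\<lambda>s. \<gamma> s i) has_real_derivative cstruct v i) (at t)) \<and>
            (\<forall>i<2*n. ((\<lambda>s. ?\<alpha> s i) has_real_derivative cstruct w i) (at t))"
          by (intro exI[of _ v] exI[of _ "?v v"] conjI dots[OF t v, symmetric] d allI impI der[OF d])
      qed
    qed
  qed
  ultimately show ?thesis unfolding action_spectrum_def by (intro CollectI exI[of _ ?\<alpha>] conjI)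
qed

text \<open>
  Each closed characteristic of the product has the action of one in a factor, and those of the
  factors embed. Stated for the sets of actions rather than for their infima, the identity covers
  an empty spectrum too, whose infimum is some fixed real number.
\<close>

theorem action_spectrum_l2_gauge:
  assumes g: "asym_norm (2*n) g" and h: "asym_norm (2*m) h"
  shows "action_spectrum (n + m) (l2_gauge (2*n) (2*m) g h) = action_spectrum n g \<union> action_spectrum m h"
proof (intro equalityI subsetI)
  let ?G = "l2_gauge (2*n) (2*m) g h"
  fix a assume "a \<in> action_spectrum (n + m) ?G"
  then obtain \<gamma> where a: "a = symp_action (n + m) \<gamma>" and \<gamma>: "gauge_characteristic (n + m) ?G \<gamma>"
    by (auto simp: action_spectrum_def)
  have D: "2 * (n + m) = 2*n + 2*m" by simp
  have sph: "\<gamma> t \<in> coord_space (2*n + 2*m)" "?G (\<gamma> t) = 1" if "t \<in> {0..1}" for t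
    using \<gamma> that unfolding gauge_characteristic_def D by blast+
  let ?x = "\<lambda>t. block 0 (2*n) (\<gamma> t)" and ?y = "\<lambda>t. block (2*n) (2*m) (\<gamma> t)"
  have one: "(g (?x t))\<^sup>2 + (h (?y t))\<^sup>2 = 1" if "t \<in> {0..1}" for t
    using sph[OF that] by (simp add: l2_gauge_def)
  have nn: "g (?x t) \<ge> 0" "h (?y t) \<ge> 0" for t
    by (auto intro: asym_norm_nonneg[OF g] asym_norm_nonneg[OF h])
  have cons: "(g (?x t))\<^sup>2 = (g (?x 0))\<^sup>2" if "t \<in> {0..1}" for t
    by (rule l2_characteristic_conserves_gauge[OF g h \<gamma> that])
  have gx: "g (?x t) = g (?x 0)" if "t \<in> {0..1}" for t
    by (rule power2_eq_imp_eq[OF cons[OF that] nn(1) nn(1)])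
  have cons': "(h (?y t))\<^sup>2 = (h (?y 0))\<^sup>2" if "t \<in> {0..1}" for t
    using cons[OF that] one[OF that] one[of 0] by simp
  have hy: "h (?y t) = h (?y 0)" if "t \<in> {0..1}" for t
    by (rule power2_eq_imp_eq[OF cons'[OF that] nn(2) nn(2)])
  show "a \<in> action_spectrum n g \<union> action_spectrum m h"
  proof (cases "g (?x 0) = 0")
    case False
    then have pos: "g (?x 0) > 0" using nn[of 0] by simp
    have "symp_action (n + m) \<gamma> \<in> action_spectrum n g"
    proof (rule gauge_characteristic_block[OF g _ _ \<gamma> pos gx])
      fix t v assume t: "t \<in> {0..1}" and v: "supports (2 * (n + m)) ?G v (\<gamma> t)"
      note S = supports_l2_gauge[OF g h sph[OF t] v[unfolded D], folded D]
      show "dot (2*n) (block 0 (2*n) v) x \<le> dot (2*(n+m)) v (\<gamma> t) * (g (?x 0) * g x)"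
        if "x \<in> coord_space (2*n)" for x using S(1)[OF that] gx[OF t] by simp
      show "dot (2*n) (block 0 (2*n) v) (?x t) = dot (2*(n+m)) v (\<gamma> t) * (g (?x 0))\<^sup>2"
        using S(3) gx[OF t] by simp
    qed auto
    then show ?thesis using a by simp
  next
    case True
    then have pos: "h (?y 0) > 0" using nn[of 0] one[of 0] by (cases "h (?y 0) = 0") auto
    have "symp_action (n + m) \<gamma> \<in> action_spectrum m h"
    proof (rule gauge_characteristic_block[OF h _ _ \<gamma> pos hy])
      fix t v assume t: "t \<in> {0..1}" and v: "supports (2 * (n + m)) ?G v (\<gamma> t)"
      note S = supports_l2_gauge[OF g h sph[OF t] v[unfolded D], folded D]
      show "dot (2*m) (block (2*n) (2*m) v) y \<le> dot (2*(n+m)) v (\<gamma> t) * (h (?y 0) * h y)"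
        if "y \<in> coord_space (2*m)" for y using S(2)[OF that] hy[OF t] by simp
      show "dot (2*m) (block (2*n) (2*m) v) (?y t) = dot (2*(n+m)) v (\<gamma> t) * (h (?y 0))\<^sup>2"
        using S(4) hy[OF t] by simp
    qed auto
    then show ?thesis using a by simp
  qed
next
  fix a assume "a \<in> action_spectrum n g \<union> action_spectrum m h"
  then show "a \<in> action_spectrum (n + m) (l2_gauge (2*n) (2*m) g h)"
  proof
    assume "a \<in> action_spectrum n g"
    then obtain \<alpha> where "a = symp_action n \<alpha>" "gauge_characteristic n g \<alpha>"
      by (auto simp: action_spectrum_def)
    then show ?thesis
      using gauge_characteristic_embed[OF g, of 0 "n + m" "l2_gauge (2*n) (2*m) g h"]
        l2_gauge_embed(1)[OF g h] by (simp add: l2_gauge_def)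
  next
    assume "a \<in> action_spectrum m h"
    then obtain \<alpha> where "a = symp_action m \<alpha>" "gauge_characteristic m h \<alpha>"
      by (auto simp: action_spectrum_def)
    then show ?thesis
      using gauge_characteristic_embed[OF h, of "2*n" "n + m" "l2_gauge (2*n) (2*m) g h"]
        l2_gauge_embed(2)[OF g h] by (simp add: l2_gauge_def)
  qed
qed

section \<open>Volume\<close>

text \<open>
  The Gaussian integral of a gauge is \<open>n!\<close> times the volume of its unit ball in dimension \<open>2n\<close>, and
  it is visibly multiplicative under two-products.
\<close>

abbreviation lebesgue_prod :: "nat set \<Rightarrow> (nat \<Rightarrow> real) measure" where
  "lebesgue_prod I \<equiv> PiM I (\<lambda>_. lborel)"

definition gaussian_integral :: "nat \<Rightarrow> ((nat \<Rightarrow> real) \<Rightarrow> real) \<Rightarrow> ennreal" where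
  "gaussian_integral d g = (\<integral>\<^sup>+x. ennreal (exp (- (g (block 0 d x))\<^sup>2)) \<partial>lebesgue_prod {..<d})"

interpretation lborel_power: product_sigma_finite "\<lambda>_::nat. lborel :: real measure"
  by standard

lemma measurable_block:
  assumes "\<And>i. i < d \<Longrightarrow> i + b \<in> I"
  shows "block b d \<in> borel_measurable (lebesgue_prod I)"
proof -
  have "(\<lambda>x i. if i < d then x (i + b) else 0) \<in> measurable (lebesgue_prod I) (PiM UNIV (\<lambda>_. borel))"
  proof (rule measurable_PiM_single')
    show "(\<lambda>x. if i < d then x (i + b) else 0) \<in> borel_measurable (lebesgue_prod I)" for i
      using assms[of i] by (cases "i < d") (auto intro: measurable_component_singleton[THEN measurable_compose])
  qed auto
  then show ?thesis
    unfolding block_def[abs_def] using measurable_cong_sets[OF refl sets_PiM_equal_borel] by blast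
qed

lemma measurable_asym_norm_block:
  assumes g: "asym_norm d g" and I: "\<And>i. i < d \<Longrightarrow> i + b \<in> I"
  shows "(\<lambda>x. g (\<lambda>i. block b d x i - (if i < d then p i else 0))) \<in> borel_measurable (lebesgue_prod I)"
proof -
  have "(\<lambda>x. g (\<lambda>i. if i < d then x i - p i else 0)) \<in> borel_measurable borel"
    by (intro borel_measurable_continuous_onI continuous_on_asym_norm[OF g])
  from measurable_compose[OF measurable_block[OF I] this]
  have "(\<lambda>x. g (\<lambda>i. if i < d then block b d x i - p i else 0)) \<in> borel_measurable (lebesgue_prod I)" .
  moreover have "(\<lambda>i. if i < d then block b d x i - p i else 0) = (\<lambda>i. block b d x i - (if i < d then p i else 0))" for x
    by (auto simp: block_def)
  ultimately show ?thesis by simp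
qed

lemma measurable_asym_norm_block0:
  assumes g: "asym_norm d g" and I: "\<And>i. i < d \<Longrightarrow> i + b \<in> I"
  shows "(\<lambda>x. g (block b d x)) \<in> borel_measurable (lebesgue_prod I)"
  using measurable_asym_norm_block[OF assms, of "\<lambda>_. 0"] by simp

lemma lebesgue_prod_affine:
  fixes p :: "nat \<Rightarrow> real"
  assumes c: "c > 0" and A: "A \<in> sets (lebesgue_prod {..<d})"
  defines "T \<equiv> \<lambda>x. \<lambda>i\<in>{..<d}. p i + c * x i"
  shows "emeasure (lebesgue_prod {..<d}) A
       = ennreal (c ^ d) * emeasure (lebesgue_prod {..<d}) (T -` A \<inter> space (lebesgue_prod {..<d}))"
proof -
  let ?L = "lebesgue_prod {..<d}"
  have T: "T \<in> measurable ?L ?L" unfolding T_def by measurable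
  have "density (distr ?L ?L T) (\<lambda>_. ennreal (c ^ d)) = ?L"
  proof (rule lborel_power.PiM_eqI)
    fix B :: "nat \<Rightarrow> real set" assume B: "\<And>i. i \<in> {..<d} \<Longrightarrow> B i \<in> sets lborel"
    have BE: "Pi\<^sub>E {..<d} B \<in> sets ?L" using B by (intro sets_PiM_I_finite) auto
    have one: "ennreal c * emeasure lborel ((\<lambda>x. p i + c * x) -` B i) = emeasure lborel (B i)" if "i < d" for i
    proof -
      have Bi: "B i \<in> sets borel" using B that by simp
      have "emeasure lborel (B i) = emeasure (density (distr lborel borel (\<lambda>x. p i + c * x)) (\<lambda>_. ennreal \<bar>c\<bar>)) (B i)"
        using lborel_real_affine[of c "p i"] c by simp
      also have "\<dots> = ennreal c * emeasure lborel ((\<lambda>x. p i + c * x) -` B i)"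
        using c Bi by (simp add: emeasure_density_const emeasure_distr)
      finally show ?thesis by simp
    qed
    have "T -` Pi\<^sub>E {..<d} B \<inter> space ?L = Pi\<^sub>E {..<d} (\<lambda>i. (\<lambda>x. p i + c * x) -` B i)"
      by (auto simp: T_def space_PiM PiE_iff)
    moreover have "emeasure ?L (Pi\<^sub>E {..<d} (\<lambda>i. (\<lambda>x. p i + c * x) -` B i))
       = (\<Prod>i<d. emeasure lborel ((\<lambda>x. p i + c * x) -` B i))"
    proof (rule lborel_power.emeasure_PiM)
      show "(\<lambda>x. p i + c * x) -` B i \<in> sets lborel" if "i \<in> {..<d}" for i
        using measurable_sets[of "\<lambda>x. p i + c * x" borel borel "B i"] B[OF that] by simp
    qed simp
    ultimately have "emeasure (density (distr ?L ?L T) (\<lambda>_. ennreal (c ^ d))) (Pi\<^sub>E {..<d} B)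
       = ennreal (c ^ d) * (\<Prod>i<d. emeasure lborel ((\<lambda>x. p i + c * x) -` B i))"
      using BE by (simp add: emeasure_density_const emeasure_distr[OF T])
    also have "\<dots> = (\<Prod>i<d. ennreal c * emeasure lborel ((\<lambda>x. p i + c * x) -` B i))"
      using c by (simp add: prod.distrib ennreal_power)
    also have "\<dots> = (\<Prod>i\<in>{..<d}. emeasure lborel (B i))" using one by (intro prod.cong) auto
    finally show "emeasure (density (distr ?L ?L T) (\<lambda>_. ennreal (c ^ d))) (Pi\<^sub>E {..<d} B)
       = (\<Prod>i\<in>{..<d}. emeasure lborel (B i))" .
  qed simp_all
  then have "emeasure ?L A = emeasure (density (distr ?L ?L T) (\<lambda>_. ennreal (c ^ d))) A" by simp
  also have "\<dots> = ennreal (c ^ d) * emeasure ?L (T -` A \<inter> space ?L)"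
    using A by (simp add: emeasure_density_const emeasure_distr[OF T])
  finally show ?thesis .
qed

lemma emeasure_gauge_sublevel:
  assumes g: "asym_norm d g" and p: "p \<in> coord_space d" and r: "r > 0"
  shows "emeasure (lebesgue_prod {..<d}) {x \<in> space (lebesgue_prod {..<d}). g (\<lambda>i. block 0 d x i - p i) \<le> r}
     = ennreal (r ^ d) * emeasure (lebesgue_prod {..<d}) {x \<in> space (lebesgue_prod {..<d}). g (block 0 d x) \<le> 1}"
proof -
  let ?L = "lebesgue_prod {..<d}"
  define T where "T x = (\<lambda>i\<in>{..<d}. p i + r * x i)" for x :: "nat \<Rightarrow> real"
  have p': "(\<lambda>i. if i < d then p i else 0) = p" using p by (auto simp: in_coord_space)
  have "(\<lambda>x. g (\<lambda>i. block 0 d x i - (if i < d then p i else 0))) \<in> borel_measurable ?L"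
    by (rule measurable_asym_norm_block[OF g]) simp
  then have A: "{x \<in> space ?L. g (\<lambda>i. block 0 d x i - p i) \<le> r} \<in> sets ?L"
    unfolding fun_cong[OF p'] by measurable
  have "(\<lambda>i. block 0 d (T x) i - p i) = (\<lambda>i. r * block 0 d x i)" for x
    using p by (auto simp: T_def block_def in_coord_space)
  then have "g (\<lambda>i. block 0 d (T x) i - p i) \<le> r \<longleftrightarrow> g (block 0 d x) \<le> 1" for x
    using asym_norm_scale[OF g, of "block 0 d x" r] r by simp
  moreover have "T x \<in> space ?L" for x by (simp add: T_def space_PiM)
  ultimately have "T -` {x \<in> space ?L. g (\<lambda>i. block 0 d x i - p i) \<le> r} \<inter> space ?L
     = {x \<in> space ?L. g (block 0 d x) \<le> 1}" by auto
  with lebesgue_prod_affine[OF r A, of p] show ?thesis unfolding T_def by simp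
qed

lemma vol_gauge_ball:
  assumes g: "asym_norm d g" and p: "p \<in> coord_space d"
  shows "vol d (gauge_ball d p g)
     = enn2real (emeasure (lebesgue_prod {..<d}) {x \<in> space (lebesgue_prod {..<d}). g (block 0 d x) \<le> 1})"
proof -
  have "(\<lambda>x. restrict x {..<d}) ` gauge_ball d p g
     = {x \<in> space (lebesgue_prod {..<d}). g (\<lambda>i. block 0 d x i - p i) \<le> 1}"
  proof (intro equalityI subsetI)
    fix y assume "y \<in> (\<lambda>x. restrict x {..<d}) ` gauge_ball d p g"
    then obtain x where x: "x \<in> coord_space d" "g (\<lambda>i. x i - p i) \<le> 1" "y = restrict x {..<d}"
      by (auto simp: gauge_ball_def)
    moreover have "block 0 d y = x" using x(1,3) by (auto simp: block_def in_coord_space)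
    ultimately show "y \<in> {x \<in> space (lebesgue_prod {..<d}). g (\<lambda>i. block 0 d x i - p i) \<le> 1}"
      by (simp add: space_PiM)
  next
    fix y assume y: "y \<in> {x \<in> space (lebesgue_prod {..<d}). g (\<lambda>i. block 0 d x i - p i) \<le> 1}"
    then have "y = restrict (block 0 d y) {..<d}"
      by (auto simp: space_PiM PiE_def extensional_def block_def restrict_def)
    moreover have "block 0 d y \<in> gauge_ball d p g" using y by (simp add: gauge_ball_def)
    ultimately show "y \<in> (\<lambda>x. restrict x {..<d}) ` gauge_ball d p g" by blast
  qed
  then show ?thesis
    unfolding vol_def measure_def using emeasure_gauge_sublevel[OF g p, of 1] by simp
qed

lemma ennreal_fact: "ennreal (fact n) = fact n"
  by (metis ennreal_of_nat_eq_real_of_nat of_nat_fact)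

text \<open>
  Layer-cake: \<open>exp (- g\<^sup>2)\<close> is the integral of \<open>exp (- s)\<close> over \<open>s \<ge> g\<^sup>2\<close>, and the ball of radius
  \<open>sqrt s\<close> has \<open>s ^ n\<close> times the volume of the unit ball, so that a Gamma integral remains.
\<close>

lemma gaussian_integral_eq_volume:
  assumes g: "asym_norm (2*n) g"
  shows "gaussian_integral (2*n) g = fact n *
     emeasure (lebesgue_prod {..<2*n}) {x \<in> space (lebesgue_prod {..<2*n}). g (block 0 (2*n) x) \<le> 1}"
proof -
  let ?L = "lebesgue_prod {..<2*n}"
  define G where "G x = g (block 0 (2*n) x)" for x
  define U where "U = emeasure ?L {x \<in> space ?L. G x \<le> 1}"
  have G[measurable]: "G \<in> borel_measurable ?L"
    unfolding G_def by (rule measurable_asym_norm_block0[OF g]) simp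
  have G0: "G x \<ge> 0" for x unfolding G_def by (intro asym_norm_nonneg[OF g] block_in)
  interpret L: sigma_finite_measure ?L by (rule lborel_power.sigma_finite) simp
  interpret P: pair_sigma_finite ?L lborel ..
  let ?f = "\<lambda>x s. ennreal (exp (- s)) * indicator {(G x)\<^sup>2..} s"
  have "(\<integral>\<^sup>+s. ?f x s \<partial>lborel) = ennreal (exp (- (G x)\<^sup>2))" for x
  proof -
    have "(\<integral>\<^sup>+s. ?f x s \<partial>lborel) = ennreal (0 - (- exp (- (G x)\<^sup>2)))"
    proof (rule nn_integral_FTC_atLeast)
      show "((\<lambda>s. - exp (- s)) \<longlongrightarrow> (0::real)) at_top"
        using tendsto_minus[OF filterlim_compose[OF exp_at_bot filterlim_uminus_at_bot_at_top]] by simp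
    qed (auto intro!: derivative_eq_intros)
    then show ?thesis by simp
  qed
  then have "gaussian_integral (2*n) g = (\<integral>\<^sup>+x. (\<integral>\<^sup>+s. ?f x s \<partial>lborel) \<partial>?L)"
    by (simp add: gaussian_integral_def G_def)
  also have "\<dots> = (\<integral>\<^sup>+s. (\<integral>\<^sup>+x. ?f x s \<partial>?L) \<partial>lborel)"
  proof (rule P.Fubini'[symmetric])
    have "(\<lambda>(x, s). ennreal (exp (- s)) * (if (G x)\<^sup>2 \<le> s then 1 else 0)) \<in> borel_measurable (?L \<Otimes>\<^sub>M lborel)"
      by measurable
    then show "(\<lambda>(x, s). ?f x s) \<in> borel_measurable (?L \<Otimes>\<^sub>M lborel)"
      by (simp add: indicator_def)
  qed
  also have "\<dots> = (\<integral>\<^sup>+s. ennreal (s ^ n * exp (- s)) * indicator {0..} s * U \<partial>lborel)"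
  proof (rule nn_integral_cong_AE)
    have "AE s in lborel. s \<noteq> (0::real)" by (rule AE_lborel_singleton)
    then show "AE s in lborel. (\<integral>\<^sup>+x. ?f x s \<partial>?L) = ennreal (s ^ n * exp (- s)) * indicator {0..} s * U"
    proof eventually_elim
      case (elim s)
      have "(\<integral>\<^sup>+x. ?f x s \<partial>?L) = (\<integral>\<^sup>+x. ennreal (exp (- s)) * indicator {x \<in> space ?L. (G x)\<^sup>2 \<le> s} x \<partial>?L)"
        by (intro nn_integral_cong) (auto simp: indicator_def)
      also have "\<dots> = ennreal (exp (- s)) * emeasure ?L {x \<in> space ?L. (G x)\<^sup>2 \<le> s}"
        by (intro nn_integral_cmult_indicator) measurable
      also have "\<dots> = ennreal (s ^ n * exp (- s)) * indicator {0..} s * U"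
      proof (cases "s > 0")
        case True
        have "(G x)\<^sup>2 \<le> s \<longleftrightarrow> G x \<le> sqrt s" for x
          using G0[of x] real_sqrt_le_iff[of "(G x)\<^sup>2" s] by simp
        then have "emeasure ?L {x \<in> space ?L. (G x)\<^sup>2 \<le> s} = ennreal (sqrt s ^ (2 * n)) * U"
          using emeasure_gauge_sublevel[OF g, of "\<lambda>i. 0" "sqrt s"] True by (simp add: G_def U_def)
        also have "sqrt s ^ (2 * n) = s ^ n" using True by (simp add: power_mult)
        finally show ?thesis
          using True by (simp add: ennreal_mult ac_simps)
      next
        case False
        then have "s < 0" using elim by simp
        then have "{x \<in> space ?L. (G x)\<^sup>2 \<le> s} = {}" by (auto simp: not_le intro: less_le_trans)
        then have "emeasure ?L {x \<in> space ?L. (G x)\<^sup>2 \<le> s} = 0" by (simp only: emeasure_empty)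
        then show ?thesis using \<open>s < 0\<close> by simp
      qed
      finally show ?case .
    qed
  qed
  also have "\<dots> = (\<integral>\<^sup>+s. ennreal (s ^ n * exp (- s)) * indicator {0..} s \<partial>lborel) * U"
    by (rule nn_integral_multc) measurable
  also have "\<dots> = fact n * U"
    unfolding nn_intergal_power_times_exp_Ici by (simp add: ennreal_fact)
  finally show ?thesis unfolding U_def G_def .
qed

text \<open>The denominator of the systolic ratio; translating the ball to the origin does not change it.\<close>

lemma fact_vol_gauge_ball:
  assumes g: "asym_norm (2*n) g" and p: "p \<in> coord_space (2*n)"
  shows "fact n * vol (2*n) (gauge_ball (2*n) p g) = enn2real (gaussian_integral (2*n) g)"
proof -
  have "enn2real (fact n) = fact n" by (metis enn2real_ennreal ennreal_fact fact_ge_zero)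
  then show ?thesis
    unfolding vol_gauge_ball[OF assms] gaussian_integral_eq_volume[OF g] enn2real_mult by simp
qed

lemma lebesgue_prod_shift:
  "distr (lebesgue_prod {d..<d+e}) (lebesgue_prod {..<e}) (\<lambda>x. \<lambda>i\<in>{..<e}. x (i + d)) = lebesgue_prod {..<e}"
proof (rule lborel_power.PiM_eqI)
  let ?S = "\<lambda>x::nat\<Rightarrow>real. \<lambda>i\<in>{..<e}. x (i + d)"
  have S: "?S \<in> measurable (lebesgue_prod {d..<d+e}) (lebesgue_prod {..<e})"
    by (intro measurable_restrict measurable_component_singleton) auto
  fix B :: "nat \<Rightarrow> real set" assume B: "\<And>i. i \<in> {..<e} \<Longrightarrow> B i \<in> sets lborel"
  have "?S -` Pi\<^sub>E {..<e} B \<inter> space (lebesgue_prod {d..<d+e}) = Pi\<^sub>E {d..<d+e} (\<lambda>i. B (i - d))"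
  proof (intro equalityI subsetI)
    fix x assume x: "x \<in> ?S -` Pi\<^sub>E {..<e} B \<inter> space (lebesgue_prod {d..<d+e})"
    have "x i \<in> B (i - d)" if "i \<in> {d..<d+e}" for i
    proof -
      have i: "i - d < e" "i - d + d = i" using that by (simp, linarith, simp)
      have "?S x \<in> Pi\<^sub>E {..<e} B" using x by simp
      from PiE_mem[OF this, of "i - d"] i(1) have "?S x (i - d) \<in> B (i - d)" by simp
      then show ?thesis using i by simp
    qed
    moreover have "x \<in> extensional {d..<d+e}" using x by (simp add: space_PiM PiE_def)
    ultimately show "x \<in> Pi\<^sub>E {d..<d+e} (\<lambda>i. B (i - d))" by (intro PiE_I) (auto simp: extensional_def)
  next
    fix x assume x: "x \<in> Pi\<^sub>E {d..<d+e} (\<lambda>i. B (i - d))"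
    have "x (i + d) \<in> B i" if "i < e" for i using PiE_mem[OF x, of "i + d"] that by simp
    then show "x \<in> ?S -` Pi\<^sub>E {..<e} B \<inter> space (lebesgue_prod {d..<d+e})"
      using x by (auto simp: space_PiM PiE_iff)
  qed
  moreover have "emeasure (lebesgue_prod {d..<d+e}) (Pi\<^sub>E {d..<d+e} (\<lambda>i. B (i - d)))
      = (\<Prod>i\<in>{d..<d+e}. emeasure lborel (B (i - d)))"
    using B by (intro lborel_power.emeasure_PiM) auto
  moreover have "(\<Prod>i\<in>{d..<d+e}. emeasure lborel (B (i - d))) = (\<Prod>i\<in>{0..<e}. emeasure lborel (B i))"
    using prod.shift_bounds_nat_ivl[of "\<lambda>i. emeasure lborel (B (i - d))" 0 d e] by (simp add: add.commute)
  ultimately show "emeasure (distr (lebesgue_prod {d..<d+e}) (lebesgue_prod {..<e}) ?S) (Pi\<^sub>E {..<e} B)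
      = (\<Prod>i\<in>{..<e}. emeasure lborel (B i))"
    using sets_PiM_I_finite[of "{..<e}" B "\<lambda>_. lborel"] B by (simp add: emeasure_distr[OF S] atLeast0LessThan)
qed simp_all

text \<open>The Gaussian of the product gauge is the product of the Gaussians in complementary variables.\<close>

theorem gaussian_integral_l2_gauge:
  assumes g: "asym_norm d g" and h: "asym_norm e h"
  shows "gaussian_integral (d + e) (l2_gauge d e g h) = gaussian_integral d g * gaussian_integral e h"
proof -
  let ?I = "{..<d}" and ?J = "{d..<d+e}"
  define a where "a x = ennreal (exp (- (g (block 0 d x))\<^sup>2))" for x
  define b where "b y = ennreal (exp (- (h (block d e y))\<^sup>2))" for y
  define b' where "b' y = ennreal (exp (- (h (block 0 e y))\<^sup>2))" for y
  have am: "a \<in> borel_measurable (lebesgue_prod ?I)"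
    unfolding a_def using measurable_asym_norm_block0[OF g, of 0 ?I] by measurable
  have am': "a \<in> borel_measurable (lebesgue_prod {..<d+e})"
    unfolding a_def using measurable_asym_norm_block0[OF g, of 0 "{..<d+e}"] by measurable
  have bm: "b \<in> borel_measurable (lebesgue_prod ?J)"
    unfolding b_def using measurable_asym_norm_block0[OF h, of d ?J] by measurable
  have bm': "b \<in> borel_measurable (lebesgue_prod {..<d+e})"
    unfolding b_def using measurable_asym_norm_block0[OF h, of d "{..<d+e}"] by measurable
  have b'm: "b' \<in> borel_measurable (lebesgue_prod {..<e})"
    unfolding b'_def using measurable_asym_norm_block0[OF h, of 0 "{..<e}"] by measurable
  have IJ: "?I \<union> ?J = {..<d+e}" by auto
  have "block 0 d (block 0 (d+e) z) = block 0 d z" "block d e (block 0 (d+e) z) = block d e z" for z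
    by (auto simp: block_def)
  then have "ennreal (exp (- (l2_gauge d e g h (block 0 (d+e) z))\<^sup>2)) = a z * b z" for z
    by (simp add: l2_gauge_def a_def b_def exp_add[symmetric] ennreal_mult[symmetric])
  then have "gaussian_integral (d + e) (l2_gauge d e g h) = (\<integral>\<^sup>+z. a z * b z \<partial>lebesgue_prod (?I \<union> ?J))"
    by (simp add: gaussian_integral_def IJ)
  also have "\<dots> = (\<integral>\<^sup>+x. (\<integral>\<^sup>+y. a (merge ?I ?J (x, y)) * b (merge ?I ?J (x, y)) \<partial>lebesgue_prod ?J) \<partial>lebesgue_prod ?I)"
  proof (rule lborel_power.product_nn_integral_fold)
    show "(\<lambda>z. a z * b z) \<in> borel_measurable (lebesgue_prod (?I \<union> ?J))"
      unfolding IJ by (rule borel_measurable_times_ennreal[OF am' bm'])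
  qed auto
  also have "\<dots> = (\<integral>\<^sup>+x. (\<integral>\<^sup>+y. a x * b y \<partial>lebesgue_prod ?J) \<partial>lebesgue_prod ?I)"
  proof -
    have "block 0 d (merge ?I ?J (x, y)) = block 0 d x" "block d e (merge ?I ?J (x, y)) = block d e y" for x y
      by (auto simp: block_def merge_def)
    then show ?thesis by (simp add: a_def b_def)
  qed
  also have "\<dots> = (\<integral>\<^sup>+x. a x * (\<integral>\<^sup>+y. b y \<partial>lebesgue_prod ?J) \<partial>lebesgue_prod ?I)"
    by (simp add: nn_integral_cmult[OF bm])
  also have "\<dots> = (\<integral>\<^sup>+x. a x \<partial>lebesgue_prod ?I) * (\<integral>\<^sup>+y. b y \<partial>lebesgue_prod ?J)"
    by (rule nn_integral_multc[OF am])
  also have "(\<integral>\<^sup>+y. b y \<partial>lebesgue_prod ?J) = (\<integral>\<^sup>+y. b' y \<partial>lebesgue_prod {..<e})"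
  proof -
    let ?S = "\<lambda>x::nat\<Rightarrow>real. \<lambda>i\<in>{..<e}. x (i + d)"
    have S: "?S \<in> measurable (lebesgue_prod ?J) (lebesgue_prod {..<e})"
      by (intro measurable_restrict measurable_component_singleton) auto
    have "(\<integral>\<^sup>+y. b' y \<partial>lebesgue_prod {..<e}) = (\<integral>\<^sup>+y. b' (?S y) \<partial>lebesgue_prod ?J)"
      by (subst lebesgue_prod_shift[of d e, symmetric]) (rule nn_integral_distr[OF S], simp add: b'm)
    moreover have "block 0 e (?S y) = block d e y" for y by (auto simp: block_def)
    ultimately show ?thesis by (simp add: b_def b'_def)
  qed
  finally show ?thesis by (simp add: gaussian_integral_def a_def b'_def)
qed

section \<open>The disc\<close>

definition disc_gauge :: "real \<Rightarrow> (nat \<Rightarrow> real) \<Rightarrow> real" where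
  "disc_gauge R x = sqrt ((x 0)\<^sup>2 + (x 1)\<^sup>2) / R"

lemma sum_lessThan_two: "(\<Sum>i<2. f i) = f 0 + f 1" for f :: "nat \<Rightarrow> real"
  by (simp add: numeral_2_eq_2)

lemma asym_norm_disc_gauge:
  assumes R: "R > 0"
  shows "asym_norm 2 (disc_gauge R)"
  unfolding asym_norm_def
proof (intro conjI ballI allI impI)
  fix x :: "nat \<Rightarrow> real" and c :: real assume "c \<ge> 0"
  have "(c * x 0)\<^sup>2 + (c * x 1)\<^sup>2 = c\<^sup>2 * ((x 0)\<^sup>2 + (x 1)\<^sup>2)" by (simp add: power_mult_distrib distrib_left)
  then show "disc_gauge R (\<lambda>i. c * x i) = c * disc_gauge R x"
    using \<open>c \<ge> 0\<close> by (simp add: disc_gauge_def real_sqrt_mult)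
next
  fix x y :: "nat \<Rightarrow> real"
  show "disc_gauge R (\<lambda>i. x i + y i) \<le> disc_gauge R x + disc_gauge R y"
    using real_sqrt_sum_squares_triangle_ineq[of "x 0" "y 0" "x 1" "y 1"] R
    by (simp add: disc_gauge_def divide_right_mono add_divide_distrib[symmetric])
next
  have "1 / (2 * R) * (\<Sum>i<2. \<bar>x i\<bar>) \<le> disc_gauge R x" for x
  proof -
    have "\<bar>x 0\<bar> \<le> sqrt ((x 0)\<^sup>2 + (x 1)\<^sup>2)" "\<bar>x 1\<bar> \<le> sqrt ((x 0)\<^sup>2 + (x 1)\<^sup>2)"
      by (auto intro!: real_le_rsqrt)
    then have "\<bar>x 0\<bar> + \<bar>x 1\<bar> \<le> 2 * sqrt ((x 0)\<^sup>2 + (x 1)\<^sup>2)" by linarith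
    then have "(\<bar>x 0\<bar> + \<bar>x 1\<bar>) / (2 * R) \<le> 2 * sqrt ((x 0)\<^sup>2 + (x 1)\<^sup>2) / (2 * R)"
      using R by (intro divide_right_mono) auto
    then show ?thesis by (simp add: disc_gauge_def sum_lessThan_two)
  qed
  then show "\<exists>c>0. \<forall>x\<in>coord_space 2. c * (\<Sum>i<2. \<bar>x i\<bar>) \<le> disc_gauge R x"
    using R by (intro exI[of _ "1 / (2 * R)"]) auto
next
  have "disc_gauge R x \<le> 1 / R * (\<Sum>i<2. \<bar>x i\<bar>)" for x
    using sqrt_sum_squares_le_sum_abs[of "x 0" "x 1"] R
    by (simp add: disc_gauge_def sum_lessThan_two divide_right_mono)
  then show "\<exists>C\<ge>0. \<forall>x\<in>coord_space 2. disc_gauge R x \<le> C * (\<Sum>i<2. \<bar>x i\<bar>)"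
    using R by (intro exI[of _ "1 / R"]) auto
qed

lemma nn_integral_gaussian:
  assumes R: "R > 0"
  shows "(\<integral>\<^sup>+x. ennreal (exp (- (x / R)\<^sup>2)) \<partial>lborel) = ennreal (sqrt pi * R)"
proof -
  interpret N: prob_space "density lborel (normal_density 0 (R / sqrt 2))"
    using R by (intro prob_space_normal_density) simp
  have c: "sqrt (2 * pi * (R / sqrt 2)\<^sup>2) = sqrt pi * R" using R by (simp add: power_divide real_sqrt_mult)
  have "normal_density 0 (R / sqrt 2) x = 1 / (sqrt pi * R) * exp (- (x / R)\<^sup>2)" for x
    unfolding normal_density_def c by (simp add: power_divide)
  then have "1 = (\<integral>\<^sup>+x. ennreal (1 / (sqrt pi * R)) * ennreal (exp (- (x / R)\<^sup>2)) \<partial>lborel)"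
    using N.emeasure_space_1 R by (simp add: emeasure_density ennreal_mult[symmetric])
  also have "\<dots> = ennreal (1 / (sqrt pi * R)) * (\<integral>\<^sup>+x. ennreal (exp (- (x / R)\<^sup>2)) \<partial>lborel)"
    by (rule nn_integral_cmult) measurable
  finally have "ennreal (sqrt pi * R) * 1 = ennreal (sqrt pi * R) * ennreal (1 / (sqrt pi * R)) *
      (\<integral>\<^sup>+x. ennreal (exp (- (x / R)\<^sup>2)) \<partial>lborel)" by (simp only: mult.assoc)
  also have "ennreal (sqrt pi * R) * ennreal (1 / (sqrt pi * R)) = 1"
    using R by (simp add: ennreal_mult[symmetric])
  finally show ?thesis by simp
qed

lemma gaussian_integral_disc:
  assumes R: "R > 0"
  shows "gaussian_integral 2 (disc_gauge R) = ennreal (pi * R\<^sup>2)"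
proof -
  have "(disc_gauge R (block 0 2 x))\<^sup>2 = (x 0 / R)\<^sup>2 + (x 1 / R)\<^sup>2" for x
    using R by (simp add: disc_gauge_def block_def power_divide add_divide_distrib)
  then have "ennreal (exp (- (disc_gauge R (block 0 2 x))\<^sup>2)) = (\<Prod>i<2. ennreal (exp (- (x i / R)\<^sup>2)))" for x
    by (simp add: numeral_2_eq_2 exp_diff exp_minus ennreal_mult[symmetric] divide_inverse)
  then have "gaussian_integral 2 (disc_gauge R) = (\<integral>\<^sup>+x. (\<Prod>i<2. ennreal (exp (- (x i / R)\<^sup>2))) \<partial>lebesgue_prod {..<2})"
    by (simp add: gaussian_integral_def)
  also have "\<dots> = (\<Prod>i<2::nat. \<integral>\<^sup>+x. ennreal (exp (- (x / R)\<^sup>2)) \<partial>lborel)"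
    by (rule lborel_power.product_nn_integral_prod) auto
  also have "\<dots> = ennreal (sqrt pi * R) * ennreal (sqrt pi * R)"
    by (simp only: nn_integral_gaussian[OF R]) (simp add: numeral_2_eq_2)
  also have "\<dots> = ennreal (pi * R\<^sup>2)" using R by (simp add: ennreal_mult[symmetric] power2_eq_square mult.left_commute)
  finally show ?thesis .
qed

lemma disc_characteristic:
  assumes R: "R > 0"
  defines "\<gamma> \<equiv> \<lambda>t i. if i = 0 then R * cos (2 * pi * t) else if i = 1 then R * sin (2 * pi * t) else (0::real)"
  shows "gauge_characteristic 1 (disc_gauge R) \<gamma>"
  unfolding gauge_characteristic_def
proof (intro conjI allI impI ballI)
  have unit: "(R * cos s)\<^sup>2 + (R * sin s)\<^sup>2 = R\<^sup>2" for s
    by (simp add: power_mult_distrib distrib_left[symmetric])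
  have d0: "((\<lambda>t. \<gamma> t 0) has_real_derivative - (2 * pi) * \<gamma> t 1) (at t)" for t
    unfolding \<gamma>_def by (auto intro!: derivative_eq_intros)
  have d1: "((\<lambda>t. \<gamma> t 1) has_real_derivative 2 * pi * \<gamma> t 0) (at t)" for t
    unfolding \<gamma>_def by (auto intro!: derivative_eq_intros)
  have lt2: "i < 2 * 1 \<Longrightarrow> i = 0 \<or> i = 1" for i :: nat by auto
  show "\<gamma> 0 = \<gamma> 1" by (auto simp: \<gamma>_def)
  show "\<gamma> t \<in> coord_space (2 * 1)" for t by (auto simp: \<gamma>_def in_coord_space)
  show "disc_gauge R (\<gamma> t) = 1" for t using R unit by (simp add: disc_gauge_def \<gamma>_def)
  show "\<not> \<gamma> constant_on {0..1}"
  proof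
    assume "\<gamma> constant_on {0..1}"
    then obtain w where "\<And>t. t \<in> {0..1} \<Longrightarrow> \<gamma> t = w" by (auto simp: constant_on_def)
    from this[of 0] this[of "1/2"] have "\<gamma> 0 0 = \<gamma> (1/2) 0" by simp
    then show False using R by (simp add: \<gamma>_def)
  qed
  show "abs_continuous_on_Icc 0 1 (\<lambda>t. \<gamma> t i)" if "i < 2 * 1" for i
  proof (rule ac_lipschitz[where C = "2 * pi * R"])
    fix u v
    have b: "\<bar>\<gamma> t 0\<bar> \<le> R" "\<bar>\<gamma> t 1\<bar> \<le> R" for t using R by (auto simp: \<gamma>_def abs_mult)
    have "norm (\<gamma> v i - \<gamma> u i) \<le> 2 * pi * R * norm (v - u)"
    proof (rule field_differentiable_bound[of UNIV])
      fix t
      show "((\<lambda>t. \<gamma> t i) has_field_derivative (if i = 0 then - (2 * pi) * \<gamma> t 1 else 2 * pi * \<gamma> t 0)) (at t within UNIV)"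
        using lt2[OF that] d0 d1 by auto
      show "norm (if i = 0 then - (2 * pi) * \<gamma> t 1 else 2 * pi * \<gamma> t 0) \<le> 2 * pi * R"
        using b[of t] by (auto simp: abs_mult)
    qed auto
    then show "\<bar>\<gamma> v i - \<gamma> u i\<bar> \<le> 2 * pi * R * \<bar>v - u\<bar>" by simp
  qed
  have sup: "supports (2 * 1) (disc_gauge R) (\<lambda>i. 2 * pi * \<gamma> t i) (\<gamma> t)" for t
    unfolding supports_def
  proof (intro conjI ballI)
    show "(\<lambda>i. 2 * pi * \<gamma> t i) \<in> coord_space (2 * 1)" by (auto simp: \<gamma>_def in_coord_space)
    fix y assume "y \<in> coord_space (2 * 1)"
    have nz: "(\<gamma> t 0)\<^sup>2 + (\<gamma> t 1)\<^sup>2 = R\<^sup>2" using unit by (simp add: \<gamma>_def)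
    have "(\<gamma> t 0 * y 0 + \<gamma> t 1 * y 1)\<^sup>2 \<le> ((\<gamma> t 0)\<^sup>2 + (\<gamma> t 1)\<^sup>2) * ((y 0)\<^sup>2 + (y 1)\<^sup>2)"
      using zero_le_power2[of "\<gamma> t 0 * y 1 - \<gamma> t 1 * y 0"] by (simp add: power2_eq_square algebra_simps)
    then have "\<gamma> t 0 * y 0 + \<gamma> t 1 * y 1 \<le> sqrt (R\<^sup>2 * ((y 0)\<^sup>2 + (y 1)\<^sup>2))" unfolding nz by (rule real_le_rsqrt)
    also have "\<dots> = R\<^sup>2 * disc_gauge R y" using R by (simp add: real_sqrt_mult disc_gauge_def power2_eq_square)
    finally have "2 * pi * (\<gamma> t 0 * y 0 + \<gamma> t 1 * y 1) \<le> 2 * pi * (R\<^sup>2 * disc_gauge R y)"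
      by (intro mult_left_mono) auto
    moreover have "dot (2 * 1) (\<lambda>i. 2 * pi * \<gamma> t i) (\<gamma> t) = 2 * pi * R\<^sup>2"
      unfolding nz[symmetric] by (simp add: sum_lessThan_two power2_eq_square algebra_simps)
    moreover have "dot (2 * 1) (\<lambda>i. 2 * pi * \<gamma> t i) y = 2 * pi * (\<gamma> t 0 * y 0 + \<gamma> t 1 * y 1)"
      by (simp add: sum_lessThan_two algebra_simps)
    ultimately show "dot (2 * 1) (\<lambda>i. 2 * pi * \<gamma> t i) y
        \<le> dot (2 * 1) (\<lambda>i. 2 * pi * \<gamma> t i) (\<gamma> t) * disc_gauge R y" by (simp only: mult.assoc)
  qed
  show "AE t in lebesgue. t \<in> {0..1} \<longrightarrow> (\<exists>v. supports (2 * 1) (disc_gauge R) v (\<gamma> t) \<and>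
        (\<forall>i<2*1. ((\<lambda>s. \<gamma> s i) has_real_derivative cstruct v i) (at t)))"
  proof (intro AE_I2 impI exI conjI allI)
    fix t i assume "i < 2 * (1::nat)"
    then show "((\<lambda>s. \<gamma> s i) has_real_derivative cstruct (\<lambda>i. 2 * pi * \<gamma> t i) i) (at t)"
      using lt2[of i] d0[of t] d1[of t] by (auto simp: cstruct_def)
  qed (rule sup)
qed

text \<open>Normals of the disc are radial, by the equality case of the Cauchy-Schwarz inequality.\<close>

lemma disc_supports:
  assumes R: "R > 0" and z: "disc_gauge R z = 1" and v: "supports 2 (disc_gauge R) v z"
  defines "c \<equiv> dot 2 v z / R\<^sup>2"
  shows "v 0 = c * z 0" "v 1 = c * z 1"
proof -
  define V where "V = (v 0)\<^sup>2 + (v 1)\<^sup>2"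
  define k where "k = dot 2 v z"
  have "sqrt ((z 0)\<^sup>2 + (z 1)\<^sup>2) = R" using z R by (simp add: disc_gauge_def)
  then have zz: "(z 0)\<^sup>2 + (z 1)\<^sup>2 = R\<^sup>2" using real_sqrt_pow2[of "(z 0)\<^sup>2 + (z 1)\<^sup>2"] by simp
  have "dot 2 v v \<le> k * disc_gauge R v" using v by (simp add: supports_def k_def)
  then have "V \<le> k * (sqrt V / R)" by (simp add: sum_lessThan_two disc_gauge_def V_def power2_eq_square)
  then have "V * R \<le> k * sqrt V" using R by (simp add: field_simps)
  have V0: "V \<ge> 0" by (simp add: V_def)
  have "V * R\<^sup>2 \<le> k\<^sup>2"
  proof (cases "V = 0")
    case False
    then have "sqrt V > 0" using V0 by simp
    have "sqrt V * (sqrt V * R) = V * R"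
      unfolding mult.assoc[symmetric] real_sqrt_mult_self using V0 by simp
    then have "sqrt V * (sqrt V * R) \<le> sqrt V * k"
      using \<open>V * R \<le> k * sqrt V\<close> by (simp only: mult.commute[of k])
    then have "sqrt V * R \<le> k" using \<open>sqrt V > 0\<close> by simp
    then have "(sqrt V * R)\<^sup>2 \<le> k\<^sup>2" using R V0 by (intro power_mono) auto
    then show ?thesis using V0 by (simp add: power_mult_distrib)
  qed simp
  have "R\<^sup>2 * ((v 0 - c * z 0)\<^sup>2 + (v 1 - c * z 1)\<^sup>2) = R\<^sup>2 * (V - 2 * c * k + c\<^sup>2 * ((z 0)\<^sup>2 + (z 1)\<^sup>2))"
    by (simp add: V_def k_def sum_lessThan_two power2_eq_square algebra_simps)
  also have "\<dots> = V * R\<^sup>2 - k\<^sup>2"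
    unfolding zz using R by (simp add: c_def k_def[symmetric] power2_eq_square field_simps)
  also have "\<dots> \<le> 0" using \<open>V * R\<^sup>2 \<le> k\<^sup>2\<close> by simp
  finally have "(v 0 - c * z 0)\<^sup>2 + (v 1 - c * z 1)\<^sup>2 \<le> 0" using R by (simp add: mult_le_0_iff)
  then show "v 0 = c * z 0" "v 1 = c * z 1" by (simp_all add: sum_power2_le_zero_iff)
qed

lemma abs_le_abs_sin:
  fixes x :: real
  assumes "\<bar>x\<bar> \<le> 1"
  shows "cos 1 * \<bar>x\<bar> \<le> \<bar>sin x\<bar>"
proof -
  have pos: "cos 1 * y \<le> sin y" if y: "0 < y" "y \<le> 1" for y :: real
  proof -
    obtain z where z: "0 < z" "z < y" "sin y - sin 0 = (y - 0) * cos z"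
      using MVT2[of 0 y sin cos] y by (auto intro: DERIV_sin)
    have "cos 1 \<le> cos z" using z y pi_gt3 by (intro cos_monotone_0_pi_le) auto
    then show ?thesis using z y by (simp add: mult.commute mult_right_mono)
  qed
  show ?thesis
    using pos[of x] pos[of "-x"] assms by (cases x "0::real" rule: linorder_cases) auto
qed

text \<open>
  A closed characteristic on the circle winds monotonically: its angle is an absolutely continuous
  function whose derivative is proportional to the action density. A full non-trivial turn costs at
  least the area.
\<close>

lemma disc_action_lower_bound:
  assumes R: "R > 0" and "a \<in> action_spectrum 1 (disc_gauge R)"
  shows "a \<ge> pi * R\<^sup>2"
proof -
  obtain \<gamma> where a: "a = symp_action 1 \<gamma>" and \<gamma>: "gauge_characteristic 1 (disc_gauge R) \<gamma>"
    using assms(2) by (auto simp: action_spectrum_def)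
  have ac: "abs_continuous_on_Icc 0 1 (\<lambda>t. \<gamma> t i)" if "i < 2" for i
    using \<gamma> that unfolding gauge_characteristic_def by simp
  have cl: "\<gamma> 0 = \<gamma> 1" and nc: "\<not> \<gamma> constant_on {0..1}"
    and sph: "\<And>t. t \<in> {0..1} \<Longrightarrow> \<gamma> t \<in> coord_space 2 \<and> disc_gauge R (\<gamma> t) = 1"
    and ae: "AE t in lebesgue. t \<in> {0..1} \<longrightarrow> (\<exists>v. supports 2 (disc_gauge R) v (\<gamma> t) \<and>
        (\<forall>i<2. ((\<lambda>s. \<gamma> s i) has_real_derivative cstruct v i) (at t)))"
    using \<gamma> unfolding gauge_characteristic_def by simp_all
  define x where "x t = \<gamma> t 0 / R" for t
  define y where "y t = \<gamma> t 1 / R" for t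
  have xy: "(x t)\<^sup>2 + (y t)\<^sup>2 = 1" if "t \<in> {0..1}" for t
  proof -
    have "sqrt ((\<gamma> t 0)\<^sup>2 + (\<gamma> t 1)\<^sup>2) = R" using sph[OF that] R by (simp add: disc_gauge_def)
    then have "(\<gamma> t 0)\<^sup>2 + (\<gamma> t 1)\<^sup>2 = R\<^sup>2" using real_sqrt_pow2[of "(\<gamma> t 0)\<^sup>2 + (\<gamma> t 1)\<^sup>2"] by simp
    then show ?thesis using R by (simp add: x_def y_def power_divide add_divide_distrib[symmetric])
  qed
  have acx: "abs_continuous_on_Icc 0 1 x" and acy: "abs_continuous_on_Icc 0 1 y"
    using ac_affine[OF ac[of 0], of "1 / R" 0] ac_affine[OF ac[of 1], of "1 / R" 0]
    by (simp_all add: x_def[abs_def] y_def[abs_def])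
  define z where "z t = Complex (x t) (y t)" for t
  have cz: "continuous_on {0..1} z"
    unfolding z_def Complex_eq
    by (intro continuous_intros ac_imp_continuous_on[OF acx] ac_imp_continuous_on[OF acy])
  have nz: "norm (z t) = 1" if "t \<in> {0..1}" for t using xy[OF that] by (simp add: z_def cmod_def)
  have "z t \<noteq> 0" if "t \<in> {0..1}" for t using nz[OF that] by auto
  then obtain \<phi> where c\<phi>: "continuous_on {0..1} \<phi>" and \<phi>: "\<And>t. t \<in> {0..1} \<Longrightarrow> z t = exp (\<phi> t)"
    using continuous_logarithm_on_contractible[OF cz convex_imp_contractible[OF convex_real_interval(5)]] by blast
  define \<theta> where "\<theta> t = Im (\<phi> t)" for t
  have c\<theta>: "continuous_on {0..1} \<theta>" unfolding \<theta>_def by (intro continuous_intros c\<phi>)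
  have x\<theta>: "x t = cos (\<theta> t)" and y\<theta>: "y t = sin (\<theta> t)" if "t \<in> {0..1}" for t
  proof -
    have "exp (Re (\<phi> t)) = 1" using nz[OF that] \<phi>[OF that] by (simp add: norm_exp_eq_Re)
    then have "z t = Complex (cos (\<theta> t)) (sin (\<theta> t))"
      using \<phi>[OF that] by (simp add: exp_eq_polar \<theta>_def cis.ctr)
    then show "x t = cos (\<theta> t)" "y t = sin (\<theta> t)" by (simp_all add: z_def)
  qed
  have sin\<theta>: "sin (\<theta> s - \<theta> t) = y s * x t - x s * y t" if "s \<in> {0..1}" "t \<in> {0..1}" for s t
    using that by (simp add: x\<theta> y\<theta> sin_diff)
  obtain \<eta> where "\<eta> > 0" and \<eta>: "\<And>s t. s \<in> {0..1} \<Longrightarrow> t \<in> {0..1} \<Longrightarrow> \<bar>s - t\<bar> < \<eta> \<Longrightarrow> \<bar>\<theta> s - \<theta> t\<bar> < 1"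
  proof -
    have "\<exists>d>0. \<forall>t\<in>{0..1}. \<forall>s\<in>{0..1}. \<bar>s - t\<bar> < d \<longrightarrow> \<bar>\<theta> s - \<theta> t\<bar> < 1"
      using compact_uniformly_continuous[OF c\<theta> compact_Icc] unfolding uniformly_continuous_on_def dist_real_def
      by (elim allE[of _ 1]) simp
    then show ?thesis using that by blast
  qed
  have cos1: "cos (1::real) > 0" using pi_gt3 by (intro cos_gt_zero) auto
  have ac\<theta>: "abs_continuous_on_Icc 0 1 \<theta>"
  proof (rule ac_dominated[of UNIV 0 1 "\<lambda>b. if b then x else y" \<eta> "1 / cos 1"])
    fix u v :: real assume uv: "0 \<le> u" "u \<le> v" "v \<le> 1" "v - u < \<eta>"
    have "cos 1 * \<bar>\<theta> v - \<theta> u\<bar> \<le> \<bar>sin (\<theta> v - \<theta> u)\<bar>"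
      using \<eta>[of v u] uv by (intro abs_le_abs_sin) auto
    also have "\<dots> = \<bar>(y v - y u) * x u + - (x v - x u) * y u\<bar>"
      using uv by (subst sin\<theta>) (auto simp: algebra_simps)
    also have "\<dots> \<le> \<bar>y v - y u\<bar> * \<bar>x u\<bar> + \<bar>x v - x u\<bar> * \<bar>y u\<bar>"
      by (rule order_trans[OF abs_triangle_ineq]) (simp add: abs_mult abs_minus_commute)
    also have "\<dots> \<le> \<bar>y v - y u\<bar> * 1 + \<bar>x v - x u\<bar> * 1"
      using uv by (intro add_mono mult_left_mono) (auto simp: x\<theta> y\<theta>)
    finally have "cos 1 * \<bar>\<theta> v - \<theta> u\<bar> \<le> (\<Sum>b\<in>UNIV. \<bar>(if b then x else y) v - (if b then x else y) u\<bar>)"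
      by (simp add: UNIV_bool)
    then show "\<bar>\<theta> v - \<theta> u\<bar> \<le> 1 / cos 1 * (\<Sum>b\<in>UNIV. \<bar>(if b then x else y) v - (if b then x else y) u\<bar>)"
      using cos1 by (simp add: field_simps)
  qed (use acx acy \<open>\<eta> > 0\<close> cos1 in auto)
  have "AE t in lebesgue. t \<noteq> 0 \<and> t \<noteq> (1::real)"
    by (intro AE_completion) (auto intro: AE_lborel_singleton AE_conjI)
  with ae have ae\<theta>: "AE t in lebesgue. t \<in> {0..1} \<longrightarrow> (\<exists>v c. c \<ge> 0 \<and> dot 2 v (\<gamma> t) = R\<^sup>2 * c \<and>
      (\<forall>i<2. ((\<lambda>s. \<gamma> s i) has_real_derivative cstruct v i) (at t)) \<and> (\<theta> has_real_derivative c) (at t))"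
  proof eventually_elim
    case (elim t)
    show ?case
    proof
      assume t: "t \<in> {0..1}"
      then have t': "t \<in> {0<..<1}" using elim by auto
      obtain v where v: "supports 2 (disc_gauge R) v (\<gamma> t)"
        and d: "\<And>i. i < 2 \<Longrightarrow> ((\<lambda>s. \<gamma> s i) has_real_derivative cstruct v i) (at t)" using elim t by blast
      define c where "c = dot 2 v (\<gamma> t) / R\<^sup>2"
      have vc: "v 0 = c * \<gamma> t 0" "v 1 = c * \<gamma> t 1"
        unfolding c_def using disc_supports[OF R _ v] sph[OF t] by auto
      have "c \<ge> 0"
        using supports_nonneg[OF asym_norm_disc_gauge[OF R] _ v] sph[OF t] by (simp add: c_def)
      moreover have "dot 2 v (\<gamma> t) = R\<^sup>2 * c" using R by (simp add: c_def)
      moreover have "(\<theta> has_real_derivative c) (at t)"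
      proof -
        have dx: "(x has_real_derivative - c * y t) (at t)"
          using DERIV_cdivide[OF d[of 0], of R] vc R by (simp add: x_def[abs_def] y_def cstruct_def)
        have dy: "(y has_real_derivative c * x t) (at t)"
          using DERIV_cdivide[OF d[of 1], of R] vc R by (simp add: x_def y_def[abs_def] cstruct_def)
        define S where "S s = y s * x t - x s * y t" for s
        have "S t = 0" by (simp add: S_def)
        have "(S has_real_derivative (c * x t * x t - - c * y t * y t)) (at t)"
          unfolding S_def by (intro DERIV_diff DERIV_cmult_right dx dy)
        moreover have "c * x t * x t - - c * y t * y t = c * ((x t)\<^sup>2 + (y t)\<^sup>2)"
          by (simp add: power2_eq_square algebra_simps)
        ultimately have dS: "(S has_real_derivative c) (at t)" using xy[OF t] by simp
        have "(arcsin has_real_derivative 1) (at (S t))"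
          using DERIV_arcsin[of "S t"] \<open>S t = 0\<close> by simp
        from DERIV_chain2[OF this dS] have "((\<lambda>s. \<theta> t + arcsin (S s)) has_real_derivative (0 + 1 * c)) (at t)"
          by (intro DERIV_add DERIV_const)
        then have "((\<lambda>s. \<theta> t + arcsin (S s)) has_real_derivative c) (at t)" by simp
        then show ?thesis
        proof (rule has_field_derivative_transform_within_open)
          show "open ({0<..<1} \<inter> ball t \<eta>)" by auto
          show "t \<in> {0<..<1} \<inter> ball t \<eta>" using t' \<open>\<eta> > 0\<close> by simp
          fix s assume s: "s \<in> {0<..<1} \<inter> ball t \<eta>"
          then have "\<bar>\<theta> s - \<theta> t\<bar> < 1" using \<eta>[of s t] t by (auto simp: dist_real_def)
          then have "arcsin (sin (\<theta> s - \<theta> t)) = \<theta> s - \<theta> t" using pi_gt3 by (intro arcsin_sin) auto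
          then show "\<theta> t + arcsin (S s) = \<theta> s" using sin\<theta>[of s t] s t by (simp add: S_def)
        qed
      qed
      ultimately show "\<exists>v c. c \<ge> 0 \<and> dot 2 v (\<gamma> t) = R\<^sup>2 * c \<and>
        (\<forall>i<2. ((\<lambda>s. \<gamma> s i) has_real_derivative cstruct v i) (at t)) \<and> (\<theta> has_real_derivative c) (at t)"
        using d by blast
    qed
  qed
  \<comment> \<open>Truncation at \<open>0\<close> makes the derivative non-negative everywhere instead of almost everywhere.\<close>
  define D where "D t = max 0 (deriv \<theta> t)" for t
  have aeD: "AE t in lebesgue. t \<in> {0..1} \<longrightarrow> (\<theta> has_real_derivative D t) (at t)"
    using ae\<theta>
  proof eventually_elim
    case (elim t)
    then show ?case by (auto simp: D_def DERIV_imp_deriv max_absorb2)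
  qed
  obtain N where N: "negligible N" "\<forall>t\<in>{0..1} - N. (\<theta> has_real_derivative D t) (at t)"
    using AE_imp_negligible[OF aeD] by blast
  have hi: "(D has_integral (\<theta> v - \<theta> u)) {u..v}" if "0 \<le> u" "u \<le> v" "v \<le> 1" for u v
    by (rule ac_has_integral[OF ac_restrict[OF ac\<theta>] _ N(1)]) (use that N(2) in auto)
  have mono: "\<theta> u \<le> \<theta> v" if "0 \<le> u" "u \<le> v" "v \<le> 1" for u v
    using has_integral_nonneg[OF hi[OF that]] by (simp add: D_def)
  have lint: "(LINT t:{0..1}|lebesgue. D t) = \<theta> 1 - \<theta> 0"
  proof -
    have Dint: "D absolutely_integrable_on {0..1}"
      by (rule ac_derivative_absolutely_integrable[OF ac\<theta> _ N(1)]) (use N(2) in auto)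
    show ?thesis using set_lebesgue_integral_eq_integral(2)[OF Dint] integral_unique[OF hi[of 0 1]] by simp
  qed
  have "a = (LINT t:{0..1}|lebesgue. R\<^sup>2 / 2 * D t)"
    unfolding a symp_action_def
  proof (rule LINT_cong_AE_lebesgue)
    show "AE t in lebesgue. t \<in> {0..1} \<longrightarrow> liouville_form 1 (\<gamma> t) (\<lambda>i. deriv (\<lambda>s. \<gamma> s i) t) = R\<^sup>2 / 2 * D t"
      using ae\<theta>
    proof eventually_elim
      case (elim t)
      show ?case
      proof
        assume "t \<in> {0..1}"
        with elim obtain v c where c: "c \<ge> 0" "dot 2 v (\<gamma> t) = R\<^sup>2 * c" "(\<theta> has_real_derivative c) (at t)"
          and v: "\<forall>i<2. ((\<lambda>s. \<gamma> s i) has_real_derivative cstruct v i) (at t)" by blast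
        have "D t = c" using c by (simp add: D_def DERIV_imp_deriv)
        then show "liouville_form 1 (\<gamma> t) (\<lambda>i. deriv (\<lambda>s. \<gamma> s i) t) = R\<^sup>2 / 2 * D t"
          using liouville_form_velocity[of 1 \<gamma> v t] v c(2) by simp
      qed
    qed
  qed
  then have a\<theta>: "a = R\<^sup>2 / 2 * (\<theta> 1 - \<theta> 0)" using lint by simp
  have "sin (\<theta> 1) = sin (\<theta> 0) \<and> cos (\<theta> 1) = cos (\<theta> 0)"
    using cl x\<theta>[of 0] x\<theta>[of 1] y\<theta>[of 0] y\<theta>[of 1] by (simp add: x_def y_def)
  then obtain k :: int where k: "\<theta> 1 = \<theta> 0 + 2 * pi * k"
    using sin_cos_eq_iff[of "\<theta> 1" "\<theta> 0"] by auto
  have "\<theta> 1 \<noteq> \<theta> 0"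
  proof
    assume eq: "\<theta> 1 = \<theta> 0"
    have "\<gamma> t = \<gamma> 0" if t: "t \<in> {0..1}" for t
    proof -
      have "\<theta> t = \<theta> 0" using mono[of 0 t] mono[of t 1] eq t by simp
      then have "x t = x 0" "y t = y 0" using x\<theta> y\<theta> t by auto
      then have "\<gamma> t 0 = \<gamma> 0 0" "\<gamma> t 1 = \<gamma> 0 1" using R by (simp_all add: x_def y_def)
      moreover have "\<gamma> t i = \<gamma> 0 i" if "i \<ge> 2" for i using sph[OF t] sph[of 0] that by (simp add: in_coord_space)
      ultimately show ?thesis
        by (intro ext) (metis One_nat_def less_2_cases not_le)
    qed
    then have "\<gamma> constant_on {0..1}" unfolding constant_on_def by (intro exI ballI)
    with nc show False by contradiction
  qed
  moreover have "\<theta> 0 \<le> \<theta> 1" by (rule mono) auto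
  ultimately have "2 * pi * k > 0" using k by linarith
  then have "k \<ge> 1" by (simp add: zero_less_mult_iff)
  then have "2 * pi * 1 \<le> 2 * pi * real_of_int k" by (intro mult_left_mono) auto
  then have "R\<^sup>2 / 2 * (2 * pi * 1) \<le> R\<^sup>2 / 2 * (\<theta> 1 - \<theta> 0)" using k by (intro mult_left_mono) auto
  then show ?thesis using a\<theta> by (simp add: mult.commute)
qed

section \<open>Comparing dimensions\<close>

lemma sys_gauge_ball:
  assumes g: "asym_norm (2*n) g" and p: "p \<in> coord_space (2*n)"
  shows "sys n (gauge_ball (2*n) p g)
     = Inf (action_spectrum n g) / root n (enn2real (gaussian_integral (2*n) g))"
  unfolding sys_def c_EHZ_gauge_ball[OF assms] fact_vol_gauge_ball[OF assms] ..

text \<open>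
  A counterexample \<open>K\<close> has positive capacity \<open>c\<close>. Its two-product with the disc of area \<open>c\<close> is a
  counterexample in the next dimension: the capacity stays \<open>c\<close>, and the normalized volume is
  multiplied by \<open>c\<close>.
\<close>

lemma weak_Viterbo_Suc:
  assumes V: "weak_Viterbo (Suc n)" and n: "n \<ge> 1"
  shows "weak_Viterbo n"
  unfolding weak_Viterbo_def
proof (intro allI impI, rule ccontr)
  fix K assume K: "convex_body (2*n) K" and "\<not> sys n K \<le> 1"
  obtain p g where p: "p \<in> coord_space (2*n)" and g: "asym_norm (2*n) g" and Kg: "K = gauge_ball (2*n) p g"
    using convex_body_eq_gauge_ball[OF K] by blast
  define c where "c = Inf (action_spectrum n g)"
  define F where "F = enn2real (gaussian_integral (2*n) g)"
  have sys: "c / root n F > 1"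
    using \<open>\<not> sys n K \<le> 1\<close> by (simp add: Kg sys_gauge_ball[OF g p] c_def F_def)
  have F0: "F \<ge> 0" by (simp add: F_def)
  then have "root n F \<ge> 0" using n by (simp add: real_root_ge_zero)
  moreover have "root n F \<noteq> 0" using sys by auto
  ultimately have rF: "root n F > 0" by simp
  then have "F > 0" using n F0 by (metis less_eq_real_def real_root_zero less_irrefl)
  have cF: "root n F < c" using sys rF by (simp add: field_simps)
  then have c: "c > 0" using rF by simp
  have "F < c ^ n"
  proof -
    have "root n F ^ n < c ^ n" using cF rF n by (intro power_strict_mono) auto
    then show ?thesis using n F0 by simp
  qed
  define R where "R = sqrt (c / pi)"
  have R: "R > 0" "pi * R\<^sup>2 = c" using c by (simp_all add: R_def)
  have h: "asym_norm (2*1) (disc_gauge R)" using asym_norm_disc_gauge[OF R(1)] by simp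
  define G where "G = l2_gauge (2*n) (2*1) g (disc_gauge R)"
  have G: "asym_norm (2 * Suc n) G" using asym_norm_l2_gauge[OF g h] by (simp add: G_def)
  have spec: "action_spectrum (Suc n) G = action_spectrum n g \<union> action_spectrum 1 (disc_gauge R)"
    using action_spectrum_l2_gauge[OF g h] by (simp add: G_def)
  have "enn2real (gaussian_integral (2 * Suc n) G) = F * c"
    using gaussian_integral_l2_gauge[OF g h] gaussian_integral_disc[OF R(1)] R(2) c
    by (simp add: G_def F_def enn2real_mult)
  then have sG: "sys (Suc n) (gauge_ball (2 * Suc n) (\<lambda>i. 0) G) = Inf (action_spectrum (Suc n) G) / root (Suc n) (F * c)"
    using sys_gauge_ball[OF G, of "\<lambda>i. 0"] by simp
  \<comment> \<open>The circle provides an element of the spectrum, so that the infimum is a genuine one.\<close>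
  have "c \<le> Inf (action_spectrum (Suc n) G)"
  proof (rule cInf_greatest)
    show "action_spectrum (Suc n) G \<noteq> {}"
      using disc_characteristic[OF R(1)] unfolding spec by (auto simp: action_spectrum_def)
    fix a assume "a \<in> action_spectrum (Suc n) G"
    then show "c \<le> a"
      unfolding spec
    proof
      assume "a \<in> action_spectrum n g"
      then show "c \<le> a" unfolding c_def
        using action_spectrum_nonneg[OF g] by (intro cInf_lower bdd_belowI[of _ 0])
    next
      assume "a \<in> action_spectrum 1 (disc_gauge R)"
      then show "c \<le> a" using disc_action_lower_bound[OF R(1)] R(2) by simp
    qed
  qed
  moreover have "root (Suc n) (F * c) < c"
  proof -
    have "F * c < c ^ Suc n" using \<open>F < c ^ n\<close> c by (simp add: mult.commute)
    then have "root (Suc n) (F * c) < root (Suc n) (c ^ Suc n)" by simp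
    also have "\<dots> = c" using c by (intro real_root_power_cancel) auto
    finally show ?thesis .
  qed
  moreover have "root (Suc n) (F * c) > 0" using \<open>F > 0\<close> c by simp
  ultimately have "sys (Suc n) (gauge_ball (2 * Suc n) (\<lambda>i. 0) G) > 1" unfolding sG by simp
  moreover have "sys (Suc n) (gauge_ball (2 * Suc n) (\<lambda>i. 0) G) \<le> 1"
    using V convex_body_gauge_ball[OF G] unfolding weak_Viterbo_def by blast
  ultimately show False by simp
qed

text \<open>Iterated two-products of a body with itself keep the spectrum and raise the volume term to a power.\<close>

lemma l2_power_same_sys:
  assumes g: "asym_norm (2*n) g"
  shows "\<exists>G. asym_norm (2 * (Suc k * n)) G \<and> action_spectrum (Suc k * n) G = action_spectrum n g \<and>
     gaussian_integral (2 * (Suc k * n)) G = gaussian_integral (2*n) g ^ Suc k"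
proof (induction k)
  case 0
  show ?case using g by (intro exI[of _ g]) simp
next
  case (Suc k)
  then obtain G where G: "asym_norm (2 * (Suc k * n)) G" "action_spectrum (Suc k * n) G = action_spectrum n g"
    "gaussian_integral (2 * (Suc k * n)) G = gaussian_integral (2*n) g ^ Suc k" by blast
  have dim: "Suc k * n + n = Suc (Suc k) * n" "2 * (Suc k * n) + 2 * n = 2 * (Suc (Suc k) * n)" by simp_all
  show ?case
    using asym_norm_l2_gauge[OF G(1) g] action_spectrum_l2_gauge[OF G(1) g] gaussian_integral_l2_gauge[OF G(1) g] G
    unfolding dim by (intro exI[of _ "l2_gauge (2 * (Suc k * n)) (2*n) G g"]) (simp add: mult.commute)
qed

text \<open>
  All two-powers of a body have its systolic ratio, while their dimensions grow without bound.
\<close>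

lemma weak_Viterbo_of_asymptotic_bound:
  fixes \<alpha> :: "nat \<Rightarrow> real"
  assumes \<alpha>: "\<alpha> \<longlonglongrightarrow> 1" and bound: "\<And>n K. n \<ge> 1 \<Longrightarrow> convex_body (2*n) K \<Longrightarrow> sys n K \<le> \<alpha> n"
    and n: "n \<ge> 1"
  shows "weak_Viterbo n"
  unfolding weak_Viterbo_def
proof (intro allI impI)
  fix K assume K: "convex_body (2*n) K"
  obtain p g where p: "p \<in> coord_space (2*n)" and g: "asym_norm (2*n) g" and Kg: "K = gauge_ball (2*n) p g"
    using convex_body_eq_gauge_ball[OF K] by blast
  have "sys n K \<le> \<alpha> (Suc k * n)" for k
  proof -
    obtain G where G: "asym_norm (2 * (Suc k * n)) G" "action_spectrum (Suc k * n) G = action_spectrum n g"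
      "gaussian_integral (2 * (Suc k * n)) G = gaussian_integral (2*n) g ^ Suc k"
      using l2_power_same_sys[OF g] by blast
    let ?F = "enn2real (gaussian_integral (2*n) g)"
    have pow: "enn2real (x ^ m) = enn2real x ^ m" for x m by (induction m) (simp_all add: enn2real_mult)
    have "root (Suc k * n) (enn2real (gaussian_integral (2 * (Suc k * n)) G)) = root (Suc k * n) (?F ^ Suc k)"
      unfolding G(3) pow ..
    also have "\<dots> = root n (root (Suc k) (?F ^ Suc k))"
      by (simp only: real_root_mult_exp mult.commute[of "Suc k" n])
    also have "root (Suc k) (?F ^ Suc k) = ?F" by (rule real_root_power_cancel) auto
    finally have "sys (Suc k * n) (gauge_ball (2 * (Suc k * n)) (\<lambda>i. 0) G) = sys n K"
      using sys_gauge_ball[OF G(1), of "\<lambda>i. 0"] G(2) sys_gauge_ball[OF g p] Kg by simp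
    moreover have "sys (Suc k * n) (gauge_ball (2 * (Suc k * n)) (\<lambda>i. 0) G) \<le> \<alpha> (Suc k * n)"
      using n by (intro bound convex_body_gauge_ball[OF G(1)]) simp
    ultimately show ?thesis by simp
  qed
  moreover have "(\<lambda>k. \<alpha> (Suc k * n)) \<longlonglongrightarrow> 1"
  proof (rule filterlim_compose[OF \<alpha>])
    have "strict_mono (\<lambda>k. Suc k * n)" using n by (auto simp: strict_mono_def)
    then show "filterlim (\<lambda>k. Suc k * n) sequentially sequentially" by (rule filterlim_subseq)
  qed
  ultimately show "sys n K \<le> 1" by (intro LIMSEQ_le_const) auto
qed

theorem corollary1p4:
  shows "(\<forall>n>1. weak_Viterbo n \<longrightarrow> (\<forall>m. 1 \<le> m \<and> m \<le> n \<longrightarrow> weak_Viterbo m)) \<and>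
         ((\<exists>\<alpha> :: nat \<Rightarrow> real. \<alpha> \<longlonglongrightarrow> 1 \<and>
             (\<forall>n\<ge>1. \<forall>K. convex_body (2*n) K \<longrightarrow> sys n K \<le> \<alpha> n)) \<longrightarrow>
          (\<forall>n\<ge>1. weak_Viterbo n))"
proof (intro conjI allI impI)
  fix n m :: nat assume V: "weak_Viterbo n" and m: "1 \<le> m \<and> m \<le> n"
  have "m \<le> n" using m by simp
  then show "weak_Viterbo m"
    by (induction rule: inc_induct) (use V m weak_Viterbo_Suc in auto)
next
  fix n :: nat
  assume "\<exists>\<alpha> :: nat \<Rightarrow> real. \<alpha> \<longlonglongrightarrow> 1 \<and> (\<forall>n\<ge>1. \<forall>K. convex_body (2*n) K \<longrightarrow> sys n K \<le> \<alpha> n)" and n: "1 \<le> n"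
  then obtain \<alpha> :: "nat \<Rightarrow> real" where "\<alpha> \<longlonglongrightarrow> 1" "\<And>n K. n \<ge> 1 \<Longrightarrow> convex_body (2*n) K \<Longrightarrow> sys n K \<le> \<alpha> n" by blast
  then show "weak_Viterbo n" using n by (rule weak_Viterbo_of_asymptotic_bound)
qed

end
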